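(* Let $(\Omega,\mathcal{F},\mathbb{P})$ be a probability space with a filtration satisfying the usual conditions, carrying two standard Brownian motions $W$ and $Z$ with $d\langle W,Z\rangle_t=\rho\,dt$, where $\rho\in[-1,1]$. Let $Y$ be the geometric Brownian motion solving $dY_t=Y_t\,dZ_t$, $Y_0=1$ (so $Y_t=e^{Z_t-t/2}$), and let $X$ be the asset price process solving $dX_t=Y_tX_t\,dW_t$, $X_0=1$, i.e. $$X_t=\exp\Big(\int_0^tY_u\,dW_u-\tfrac12\int_0^tY_u^2\,du\Big).$$ Let $\alpha>0$ satisfy $\alpha(1-\rho^2)<1$ and put $\beta=\sqrt{\alpha-\alpha^2(1-\rho^2)}$. Let $B$ be a standard Brownian motion and define $$\Gamma_t=\frac{e^{B_t-t/2}}{1+\beta\int_0^te^{B_s-s/2}\,ds}.$$ Then for every $t\ge 0$, $$\mathbb{E}X_t^{\alpha}=e^{-(\beta+\rho\alpha)}\,\mathbb{E}\exp\big((\beta+\rho\alpha)\Gamma_t\big).$$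
   Context: This is the lognormal stochastic volatility (Hull–White) model; the savings account is identically $1$. *)

theory Defs
  imports "HOL-Probability.Probability"
begin

definition filtration :: "'a measure \<Rightarrow> (real \<Rightarrow> 'a measure) \<Rightarrow> bool" where
  "filtration M F \<longleftrightarrow> (\<forall>t. subalgebra M (F t)) \<and>
     (\<forall>s t. 0 \<le> s \<longrightarrow> s \<le> t \<longrightarrow> sets (F s) \<subseteq> sets (F t))"

definition usual_conditions :: "'a measure \<Rightarrow> (real \<Rightarrow> 'a measure) \<Rightarrow> bool" where
  "usual_conditions M F \<longleftrightarrow> filtration M F \<and>
     (\<forall>t\<ge>0. sets (F t) = (\<Inter>u\<in>{t<..}. sets (F u))) \<and>
     null_sets M \<subseteq> sets (F 0)"

definition bm_filt :: "'a measure \<Rightarrow> (real \<Rightarrow> 'a measure) \<Rightarrow> (real \<Rightarrow> 'a \<Rightarrow> real) \<Rightarrow> bool" where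
  "bm_filt M F W \<longleftrightarrow>
     (AE \<omega> in M. W 0 \<omega> = 0) \<and>
     (AE \<omega> in M. continuous_on {0..} (\<lambda>t. W t \<omega>)) \<and>
     (\<forall>t\<ge>0. W t \<in> borel_measurable (F t)) \<and>
     (\<forall>s t. 0 \<le> s \<longrightarrow> s < t \<longrightarrow>
        distributed M lborel (\<lambda>\<omega>. W t \<omega> - W s \<omega>) (normal_density 0 (sqrt (t - s))) \<and>
        prob_space.indep_set M (sets (F s))
          {(\<lambda>\<omega>. W t \<omega> - W s \<omega>) -` A \<inter> space M | A. A \<in> sets borel})"

definition standard_bm :: "'a measure \<Rightarrow> (real \<Rightarrow> 'a \<Rightarrow> real) \<Rightarrow> bool" where
  "standard_bm M W \<longleftrightarrow> (\<exists>F. filtration M F \<and> bm_filt M F W)"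

definition lim_in_prob :: "'a measure \<Rightarrow> (nat \<Rightarrow> 'a \<Rightarrow> real) \<Rightarrow> ('a \<Rightarrow> real) \<Rightarrow> bool" where
  "lim_in_prob M S L \<longleftrightarrow>
     (\<forall>e>0. (\<lambda>n. measure M {\<omega> \<in> space M. e < \<bar>S n \<omega> - L \<omega>\<bar>}) \<longlonglongrightarrow> 0)"

definition riemann_sum :: "(real \<Rightarrow> 'a \<Rightarrow> real) \<Rightarrow> (real \<Rightarrow> 'a \<Rightarrow> real) \<Rightarrow> real \<Rightarrow> nat \<Rightarrow> 'a \<Rightarrow> real" where
  "riemann_sum H V t n \<omega> =
     (\<Sum>k<n. H (real k * t / real n) \<omega> *
        (V (real (Suc k) * t / real n) \<omega> - V (real k * t / real n) \<omega>))"

(* I is the Ito integral int_0^t H dW (continuous adapted H): limit in probability of left Riemann sums *)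
definition ito_integral_is :: "'a measure \<Rightarrow> (real \<Rightarrow> 'a \<Rightarrow> real) \<Rightarrow> (real \<Rightarrow> 'a \<Rightarrow> real) \<Rightarrow> real \<Rightarrow> ('a \<Rightarrow> real) \<Rightarrow> bool" where
  "ito_integral_is M H W t I \<longleftrightarrow> I \<in> borel_measurable M \<and> lim_in_prob M (riemann_sum H W t) I"

definition qcov_sum :: "(real \<Rightarrow> 'a \<Rightarrow> real) \<Rightarrow> (real \<Rightarrow> 'a \<Rightarrow> real) \<Rightarrow> real \<Rightarrow> nat \<Rightarrow> 'a \<Rightarrow> real" where
  "qcov_sum W Z t n \<omega> =
     (\<Sum>k<n. (W (real (Suc k) * t / real n) \<omega> - W (real k * t / real n) \<omega>) *
             (Z (real (Suc k) * t / real n) \<omega> - Z (real k * t / real n) \<omega>))"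

definition covariation_is :: "'a measure \<Rightarrow> (real \<Rightarrow> 'a \<Rightarrow> real) \<Rightarrow> (real \<Rightarrow> 'a \<Rightarrow> real) \<Rightarrow> real \<Rightarrow> ('a \<Rightarrow> real) \<Rightarrow> bool" where
  "covariation_is M W Z t C \<longleftrightarrow> lim_in_prob M (qcov_sum W Z t) C"

end

theory Submission
  imports Defs
begin

text \<open>
  Put \<open>c = \<beta> + \<rho> \<alpha>\<close>. Since \<open>\<alpha>\<^sup>2 - 2 \<rho> \<alpha> c + c\<^sup>2 = \<alpha>\<close>, the variable \<open>X\<^sub>t\<^sup>\<alpha>\<close> equals \<open>exp (c (Y\<^sub>t - 1))\<close> times the
  stochastic exponential of \<open>\<alpha> \<integral> Y dW - c \<integral> Y dZ\<close>, and under the measure with that density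
  \<open>Z + \<beta> \<integral> Y\<close> is a Brownian motion, so that \<open>Y\<close> has the law of \<open>\<Gamma>\<close>.

  The change of measure is done exactly on grids: if the drift over a step \<open>h\<close> is taken to be
  \<open>ln (1 + \<beta> h Y)\<close>, the tilted chain is the discretisation of \<open>\<Gamma>\<close> in which the time integral is
  replaced by its left Riemann sum. The expectations may be infinite and the densities need not be
  uniformly integrable, so paths above a level \<open>m\<close> are killed before refining the grid; killed
  densities are bounded in \<open>L\<^sup>2\<close>, and each inequality of the theorem follows by Fatou's lemma on one
  side, bounded convergence on the other, and then letting \<open>m \<rightarrow> \<infinity>\<close>.

  The grid identity needs the joint law of the increments of \<open>W\<close> and \<open>Z\<close>, which is not assumed but
  forced by the covariation (Levy's characterisation): the products of \<open>1 + \<i> \<Delta>(a W + b Z)\<close> over finer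
  and finer subdivisions are complex martingales bounded in \<open>L\<^sup>2\<close> which converge to
  \<open>exp (\<i> (a W + b Z) + (a\<^sup>2 + 2 \<rho> a b + b\<^sup>2) t / 2)\<close>.
\<close>

text \<open>The equation for c is quadratic, c^2 - 2 \<rho> \<alpha> c + \<alpha>^2 - \<alpha> = 0,
  with roots \<rho> \<alpha> + \<beta> and \<rho> \<alpha> - \<beta>; the condition \<alpha> (1 -
  \<rho>^2) < 1 says that its discriminant is positive. The term c \<integral> Y dZ costs only an
  endpoint factor because \<integral> Y dZ = Y_t - 1. The covariation of the tilting exponent with Z
  has density (\<rho> \<alpha> - c) Y = - \<beta> Y, so the tilted equation is dY = Y dB - \<beta>
  Y^2 dt. The reciprocal of Y then solves a linear equation, whose solution is the reciprocal of
  \<Gamma>; the larger root keeps the denominator of \<Gamma> positive. On a grid both killed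
  expectations are the same iterate of \<open>trans_op\<close> evaluated at 1, and this exact
  equality is the only link between the two probability spaces. The two inequalities in the limit
  are not symmetric: killing makes the integrand bounded on the side of \<Gamma>, but on the side of
  X the stochastic density remains unbounded.\<close>

subsection \<open>Centred normal laws\<close>

text \<open>The case \<open>\<sigma> = 0\<close> is the point mass at the origin; it occurs for perfect correlation.\<close>

definition normal_law :: "real \<Rightarrow> real measure" where
  "normal_law \<sigma> = distr std_normal_distribution borel (\<lambda>x. \<sigma> * x)"

lemma sets_normal_law [simp, measurable_cong]: "sets (normal_law \<sigma>) = sets borel"
  by (simp add: normal_law_def)

lemma space_normal_law [simp]: "space (normal_law \<sigma>) = UNIV"
  by (simp add: normal_law_def)

lemma prob_space_std_normal: "prob_space std_normal_distribution"
  using real_dist_normal_dist by (simp add: real_distribution_def)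

lemma real_distribution_normal_law: "real_distribution (normal_law \<sigma>)"
  unfolding normal_law_def
  by (intro prob_space.real_distribution_distr prob_space_std_normal) simp

lemma char_normal_law: "char (normal_law \<sigma>) u = complex_of_real (exp (- (\<sigma> * u)\<^sup>2 / 2))"
proof -
  have "char (normal_law \<sigma>) u = char std_normal_distribution (u * \<sigma>)"
    unfolding normal_law_def char_def by (subst integral_distr) (auto simp: mult.assoc)
  then show ?thesis by (simp add: char_std_normal_distribution mult.commute)
qed

lemma nn_integral_normal_law:
  "f \<in> borel_measurable borel \<Longrightarrow>
    (\<integral>\<^sup>+x. f x \<partial>normal_law \<sigma>) = (\<integral>\<^sup>+x. f (\<sigma> * x) \<partial>std_normal_distribution)"
  unfolding normal_law_def by (subst nn_integral_distr) auto

lemma integrable_normal_law_iff: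
  fixes f :: "real \<Rightarrow> 'b::{banach, second_countable_topology}"
  shows "f \<in> borel_measurable borel \<Longrightarrow>
    integrable (normal_law \<sigma>) f \<longleftrightarrow> integrable std_normal_distribution (\<lambda>x. f (\<sigma> * x))"
  unfolding normal_law_def by (subst integrable_distr_eq) auto

lemma integral_normal_law:
  fixes f :: "real \<Rightarrow> 'b::{banach, second_countable_topology}"
  shows "f \<in> borel_measurable borel \<Longrightarrow>
    integral\<^sup>L (normal_law \<sigma>) f = (\<integral>x. f (\<sigma> * x) \<partial>std_normal_distribution)"
  unfolding normal_law_def by (subst integral_distr) auto

text \<open>Completing the square: the exponential weight turns the standard Gaussian density into
  the one centred at \<open>c\<close>. The change of measure over a grid step is built from this
  one-dimensional case.\<close>

lemma std_normal_tilt: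
  "density std_normal_distribution (\<lambda>x. ennreal (exp (c * x - c\<^sup>2 / 2)))
    = distr std_normal_distribution borel (\<lambda>x. x + c)"
proof (rule measure_eqI)
  fix A assume A: "A \<in> sets (density std_normal_distribution (\<lambda>x. ennreal (exp (c * x - c\<^sup>2 / 2))))"
  then have [measurable]: "A \<in> sets borel" by simp
  have d: "std_normal_density x * exp (c * x - c\<^sup>2 / 2) = std_normal_density (x - c)" for x
  proof -
    have "- x\<^sup>2 / 2 + (c * x - c\<^sup>2 / 2) = - (x - c)\<^sup>2 / 2"
      by (simp add: field_simps power2_eq_square)
    then show ?thesis by (simp add: std_normal_density_def flip: exp_add)
  qed
  have "emeasure (density std_normal_distribution (\<lambda>x. ennreal (exp (c * x - c\<^sup>2 / 2)))) A
      = (\<integral>\<^sup>+x. ennreal (std_normal_density x) * (ennreal (exp (c * x - c\<^sup>2 / 2)) * indicator A x) \<partial>lborel)"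
    by (simp add: emeasure_density nn_integral_density)
  also have "\<dots> = (\<integral>\<^sup>+x. ennreal (std_normal_density (x - c)) * indicator A x \<partial>lborel)"
    by (intro nn_integral_cong) (simp flip: d add: ennreal_mult mult.assoc)
  also have "\<dots> = (\<integral>\<^sup>+x. ennreal (std_normal_density x) * indicator A (x + c) \<partial>lborel)"
    by (subst nn_integral_real_affine[where c = 1 and t = c]) (auto simp: add.commute)
  also have "\<dots> = (\<integral>\<^sup>+x. ennreal (std_normal_density x) * indicator ((\<lambda>x. x + c) -` A) x \<partial>lborel)"
    by (intro nn_integral_cong) (auto split: split_indicator)
  also have "\<dots> = emeasure std_normal_distribution ((\<lambda>x. x + c) -` A)"
    using measurable_sets_borel[of "\<lambda>x. x + c" borel A] by (subst emeasure_density) auto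
  also have "\<dots> = emeasure (distr std_normal_distribution borel (\<lambda>x. x + c)) A"
    by (simp add: emeasure_distr)
  finally show "emeasure (density std_normal_distribution (\<lambda>x. ennreal (exp (c * x - c\<^sup>2 / 2)))) A
      = emeasure (distr std_normal_distribution borel (\<lambda>x. x + c)) A" .
qed simp

lemma std_normal_shift:
  assumes [measurable]: "f \<in> borel_measurable borel"
  shows "(\<integral>\<^sup>+x. ennreal (exp (c * x - c\<^sup>2 / 2)) * f x \<partial>std_normal_distribution)
    = (\<integral>\<^sup>+x. f (x + c) \<partial>std_normal_distribution)"
proof -
  have "(\<integral>\<^sup>+x. ennreal (exp (c * x - c\<^sup>2 / 2)) * f x \<partial>std_normal_distribution)
    = (\<integral>\<^sup>+x. f x \<partial>density std_normal_distribution (\<lambda>x. ennreal (exp (c * x - c\<^sup>2 / 2))))"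
    by (subst nn_integral_density) auto
  also have "\<dots> = (\<integral>\<^sup>+x. f (x + c) \<partial>std_normal_distribution)"
    unfolding std_normal_tilt by (subst nn_integral_distr) auto
  finally show ?thesis .
qed

lemma std_normal_mgf_nn:
  "(\<integral>\<^sup>+x. ennreal (exp (c * x)) \<partial>std_normal_distribution) = ennreal (exp (c\<^sup>2 / 2))"
proof -
  have "(\<integral>\<^sup>+x. ennreal (exp (c * x)) \<partial>std_normal_distribution)
     = (\<integral>\<^sup>+x. ennreal (exp (c * x - c\<^sup>2 / 2)) * ennreal (exp (c\<^sup>2 / 2)) \<partial>std_normal_distribution)"
    by (intro nn_integral_cong) (simp flip: ennreal_mult exp_add)
  also have "\<dots> = ennreal (exp (c\<^sup>2 / 2))"
    using prob_space.emeasure_space_1[OF prob_space_std_normal]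
    by (subst std_normal_shift) (auto simp: space_density)
  finally show ?thesis .
qed

lemma std_normal_mgf:
  "integrable std_normal_distribution (\<lambda>x. exp (c * x))"
  "(\<integral>x. exp (c * x) \<partial>std_normal_distribution) = exp (c\<^sup>2 / 2)"
  using has_bochner_integral_nn_integral[of "\<lambda>x. exp (c * x)" std_normal_distribution "exp (c\<^sup>2 / 2)"]
  by (auto simp: std_normal_mgf_nn has_bochner_integral_iff)

text \<open>Under the tilted law the variable has mean \<open>c\<close>; this is the cross term in
  the variance of the exponential remainder below.\<close>

lemma std_normal_exp_id:
  "integrable std_normal_distribution (\<lambda>x. exp (c * x - c\<^sup>2 / 2) * x)"
  "(\<integral>x. exp (c * x - c\<^sup>2 / 2) * x \<partial>std_normal_distribution) = c"
proof -
  interpret G: prob_space std_normal_distribution by (rule prob_space_std_normal)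
  have G1: "measure std_normal_distribution UNIV = 1" using G.prob_space by simp
  have i: "integrable std_normal_distribution (\<lambda>x. x)"
    using integrable_std_normal_distribution_moment[of 1] by simp
  have z: "(\<integral>x. x \<partial>std_normal_distribution) = 0"
    using integral_std_normal_distribution_moment_odd[of 1] by simp
  have "integrable (density std_normal_distribution (\<lambda>x. ennreal (exp (c * x - c\<^sup>2 / 2)))) (\<lambda>x. x)"
    unfolding std_normal_tilt by (subst integrable_distr_eq) (auto intro!: i)
  then show "integrable std_normal_distribution (\<lambda>x. exp (c * x - c\<^sup>2 / 2) * x)"
    by (subst (asm) integrable_density) auto
  have "(\<integral>x. x \<partial>density std_normal_distribution (\<lambda>x. ennreal (exp (c * x - c\<^sup>2 / 2)))) = c"
  proof -
    have "(\<integral>x. x \<partial>distr std_normal_distribution borel (\<lambda>x. x + c)) = (\<integral>x. x + c \<partial>std_normal_distribution)"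
      by (rule integral_distr) simp_all
    also have "\<dots> = (\<integral>x. x \<partial>std_normal_distribution) + (\<integral>x. c \<partial>std_normal_distribution)"
      by (rule Bochner_Integration.integral_add[OF i G.integrable_const])
    also have "\<dots> = c" unfolding z by (simp add: G1)
    finally show ?thesis unfolding std_normal_tilt .
  qed
  then show "(\<integral>x. exp (c * x - c\<^sup>2 / 2) * x \<partial>std_normal_distribution) = c"
    by (subst (asm) integral_density) auto
qed

text \<open>Cancellation to first order: the error of the Euler step for the exponential martingale
  has variance of order \<open>\<sigma>\<^sup>4\<close>.\<close>

lemma std_normal_exp_remainder:
  fixes \<sigma> :: real
  defines "r \<equiv> \<lambda>x. exp (\<sigma> * x - \<sigma>\<^sup>2 / 2) - 1 - \<sigma> * x"
  shows "integrable std_normal_distribution (\<lambda>x. (r x)\<^sup>2)"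
    and "(\<integral>x. r x \<partial>std_normal_distribution) = 0"
    and "(\<integral>x. (r x)\<^sup>2 \<partial>std_normal_distribution) = exp (\<sigma>\<^sup>2) - 1 - \<sigma>\<^sup>2"
proof -
  interpret G: prob_space std_normal_distribution by (rule prob_space_std_normal)
  have i[simp]: "integrable std_normal_distribution (\<lambda>x. x)"
    using integrable_std_normal_distribution_moment[of 1] by simp
  have z[simp]: "(\<integral>x. x \<partial>std_normal_distribution) = 0"
    using integral_std_normal_distribution_moment_odd[of 1] by simp
  have i2[simp]: "integrable std_normal_distribution (\<lambda>x. x\<^sup>2)"
    using integrable_std_normal_distribution_moment[of 2] by simp
  have z2[simp]: "(\<integral>x. x\<^sup>2 \<partial>std_normal_distribution) = 1"
    using std_normal_distribution_even_moments(1)[of 1] by simp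
  have G1[simp]: "measure std_normal_distribution UNIV = 1" using G.prob_space by simp
  note [simp] = std_normal_exp_id[of \<sigma>]
  have e: "exp (\<sigma> * x - \<sigma>\<^sup>2 / 2) = exp (-\<sigma>\<^sup>2 / 2) * exp (\<sigma> * x)" for x
    by (simp flip: exp_add)
  have ie[simp]: "integrable std_normal_distribution (\<lambda>x. exp (\<sigma> * x - \<sigma>\<^sup>2 / 2))"
    unfolding e by (intro integrable_mult_right std_normal_mgf)
  have ve[simp]: "(\<integral>x. exp (\<sigma> * x - \<sigma>\<^sup>2 / 2) \<partial>std_normal_distribution) = 1"
    unfolding e integral_mult_right_zero std_normal_mgf by (simp flip: exp_add)
  have e2: "(exp (\<sigma> * x - \<sigma>\<^sup>2 / 2))\<^sup>2 = exp (-\<sigma>\<^sup>2) * exp ((2*\<sigma>) * x)" for x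
    by (simp add: power2_eq_square algebra_simps flip: exp_add)
  have ie2[simp]: "integrable std_normal_distribution (\<lambda>x. (exp (\<sigma> * x - \<sigma>\<^sup>2 / 2))\<^sup>2)"
    unfolding e2 by (intro integrable_mult_right std_normal_mgf)
  have ve2[simp]: "(\<integral>x. (exp (\<sigma> * x - \<sigma>\<^sup>2 / 2))\<^sup>2 \<partial>std_normal_distribution) = exp (\<sigma>\<^sup>2)"
    unfolding e2 integral_mult_right_zero std_normal_mgf by (simp add: power_mult_distrib flip: exp_add)
  show "(\<integral>x. r x \<partial>std_normal_distribution) = 0"
    unfolding r_def by simp
  have sq: "(r x)\<^sup>2 = (exp (\<sigma> * x - \<sigma>\<^sup>2 / 2))\<^sup>2 + 1 + \<sigma>\<^sup>2 * x\<^sup>2 - 2 * exp (\<sigma> * x - \<sigma>\<^sup>2 / 2)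
      - 2 * \<sigma> * (exp (\<sigma> * x - \<sigma>\<^sup>2 / 2) * x) + 2 * \<sigma> * x" for x
    unfolding r_def by (simp add: power2_eq_square algebra_simps)
  show "integrable std_normal_distribution (\<lambda>x. (r x)\<^sup>2)"
    unfolding sq
    by (intro Bochner_Integration.integrable_add Bochner_Integration.integrable_diff integrable_mult_right) simp_all
  show "(\<integral>x. (r x)\<^sup>2 \<partial>std_normal_distribution) = exp (\<sigma>\<^sup>2) - 1 - \<sigma>\<^sup>2"
    unfolding sq by (simp, simp add: power2_eq_square)
qed

subsection \<open>Convergence in probability\<close>

context prob_space
begin

lemma lim_in_prob_add:
  assumes [measurable]: "\<And>n. random_variable borel (X n)" "\<And>n. random_variable borel (Y n)"
    "random_variable borel A" "random_variable borel B"
    and X: "lim_in_prob M X A" and Y: "lim_in_prob M Y B"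
  shows "lim_in_prob M (\<lambda>n \<omega>. X n \<omega> + Y n \<omega>) (\<lambda>\<omega>. A \<omega> + B \<omega>)"
  unfolding lim_in_prob_def
proof (intro allI impI)
  fix e :: real assume e: "e > 0"
  let ?P = "\<lambda>n. prob {\<omega> \<in> space M. e/2 < \<bar>X n \<omega> - A \<omega>\<bar>}"
  let ?Q = "\<lambda>n. prob {\<omega> \<in> space M. e/2 < \<bar>Y n \<omega> - B \<omega>\<bar>}"
  have lim: "(\<lambda>n. ?P n + ?Q n) \<longlonglongrightarrow> 0"
    using X[unfolded lim_in_prob_def, rule_format, of "e/2"] Y[unfolded lim_in_prob_def, rule_format, of "e/2"] e
    by (intro tendsto_add_zero) simp_all
  have le: "prob {\<omega> \<in> space M. e < \<bar>X n \<omega> + Y n \<omega> - (A \<omega> + B \<omega>)\<bar>} \<le> ?P n + ?Q n" for n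
  proof -
    have "prob {\<omega> \<in> space M. e < \<bar>X n \<omega> + Y n \<omega> - (A \<omega> + B \<omega>)\<bar>}
      \<le> prob ({\<omega> \<in> space M. e/2 < \<bar>X n \<omega> - A \<omega>\<bar>} \<union> {\<omega> \<in> space M. e/2 < \<bar>Y n \<omega> - B \<omega>\<bar>})"
    proof (intro finite_measure_mono subsetI)
      fix \<omega> assume "\<omega> \<in> {\<omega> \<in> space M. e < \<bar>X n \<omega> + Y n \<omega> - (A \<omega> + B \<omega>)\<bar>}"
      moreover have "\<bar>X n \<omega> + Y n \<omega> - (A \<omega> + B \<omega>)\<bar> \<le> \<bar>X n \<omega> - A \<omega>\<bar> + \<bar>Y n \<omega> - B \<omega>\<bar>" by arith
      ultimately show "\<omega> \<in> {\<omega> \<in> space M. e/2 < \<bar>X n \<omega> - A \<omega>\<bar>} \<union> {\<omega> \<in> space M. e/2 < \<bar>Y n \<omega> - B \<omega>\<bar>}"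
        by (simp del: less_divide_eq_numeral1 divide_less_eq_numeral1) linarith
    qed simp
    also have "\<dots> \<le> ?P n + ?Q n"
      by (rule measure_Un_le) auto
    finally show ?thesis .
  qed
  show "(\<lambda>n. prob {\<omega> \<in> space M. e < \<bar>X n \<omega> + Y n \<omega> - (A \<omega> + B \<omega>)\<bar>}) \<longlonglongrightarrow> 0"
    by (rule tendsto_sandwich[OF _ _ tendsto_const lim]; intro always_eventually allI le) simp
qed

lemma lim_in_prob_cmult:
  assumes "lim_in_prob M X A"
  shows "lim_in_prob M (\<lambda>n \<omega>. c * X n \<omega>) (\<lambda>\<omega>. c * A \<omega>)"
proof (cases "c = 0")
  case False
  have "{\<omega> \<in> space M. e < \<bar>c * X n \<omega> - c * A \<omega>\<bar>} = {\<omega> \<in> space M. e / \<bar>c\<bar> < \<bar>X n \<omega> - A \<omega>\<bar>}" for n e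
    using False by (auto simp: divide_less_eq abs_mult mult.commute simp flip: right_diff_distrib)
  then show ?thesis using assms False unfolding lim_in_prob_def by auto
qed (auto simp: lim_in_prob_def not_less)

text \<open>Convergence in probability sees only the difference between sequence and limit, so a
  term may be moved from one to the other. \<open>gbm_ito_lim\<close> uses this to pass from a
  vanishing remainder to Riemann sums with limit \<open>Z.gbm t - 1\<close>.\<close>

lemma lim_in_prob_cong_AE:
  assumes [measurable]: "\<And>n. random_variable borel (X n)" "random_variable borel A"
    "\<And>n. random_variable borel (X' n)" "random_variable borel A'"
    and "\<And>n. AE \<omega> in M. X n \<omega> - A \<omega> = X' n \<omega> - A' \<omega>" and l: "lim_in_prob M X A"
  shows "lim_in_prob M X' A'"
proof -
  have "prob {\<omega> \<in> space M. e < \<bar>X n \<omega> - A \<omega>\<bar>} = prob {\<omega> \<in> space M. e < \<bar>X' n \<omega> - A' \<omega>\<bar>}" for n e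
    using assms(5)[of n] by (intro finite_measure_eq_AE) auto
  then show ?thesis using l unfolding lim_in_prob_def by simp
qed

lemma lim_in_prob_subseq:
  "lim_in_prob M X A \<Longrightarrow> filterlim r sequentially sequentially \<Longrightarrow> lim_in_prob M (\<lambda>n. X (r n)) A"
  unfolding lim_in_prob_def by (auto intro: filterlim_compose)

text \<open>Chebyshev's inequality; together with the grid isometry below it settles the limits
  whose errors have computable second moments.\<close>

lemma lim_in_prob_L2:
  assumes [measurable]: "\<And>n. random_variable borel (X n)"
    and i: "\<And>n. integrable M (\<lambda>\<omega>. (X n \<omega>)\<^sup>2)"
    and l: "(\<lambda>n. expectation (\<lambda>\<omega>. (X n \<omega>)\<^sup>2)) \<longlonglongrightarrow> 0"
  shows "lim_in_prob M X (\<lambda>_. 0)"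
  unfolding lim_in_prob_def
proof (intro allI impI)
  fix e :: real assume e: "e > 0"
  have le: "prob {\<omega> \<in> space M. e < \<bar>X n \<omega> - 0\<bar>} \<le> expectation (\<lambda>\<omega>. (X n \<omega>)\<^sup>2) / e\<^sup>2" for n
  proof -
    have "prob {\<omega> \<in> space M. e < \<bar>X n \<omega> - 0\<bar>} \<le> prob {\<omega> \<in> space M. e\<^sup>2 \<le> (X n \<omega>)\<^sup>2}"
      using e by (intro finite_measure_mono) (auto intro!: abs_le_square_iff[THEN iffD1])
    also have "\<dots> \<le> expectation (\<lambda>\<omega>. (X n \<omega>)\<^sup>2) / e\<^sup>2"
      using e by (intro integral_Markov_inequality_measure[OF i, where A = "{}"]) auto
    finally show ?thesis .
  qed
  have lim: "(\<lambda>n. expectation (\<lambda>\<omega>. (X n \<omega>)\<^sup>2) / e\<^sup>2) \<longlonglongrightarrow> 0"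
    using tendsto_divide[OF l tendsto_const[of "e\<^sup>2"]] e by simp
  show "(\<lambda>n. prob {\<omega> \<in> space M. e < \<bar>X n \<omega> - 0\<bar>}) \<longlonglongrightarrow> 0"
    by (rule tendsto_sandwich[OF _ _ tendsto_const lim])
       (use le in \<open>auto intro!: always_eventually\<close>)
qed

lemma lim_in_prob_AE:
  assumes [measurable]: "\<And>n. random_variable borel (X n)" "random_variable borel A"
    and l: "AE \<omega> in M. (\<lambda>n. X n \<omega>) \<longlonglongrightarrow> A \<omega>"
  shows "lim_in_prob M X A"
  unfolding lim_in_prob_def
proof (intro allI impI)
  fix e :: real assume e: "e > 0"
  have "(\<lambda>n. expectation (indicator {\<omega> \<in> space M. e < \<bar>X n \<omega> - A \<omega>\<bar>})) \<longlonglongrightarrow> expectation (\<lambda>_. 0 :: real)"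
  proof (rule integral_dominated_convergence[where w = "\<lambda>_. 1"])
    show "AE \<omega> in M. (\<lambda>n. indicator {\<omega> \<in> space M. e < \<bar>X n \<omega> - A \<omega>\<bar>} \<omega>) \<longlonglongrightarrow> (0 :: real)"
      using l
    proof eventually_elim
      case (elim \<omega>)
      then have "eventually (\<lambda>n. dist (X n \<omega>) (A \<omega>) < e) sequentially"
        using e by (rule tendstoD)
      then have "eventually (\<lambda>n. indicator {\<omega> \<in> space M. e < \<bar>X n \<omega> - A \<omega>\<bar>} \<omega> = (0::real)) sequentially"
        by eventually_elim (auto simp: dist_real_def)
      then show ?case by (rule tendsto_eventually)
    qed
  qed (auto split: split_indicator)
  then show "(\<lambda>n. prob {\<omega> \<in> space M. e < \<bar>X n \<omega> - A \<omega>\<bar>}) \<longlonglongrightarrow> 0"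
    by simp
qed

text \<open>Convergence in probability gives L1 convergence of the difference truncated at 1, and L1
  convergence gives an almost surely convergent subsequence. Fatou's lemma and bounded convergence
  are later applied along such a subsequence.\<close>

lemma lim_in_prob_AE_subseq:
  assumes [measurable]: "\<And>n. random_variable borel (X n)" "random_variable borel A"
    and l: "lim_in_prob M X A"
  obtains r :: "nat \<Rightarrow> nat" where "strict_mono r" "AE \<omega> in M. (\<lambda>n. X (r n) \<omega>) \<longlonglongrightarrow> A \<omega>"
proof -
  let ?u = "\<lambda>n \<omega>. min 1 \<bar>X n \<omega> - A \<omega>\<bar>"
  have i: "integrable M (?u n)" for n
    by (rule integrable_const_bound[where B = 1]) auto
  have "(\<lambda>n. expectation (\<lambda>\<omega>. norm (?u n \<omega>))) \<longlonglongrightarrow> 0"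
  proof (rule LIMSEQ_I)
    fix e :: real assume "e > 0"
    define d where "d = e / 2"
    have d: "d > 0" and e: "e = 2 * d" using \<open>e > 0\<close> by (simp_all add: d_def)
    have "(\<lambda>n. prob {\<omega> \<in> space M. d < \<bar>X n \<omega> - A \<omega>\<bar>}) \<longlonglongrightarrow> 0"
      using l[unfolded lim_in_prob_def, rule_format, of d] d by simp
    from order_tendstoD(2)[OF this d] obtain n0 where
      n0: "\<And>n. n \<ge> n0 \<Longrightarrow> prob {\<omega> \<in> space M. d < \<bar>X n \<omega> - A \<omega>\<bar>} < d"
      unfolding eventually_sequentially by blast
    have "expectation (\<lambda>\<omega>. norm (?u n \<omega>)) < e" if n: "n \<ge> n0" for n
    proof -
      have "expectation (\<lambda>\<omega>. norm (?u n \<omega>))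
        \<le> expectation (\<lambda>\<omega>. d + indicator {\<omega> \<in> space M. d < \<bar>X n \<omega> - A \<omega>\<bar>} \<omega>)"
      proof (intro integral_mono)
        show "integrable M (\<lambda>\<omega>. norm (?u n \<omega>))"
          by (rule integrable_norm[OF i])
        show "integrable M (\<lambda>\<omega>. d + indicator {\<omega> \<in> space M. d < \<bar>X n \<omega> - A \<omega>\<bar>} \<omega>)"
          by (intro Bochner_Integration.integrable_add integrable_real_indicator) (auto simp: emeasure_eq_measure)
        fix \<omega> assume "\<omega> \<in> space M"
        then show "norm (?u n \<omega>) \<le> d + indicator {\<omega> \<in> space M. d < \<bar>X n \<omega> - A \<omega>\<bar>} \<omega>"
          using d by (cases "d < \<bar>X n \<omega> - A \<omega>\<bar>") (auto simp: min_def)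
      qed
      also have "\<dots> = d + prob {\<omega> \<in> space M. d < \<bar>X n \<omega> - A \<omega>\<bar>}"
        by (subst Bochner_Integration.integral_add)
           (auto simp: prob_space emeasure_eq_measure intro!: integrable_real_indicator)
      also have "\<dots> < e" using n0[OF n] e by simp
      finally show ?thesis .
    qed
    moreover have "0 \<le> expectation (\<lambda>\<omega>. norm (?u n \<omega>))" for n by simp
    ultimately show "\<exists>n0. \<forall>n\<ge>n0. norm (expectation (\<lambda>\<omega>. norm (?u n \<omega>)) - 0) < e"
      by (intro exI[of _ n0]) simp
  qed
  from tendsto_L1_AE_subseq[OF i this] obtain r :: "nat \<Rightarrow> nat" where
    r: "strict_mono r" "AE \<omega> in M. (\<lambda>n. ?u (r n) \<omega>) \<longlonglongrightarrow> 0" by auto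
  have "AE \<omega> in M. (\<lambda>n. X (r n) \<omega>) \<longlonglongrightarrow> A \<omega>"
    using r(2)
  proof eventually_elim
    case (elim \<omega>)
    \<comment> \<open>Once the truncated difference is below 1, the truncation is inactive and can
      be removed.\<close>
    from elim have "eventually (\<lambda>n. ?u (r n) \<omega> < 1) sequentially"
      by (rule order_tendstoD(2)) simp
    then have "eventually (\<lambda>n. ?u (r n) \<omega> = \<bar>X (r n) \<omega> - A \<omega>\<bar>) sequentially"
      by eventually_elim auto
    with elim have "(\<lambda>n. \<bar>X (r n) \<omega> - A \<omega>\<bar>) \<longlonglongrightarrow> 0"
      by (simp only: tendsto_cong)
    then have "(\<lambda>n. X (r n) \<omega> - A \<omega>) \<longlonglongrightarrow> 0"
      by (rule tendsto_rabs_zero_cancel)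
    then show ?case by (rule LIM_zero_cancel)
  qed
  with r(1) that show thesis by blast
qed

text \<open>A sequence bounded in L2 is uniformly integrable, so convergence to 0 in probability
  improves to L1 (Vitali).\<close>

lemma L1_tendsto_0_of_L2_bounded:
  fixes X :: "nat \<Rightarrow> 'a \<Rightarrow> real"
  assumes [measurable]: "\<And>n. random_variable borel (X n)"
    and l: "lim_in_prob M X (\<lambda>_. 0)"
    and i: "\<And>n. integrable M (\<lambda>\<omega>. (X n \<omega>)\<^sup>2)" and C: "\<And>n. expectation (\<lambda>\<omega>. (X n \<omega>)\<^sup>2) \<le> C"
  shows "(\<lambda>n. expectation (\<lambda>\<omega>. \<bar>X n \<omega>\<bar>)) \<longlonglongrightarrow> 0"
proof (rule LIMSEQ_I)
  fix e :: real assume "e > 0"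
  define d where "d = e / 4"
  have d: "d > 0" and e: "e = 4 * d" using \<open>e > 0\<close> by (simp_all add: d_def)
  have C0: "C \<ge> 0" using C[of 0] by (rule order_trans[rotated]) simp
  \<comment> \<open>Above the level \<open>1/\<eta>\<close> the tail is paid for by the second
    moment; the choice gives \<open>\<eta> * C \<le> d\<close>, so that this payment is at most
    \<open>d\<close>.\<close>
  define \<eta> where "\<eta> = d / (C + 1)"
  have \<eta>: "\<eta> > 0" "\<eta> * C \<le> d" using d C0 by (auto simp: \<eta>_def field_simps)
  have "(\<lambda>n. prob {\<omega> \<in> space M. d < \<bar>X n \<omega>\<bar>}) \<longlonglongrightarrow> 0"
    using l[unfolded lim_in_prob_def, rule_format, of "d"] d by simp
  from order_tendstoD(2)[OF this mult_pos_pos[OF d \<eta>(1)]] obtain n0 where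
    n0: "\<And>n. n \<ge> n0 \<Longrightarrow> prob {\<omega> \<in> space M. d < \<bar>X n \<omega>\<bar>} < d * \<eta>"
    unfolding eventually_sequentially by blast
  have i1: "integrable M (\<lambda>\<omega>. \<bar>X n \<omega>\<bar>)" for n
    by (rule integrable_abs[OF square_integrable_imp_integrable[OF _ i]]) simp
  have "expectation (\<lambda>\<omega>. \<bar>X n \<omega>\<bar>) < e" if n: "n \<ge> n0" for n
  proof -
    \<comment> \<open>Three ranges: up to \<open>d\<close>, between \<open>d\<close> and
      \<open>1/\<eta>\<close>, and beyond \<open>1/\<eta>\<close>, where |x| is at most
      \<open>\<eta> * x\<^sup>2\<close>. The probability bound \<open>d * \<eta>\<close> cancels the
      height \<open>1/\<eta>\<close> of the middle range.\<close>
    have pt: "\<bar>x\<bar> \<le> d + \<eta> * x\<^sup>2 + (if d < \<bar>x\<bar> then 1/\<eta> else 0)" for x :: real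
    proof (cases "\<bar>x\<bar> \<le> 1/\<eta>")
      case True
      moreover have "0 \<le> \<eta> * x\<^sup>2" "0 \<le> 1/\<eta>" using \<eta> by auto
      ultimately show ?thesis using d by (simp only: split: if_split) linarith
    next
      case False
      then have "1 \<le> \<eta> * \<bar>x\<bar>" using \<eta> by (simp add: field_simps)
      then have "\<bar>x\<bar> * 1 \<le> \<bar>x\<bar> * (\<eta> * \<bar>x\<bar>)" by (intro mult_left_mono) auto
      then have "\<bar>x\<bar> \<le> \<eta> * x\<^sup>2" by (simp add: power2_eq_square mult.left_commute)
      moreover have "0 \<le> 1/\<eta>" using \<eta> by auto
      ultimately show ?thesis using d by (simp only: split: if_split) linarith
    qed
    have "expectation (\<lambda>\<omega>. \<bar>X n \<omega>\<bar>)
      \<le> expectation (\<lambda>\<omega>. d + \<eta> * (X n \<omega>)\<^sup>2 + indicator {\<omega> \<in> space M. d < \<bar>X n \<omega>\<bar>} \<omega> * (1/\<eta>))"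
    proof (intro integral_mono i1)
      show "integrable M (\<lambda>\<omega>. d + \<eta> * (X n \<omega>)\<^sup>2 + indicator {\<omega> \<in> space M. d < \<bar>X n \<omega>\<bar>} \<omega> * (1/\<eta>))"
        using i by (intro Bochner_Integration.integrable_add integrable_mult_right integrable_mult_left
          integrable_real_indicator) (auto simp: emeasure_eq_measure)
      show "\<bar>X n \<omega>\<bar> \<le> d + \<eta> * (X n \<omega>)\<^sup>2 + indicator {\<omega> \<in> space M. d < \<bar>X n \<omega>\<bar>} \<omega> * (1/\<eta>)"
        if "\<omega> \<in> space M" for \<omega>
        using pt[of "X n \<omega>"] that by (simp split: if_splits)
    qed
    also have "\<dots> = d + \<eta> * expectation (\<lambda>\<omega>. (X n \<omega>)\<^sup>2) + prob {\<omega> \<in> space M. d < \<bar>X n \<omega>\<bar>} * (1/\<eta>)"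
    proof -
      have j: "integrable M (indicat_real {\<omega> \<in> space M. d < \<bar>X n \<omega>\<bar>})"
        by (intro integrable_real_indicator) (auto simp: emeasure_eq_measure)
      have "integrable M (\<lambda>\<omega>. d + \<eta> * (X n \<omega>)\<^sup>2)"
        by (intro Bochner_Integration.integrable_add integrable_const integrable_mult_right i)
      from Bochner_Integration.integral_add[OF this integrable_mult_left[OF j, of "1/\<eta>"]]
        Bochner_Integration.integral_add[OF integrable_const[of d] integrable_mult_right[OF i[of n], of \<eta>]]
      show ?thesis by (simp add: prob_space)
    qed
    also have "\<dots> \<le> d + d + (d * \<eta>) * (1/\<eta>)"
      using n0[OF n] \<eta> order_trans[OF mult_left_mono[OF C[of n], of \<eta>] \<eta>(2)]
      by (intro add_mono mult_right_mono) auto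
    also have "\<dots> < e" using \<eta> d e by simp
    finally show ?thesis .
  qed
  moreover have "0 \<le> expectation (\<lambda>\<omega>. \<bar>X n \<omega>\<bar>)" for n by simp
  ultimately show "\<exists>n0. \<forall>n\<ge>n0. norm (expectation (\<lambda>\<omega>. \<bar>X n \<omega>\<bar>) - 0) < e"
    by (intro exI[of _ n0]) simp
qed

end

subsection \<open>Brownian increments\<close>

context prob_space
begin

text \<open>Arbitrary target spaces matter: with \<open>X\<close> the identity into the past
  sigma-algebra, a product law expresses independence from the whole past and not just from one
  variable.\<close>

lemma distr_pair_eqI:
  assumes [measurable]: "random_variable S X" "random_variable T Y"
    and p: "\<And>A B. A \<in> sets S \<Longrightarrow> B \<in> sets T \<Longrightarrow>
      prob ((X -` A \<inter> space M) \<inter> (Y -` B \<inter> space M)) = prob (X -` A \<inter> space M) * prob (Y -` B \<inter> space M)"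
  shows "distr M S X \<Otimes>\<^sub>M distr M T Y = distr M (S \<Otimes>\<^sub>M T) (\<lambda>x. (X x, Y x))"
proof -
  interpret X: prob_space "distr M S X" by (rule prob_space_distr) simp
  interpret Y: prob_space "distr M T Y" by (rule prob_space_distr) simp
  show ?thesis
  proof (rule pair_measure_eqI)
    fix A B assume "A \<in> sets (distr M S X)" "B \<in> sets (distr M T Y)"
    then have A[measurable]: "A \<in> sets S" and B[measurable]: "B \<in> sets T" by auto
    have "(\<lambda>x. (X x, Y x)) -` (A \<times> B) \<inter> space M = (X -` A \<inter> space M) \<inter> (Y -` B \<inter> space M)" by auto
    then show "emeasure (distr M S X) A * emeasure (distr M T Y) B
        = emeasure (distr M (S \<Otimes>\<^sub>M T) (\<lambda>x. (X x, Y x))) (A \<times> B)"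
      using p[OF A B] by (simp add: emeasure_distr emeasure_eq_measure flip: ennreal_mult)
  qed (auto intro: X.sigma_finite_measure_axioms Y.sigma_finite_measure_axioms)
qed

text \<open>Freezing: by independence the second variable is integrated out while the first is held
  fixed. In the chain computations this takes the place of conditional expectation.\<close>

lemma nn_integral_distr_pair:
  assumes [measurable]: "random_variable S X" "random_variable T Y" "f \<in> borel_measurable (S \<Otimes>\<^sub>M T)"
    and i: "distr M S X \<Otimes>\<^sub>M distr M T Y = distr M (S \<Otimes>\<^sub>M T) (\<lambda>x. (X x, Y x))"
  shows "(\<integral>\<^sup>+\<omega>. f (X \<omega>, Y \<omega>) \<partial>M) = (\<integral>\<^sup>+\<omega>. (\<integral>\<^sup>+y. f (X \<omega>, y) \<partial>distr M T Y) \<partial>M)"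
proof -
  interpret Y: prob_space "distr M T Y" by (rule prob_space_distr) simp
  have "(\<integral>\<^sup>+\<omega>. f (X \<omega>, Y \<omega>) \<partial>M) = (\<integral>\<^sup>+z. f z \<partial>distr M (S \<Otimes>\<^sub>M T) (\<lambda>x. (X x, Y x)))"
    by (subst nn_integral_distr) auto
  also have "\<dots> = (\<integral>\<^sup>+x. (\<integral>\<^sup>+y. f (x, y) \<partial>distr M T Y) \<partial>distr M S X)"
    unfolding i[symmetric] by (subst Y.nn_integral_fst[symmetric]) auto
  also have "\<dots> = (\<integral>\<^sup>+\<omega>. (\<integral>\<^sup>+y. f (X \<omega>, y) \<partial>distr M T Y) \<partial>M)"
    by (subst nn_integral_distr) auto
  finally show ?thesis .
qed

text \<open>Orthogonality of martingale differences: when the sum is squared, \<open>\<xi> n\<close>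
  is centred and independent of the partial sum times \<open>H n\<close>, so the mixed term has mean
  zero.\<close>

lemma martingale_difference_L2:
  fixes G :: "nat \<Rightarrow> 'a measure" and H \<xi> :: "nat \<Rightarrow> 'a \<Rightarrow> real"
  assumes sub: "\<And>k. subalgebra M (G k)" and mono: "\<And>k. sets (G k) \<subseteq> sets (G (Suc k))"
    and H: "\<And>k. H k \<in> borel_measurable (G k)" "\<And>k. integrable M (\<lambda>\<omega>. (H k \<omega>)\<^sup>2)"
    and \<xi>: "\<And>k. \<xi> k \<in> borel_measurable (G (Suc k))" "\<And>k. integrable M (\<lambda>\<omega>. (\<xi> k \<omega>)\<^sup>2)"
      "\<And>k. expectation (\<xi> k) = 0"
    and ind: "\<And>k X. X \<in> borel_measurable (G k) \<Longrightarrow> indep_var borel X borel (\<xi> k)"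
  shows "integrable M (\<lambda>\<omega>. (\<Sum>k<n. H k \<omega> * \<xi> k \<omega>)\<^sup>2)"
    and "expectation (\<lambda>\<omega>. (\<Sum>k<n. H k \<omega> * \<xi> k \<omega>)\<^sup>2)
      = (\<Sum>k<n. expectation (\<lambda>\<omega>. (H k \<omega>)\<^sup>2) * expectation (\<lambda>\<omega>. (\<xi> k \<omega>)\<^sup>2))"
proof -
  let ?S = "\<lambda>n \<omega>. \<Sum>k<n. H k \<omega> * \<xi> k \<omega>"
  have GM: "f \<in> borel_measurable (G k) \<Longrightarrow> f \<in> borel_measurable M" for f :: "'a \<Rightarrow> real" and k
    by (rule measurable_from_subalg[OF sub])
  have GS: "f \<in> borel_measurable (G k) \<Longrightarrow> f \<in> borel_measurable (G (Suc k))" for f :: "'a \<Rightarrow> real" and k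
    using sub[of k] sub[of "Suc k"] mono[of k]
    by (intro measurable_from_subalg[of "G (Suc k)" "G k"]) (auto simp: subalgebra_def)
  have [measurable]: "H k \<in> borel_measurable M" "\<xi> k \<in> borel_measurable M" for k
    using GM H(1) \<xi>(1) by blast+
  have "?S n \<in> borel_measurable (G n) \<and> integrable M (\<lambda>\<omega>. (?S n \<omega>)\<^sup>2) \<and>
    expectation (\<lambda>\<omega>. (?S n \<omega>)\<^sup>2) = (\<Sum>k<n. expectation (\<lambda>\<omega>. (H k \<omega>)\<^sup>2) * expectation (\<lambda>\<omega>. (\<xi> k \<omega>)\<^sup>2))"
  proof (induction n)
    case (Suc n)
    then have S: "?S n \<in> borel_measurable (G n)" and Si: "integrable M (\<lambda>\<omega>. (?S n \<omega>)\<^sup>2)"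
      and Se: "expectation (\<lambda>\<omega>. (?S n \<omega>)\<^sup>2) = (\<Sum>k<n. expectation (\<lambda>\<omega>. (H k \<omega>)\<^sup>2) * expectation (\<lambda>\<omega>. (\<xi> k \<omega>)\<^sup>2))"
      by blast+
    have m: "?S (Suc n) \<in> borel_measurable (G (Suc n))"
      using GS[OF S] GS[OF H(1)] \<xi>(1) by simp
    have \<xi>i: "integrable M (\<xi> n)"
      by (rule square_integrable_imp_integrable[OF _ \<xi>(2)]) simp
    have SH: "(\<lambda>\<omega>. ?S n \<omega> * H n \<omega>) \<in> borel_measurable (G n)"
      using S H(1)[of n] by (rule borel_measurable_times)
    have SHi: "integrable M (\<lambda>\<omega>. ?S n \<omega> * H n \<omega>)"
    proof (rule Bochner_Integration.integrable_bound)
      show "integrable M (\<lambda>\<omega>. (?S n \<omega>)\<^sup>2 + (H n \<omega>)\<^sup>2)"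
        by (rule Bochner_Integration.integrable_add[OF Si H(2)])
      show "(\<lambda>\<omega>. ?S n \<omega> * H n \<omega>) \<in> borel_measurable M" using GM[OF SH] .
      \<comment> \<open>The partial sum and \<open>H n\<close> both belong to the past and may be
        dependent; their product is integrable because both are square integrable.\<close>
      have "\<bar>x * y\<bar> \<le> x\<^sup>2 + y\<^sup>2" for x y :: real
      proof -
        have "0 \<le> \<bar>x\<bar> * \<bar>y\<bar>" by simp
        then show ?thesis using sum_squares_bound[of "\<bar>x\<bar>" "\<bar>y\<bar>"] unfolding abs_mult power2_abs by linarith
      qed
      then show "AE \<omega> in M. norm (?S n \<omega> * H n \<omega>) \<le> norm ((?S n \<omega>)\<^sup>2 + (H n \<omega>)\<^sup>2)"
        by (intro AE_I2) simp
    qed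
    have c: "integrable M (\<lambda>\<omega>. (?S n \<omega> * H n \<omega>) * \<xi> n \<omega>)"
      "expectation (\<lambda>\<omega>. (?S n \<omega> * H n \<omega>) * \<xi> n \<omega>) = 0"
      using indep_var_integrable[OF ind[OF SH] SHi \<xi>i] indep_var_lebesgue_integral[OF ind[OF SH] SHi \<xi>i]
      by (simp_all add: \<xi>(3))
    have i2: "indep_var borel (\<lambda>\<omega>. (H n \<omega>)\<^sup>2) borel (\<lambda>\<omega>. (\<xi> n \<omega>)\<^sup>2)"
      using indep_var_compose[OF ind[OF H(1)[of n]], of "\<lambda>x. x\<^sup>2" borel "\<lambda>x. x\<^sup>2" borel]
      by (simp add: comp_def)
    have d: "integrable M (\<lambda>\<omega>. (H n \<omega>)\<^sup>2 * (\<xi> n \<omega>)\<^sup>2)"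
      "expectation (\<lambda>\<omega>. (H n \<omega>)\<^sup>2 * (\<xi> n \<omega>)\<^sup>2) = expectation (\<lambda>\<omega>. (H n \<omega>)\<^sup>2) * expectation (\<lambda>\<omega>. (\<xi> n \<omega>)\<^sup>2)"
      using indep_var_integrable[OF i2 H(2) \<xi>(2)] indep_var_lebesgue_integral[OF i2 H(2) \<xi>(2)] by auto
    have eq: "(?S (Suc n) \<omega>)\<^sup>2 = (?S n \<omega>)\<^sup>2 + (2 * ((?S n \<omega> * H n \<omega>) * \<xi> n \<omega>) + (H n \<omega>)\<^sup>2 * (\<xi> n \<omega>)\<^sup>2)" for \<omega>
      by (simp add: power2_eq_square algebra_simps)
    have ic: "integrable M (\<lambda>\<omega>. 2 * ((?S n \<omega> * H n \<omega>) * \<xi> n \<omega>) + (H n \<omega>)\<^sup>2 * (\<xi> n \<omega>)\<^sup>2)"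
      by (intro Bochner_Integration.integrable_add integrable_mult_right c d)
    have "integrable M (\<lambda>\<omega>. (?S (Suc n) \<omega>)\<^sup>2)"
      unfolding eq by (rule Bochner_Integration.integrable_add[OF Si ic])
    moreover have "expectation (\<lambda>\<omega>. (?S (Suc n) \<omega>)\<^sup>2)
        = expectation (\<lambda>\<omega>. (?S n \<omega>)\<^sup>2) + (2 * 0 + expectation (\<lambda>\<omega>. (H n \<omega>)\<^sup>2) * expectation (\<lambda>\<omega>. (\<xi> n \<omega>)\<^sup>2))"
      unfolding eq Bochner_Integration.integral_add[OF Si ic]
        Bochner_Integration.integral_add[OF integrable_mult_right[OF c(1)] d(1)] integral_mult_right_zero c(2) d(2) ..
    ultimately show ?case using m by (simp add: Se)
  qed simp
  then show "integrable M (\<lambda>\<omega>. (?S n \<omega>)\<^sup>2)"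
    "expectation (\<lambda>\<omega>. (?S n \<omega>)\<^sup>2) = (\<Sum>k<n. expectation (\<lambda>\<omega>. (H k \<omega>)\<^sup>2) * expectation (\<lambda>\<omega>. (\<xi> k \<omega>)\<^sup>2))"
    by blast+
qed

end

text \<open>The start \<open>s\<close> is kept apart from the step \<open>d\<close> because two
  families of grids occur: the main grid from 0, and the subdivisions of a single cell from which
  the joint law is found.\<close>

definition inc :: "(real \<Rightarrow> 'a \<Rightarrow> real) \<Rightarrow> real \<Rightarrow> real \<Rightarrow> nat \<Rightarrow> 'a \<Rightarrow> real" where
  "inc V s d j \<omega> = V (s + real (Suc j) * d) \<omega> - V (s + real j * d) \<omega>"

lemma sum_inc: "(\<Sum>j<n. inc V s d j \<omega>) = V (s + real n * d) \<omega> - V s \<omega>"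
  by (induction n) (auto simp: inc_def)

locale brownian = prob_space M for M :: "'a measure" +
  fixes F :: "real \<Rightarrow> 'a measure" and W :: "real \<Rightarrow> 'a \<Rightarrow> real"
  assumes filt: "filtration M F" and bm: "bm_filt M F W"
begin

lemma subalg: "subalgebra M (F s)"
  using filt by (simp add: filtration_def)

lemma space_F [simp]: "space (F s) = space M"
  using subalg[of s] by (simp add: subalgebra_def)

lemma sets_F_mono: "0 \<le> s \<Longrightarrow> s \<le> t \<Longrightarrow> sets (F s) \<subseteq> sets (F t)"
  using filt by (auto simp: filtration_def)

lemma sets_F: "A \<in> sets (F s) \<Longrightarrow> A \<in> events"
  using subalg[of s] by (auto simp: subalgebra_def)

lemma measurable_F: "f \<in> measurable (F s) S \<Longrightarrow> f \<in> measurable M S"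
  by (rule measurable_from_subalg[OF subalg])

lemma measurable_F_mono: "f \<in> measurable (F s) S \<Longrightarrow> 0 \<le> s \<Longrightarrow> s \<le> t \<Longrightarrow> f \<in> measurable (F t) S"
  using sets_F_mono by (intro measurable_from_subalg[of "F t" "F s"]) (auto simp: subalgebra_def)

lemma adapted: "0 \<le> s \<Longrightarrow> s \<le> t \<Longrightarrow> W s \<in> borel_measurable (F t)"
  using bm unfolding bm_filt_def by (blast intro: measurable_F_mono)

lemma measurable_W: "0 \<le> s \<Longrightarrow> random_variable borel (W s)"
  by (rule measurable_F[OF adapted[of s s]]) simp_all

lemma measurable_increment: "0 \<le> s \<Longrightarrow> s \<le> t \<Longrightarrow> random_variable borel (\<lambda>\<omega>. W t \<omega> - W s \<omega>)"
  by (intro borel_measurable_diff measurable_W) auto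

lemma prob_increment:
  assumes s: "0 \<le> s" "s < t" and A: "A \<in> sets (F s)" and B: "B \<in> sets borel"
  shows "prob (A \<inter> ((\<lambda>\<omega>. W t \<omega> - W s \<omega>) -` B \<inter> space M))
      = prob A * prob ((\<lambda>\<omega>. W t \<omega> - W s \<omega>) -` B \<inter> space M)"
proof -
  have "indep_set (sets (F s)) {(\<lambda>\<omega>. W t \<omega> - W s \<omega>) -` A \<inter> space M | A. A \<in> sets borel}"
    using bm s unfolding bm_filt_def by blast
  then show ?thesis using A B unfolding indep_sets2_eq by blast
qed

lemma indep_var_increment:
  assumes s: "0 \<le> s" "s < t" and X: "X \<in> measurable (F s) S" and g: "g \<in> measurable borel T"
  shows "indep_var S X T (\<lambda>\<omega>. g (W t \<omega> - W s \<omega>))"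
  unfolding indep_var_distribution_eq
proof (intro conjI distr_pair_eqI)
  show "random_variable S X" "random_variable S X" by (rule measurable_F[OF X])+
  show m: "random_variable T (\<lambda>\<omega>. g (W t \<omega> - W s \<omega>))" "random_variable T (\<lambda>\<omega>. g (W t \<omega> - W s \<omega>))"
    using s measurable_compose[OF measurable_increment g, of s t] by auto
  fix A B assume A: "A \<in> sets S" and B: "B \<in> sets T"
  have "X -` A \<inter> space M \<in> sets (F s)" using measurable_sets[OF X A] by simp
  moreover have "g -` B \<in> sets borel" using measurable_sets[OF g B] by simp
  moreover have "(\<lambda>\<omega>. g (W t \<omega> - W s \<omega>)) -` B = (\<lambda>\<omega>. W t \<omega> - W s \<omega>) -` (g -` B)" by auto
  ultimately show "prob ((X -` A \<inter> space M) \<inter> ((\<lambda>\<omega>. g (W t \<omega> - W s \<omega>)) -` B \<inter> space M))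
      = prob (X -` A \<inter> space M) * prob ((\<lambda>\<omega>. g (W t \<omega> - W s \<omega>)) -` B \<inter> space M)"
    using prob_increment[OF s] by (simp only:)
qed

lemma distr_increment:
  assumes s: "0 \<le> s" "s < t"
  shows "distr M borel (\<lambda>\<omega>. W t \<omega> - W s \<omega>) = normal_law (sqrt (t - s))"
proof -
  let ?D = "\<lambda>\<omega>. W t \<omega> - W s \<omega>" and ?\<sigma> = "sqrt (t - s)"
  have \<sigma>: "0 < ?\<sigma>" using s by simp
  have [measurable]: "random_variable borel ?D"
    using s by (intro borel_measurable_diff measurable_W) auto
  have "distributed M lborel ?D (normal_density 0 ?\<sigma>)"
    using bm s by (auto simp: bm_filt_def)
  then have "distributed M lborel (\<lambda>\<omega>. (?D \<omega> - 0) / ?\<sigma>) std_normal_density"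
    by (simp only: normal_standard_normal_convert[OF \<sigma>])
  then have "distr M lborel (\<lambda>\<omega>. ?D \<omega> / ?\<sigma>) = std_normal_distribution"
    by (simp add: distributed_def)
  then have "normal_law ?\<sigma> = distr (distr M lborel (\<lambda>\<omega>. ?D \<omega> / ?\<sigma>)) borel (\<lambda>x. ?\<sigma> * x)"
    by (simp add: normal_law_def)
  also have "\<dots> = distr M borel ?D"
    using s by (subst distr_distr) (auto simp: comp_def)
  finally show ?thesis by simp
qed

text \<open>The identity map into \<open>F s\<close> is independent of the increment, so the
  increment can be integrated out with the sample point frozen.\<close>

lemma nn_integral_increment:
  assumes s: "0 \<le> s" "s < t" and [measurable]: "f \<in> borel_measurable (F s \<Otimes>\<^sub>M borel)"
  shows "(\<integral>\<^sup>+\<omega>. f (\<omega>, W t \<omega> - W s \<omega>) \<partial>M)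
    = (\<integral>\<^sup>+\<omega>. (\<integral>\<^sup>+x. f (\<omega>, sqrt (t - s) * x) \<partial>std_normal_distribution) \<partial>M)"
proof -
  have "(\<integral>\<^sup>+\<omega>. f (\<omega>, W t \<omega> - W s \<omega>) \<partial>M) = (\<integral>\<^sup>+\<omega>. (\<integral>\<^sup>+x. f (\<omega>, x) \<partial>normal_law (sqrt (t - s))) \<partial>M)"
    unfolding distr_increment[OF s, symmetric]
  proof (intro nn_integral_distr_pair distr_pair_eqI)
    show "(\<lambda>\<omega>. \<omega>) \<in> measurable M (F s)" "(\<lambda>\<omega>. \<omega>) \<in> measurable M (F s)"
      using measurable_F[OF measurable_ident_sets[OF refl], of s] by auto
    fix A B assume A: "A \<in> sets (F s)" and B: "B \<in> sets (borel :: real measure)"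
    have "(\<lambda>\<omega>. \<omega>) -` A \<inter> space M = A" using sets.sets_into_space[OF A] by auto
    then show "prob (((\<lambda>\<omega>. \<omega>) -` A \<inter> space M) \<inter> ((\<lambda>\<omega>. W t \<omega> - W s \<omega>) -` B \<inter> space M))
      = prob ((\<lambda>\<omega>. \<omega>) -` A \<inter> space M) * prob ((\<lambda>\<omega>. W t \<omega> - W s \<omega>) -` B \<inter> space M)"
      using prob_increment[OF s A B] by simp
  qed (use s assms(3) in \<open>auto intro: measurable_increment\<close>)
  also have "\<dots> = (\<integral>\<^sup>+\<omega>. (\<integral>\<^sup>+x. f (\<omega>, sqrt (t - s) * x) \<partial>std_normal_distribution) \<partial>M)"
  proof (intro nn_integral_cong nn_integral_normal_law)
    fix \<omega> assume "\<omega> \<in> space M"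
    then show "(\<lambda>x. f (\<omega>, x)) \<in> borel_measurable borel"
      using measurable_compose[OF measurable_Pair1'[of \<omega> "F s" borel] assms(3)] by simp
  qed
  finally show ?thesis .
qed

lemma integral_increment:
  fixes g :: "real \<Rightarrow> 'b::{banach, second_countable_topology}"
  assumes s: "0 \<le> s" "s < t" and g: "g \<in> borel_measurable borel"
  shows "integrable M (\<lambda>\<omega>. g (W t \<omega> - W s \<omega>)) \<longleftrightarrow> integrable std_normal_distribution (\<lambda>x. g (sqrt (t - s) * x))"
    and "expectation (\<lambda>\<omega>. g (W t \<omega> - W s \<omega>)) = (\<integral>x. g (sqrt (t - s) * x) \<partial>std_normal_distribution)"
proof -
  have [measurable]: "random_variable borel (\<lambda>\<omega>. W t \<omega> - W s \<omega>)"
    using s by (intro borel_measurable_diff measurable_W) auto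
  show "integrable M (\<lambda>\<omega>. g (W t \<omega> - W s \<omega>)) \<longleftrightarrow> integrable std_normal_distribution (\<lambda>x. g (sqrt (t - s) * x))"
    using integrable_distr_eq[of "\<lambda>\<omega>. W t \<omega> - W s \<omega>" M borel g] g
    by (simp add: distr_increment[OF s] integrable_normal_law_iff)
  show "expectation (\<lambda>\<omega>. g (W t \<omega> - W s \<omega>)) = (\<integral>x. g (sqrt (t - s) * x) \<partial>std_normal_distribution)"
    using integral_distr[of "\<lambda>\<omega>. W t \<omega> - W s \<omega>" M borel g] g
    by (simp add: distr_increment[OF s] integral_normal_law)
qed

lemma integral_mult_increment:
  fixes g :: "real \<Rightarrow> 'b::{real_normed_field, banach, second_countable_topology}"
  assumes s: "0 \<le> s" "s < t" and g: "g \<in> borel_measurable borel"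
    "integrable std_normal_distribution (\<lambda>x. g (sqrt (t - s) * x))"
    and G: "G \<in> borel_measurable (F s)" "integrable M G"
  shows "integrable M (\<lambda>\<omega>. G \<omega> * g (W t \<omega> - W s \<omega>))"
    and "expectation (\<lambda>\<omega>. G \<omega> * g (W t \<omega> - W s \<omega>))
      = expectation G * (\<integral>x. g (sqrt (t - s) * x) \<partial>std_normal_distribution)"
proof -
  have i: "indep_var borel G borel (\<lambda>\<omega>. g (W t \<omega> - W s \<omega>))"
    by (rule indep_var_increment[OF s G(1) g(1)])
  have gi: "integrable M (\<lambda>\<omega>. g (W t \<omega> - W s \<omega>))"
    using integral_increment(1)[OF s g(1)] g(2) by simp
  show "integrable M (\<lambda>\<omega>. G \<omega> * g (W t \<omega> - W s \<omega>))"
    by (rule indep_var_integrable[OF i G(2) gi])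
  show "expectation (\<lambda>\<omega>. G \<omega> * g (W t \<omega> - W s \<omega>))
      = expectation G * (\<integral>x. g (sqrt (t - s) * x) \<partial>std_normal_distribution)"
    using indep_var_lebesgue_integral[OF i G(2) gi] integral_increment(2)[OF s g(1)] by simp
qed

lemma inc_adapted: "0 \<le> s \<Longrightarrow> 0 \<le> d \<Longrightarrow> s + real (Suc j) * d \<le> t \<Longrightarrow> inc W s d j \<in> borel_measurable (F t)"
  unfolding inc_def by (intro borel_measurable_diff adapted) (simp_all add: distrib_right)

lemma measurable_inc: "0 \<le> s \<Longrightarrow> 0 \<le> d \<Longrightarrow> random_variable borel (inc W s d j)"
  by (rule measurable_F[OF inc_adapted[where t = "s + real (Suc j) * d"]]) simp_all

text \<open>Ito isometry on a grid, for a function \<open>g\<close> of the increment. It is applied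
  with \<open>g\<close> the centred square, the identity and the exponential remainder.\<close>

lemma grid_transform_L2:
  fixes H :: "nat \<Rightarrow> 'a \<Rightarrow> real" and g :: "real \<Rightarrow> real"
  assumes s: "0 \<le> s" "0 < d"
    and H: "\<And>k. H k \<in> borel_measurable (F (s + real k * d))" "\<And>k. integrable M (\<lambda>\<omega>. (H k \<omega>)\<^sup>2)"
    and g: "g \<in> borel_measurable borel" "integrable std_normal_distribution (\<lambda>x. (g (sqrt d * x))\<^sup>2)"
      "(\<integral>x. g (sqrt d * x) \<partial>std_normal_distribution) = 0"
  shows "integrable M (\<lambda>\<omega>. (\<Sum>k<n. H k \<omega> * g (inc W s d k \<omega>))\<^sup>2)"
    and "expectation (\<lambda>\<omega>. (\<Sum>k<n. H k \<omega> * g (inc W s d k \<omega>))\<^sup>2)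
      = (\<Sum>k<n. expectation (\<lambda>\<omega>. (H k \<omega>)\<^sup>2)) * (\<integral>x. (g (sqrt d * x))\<^sup>2 \<partial>std_normal_distribution)"
proof -
  have le: "0 \<le> s + real k * d" "s + real k * d < s + real (Suc k) * d" for k
    using s by (simp_all add: distrib_right)
  have d: "s + real (Suc k) * d - (s + real k * d) = d" for k by (simp add: distrib_right)
  have g2: "(\<lambda>x. (g x)\<^sup>2) \<in> borel_measurable borel" by (rule borel_measurable_power[OF g(1)])
  have i2: "integrable M (\<lambda>\<omega>. (g (inc W s d k \<omega>))\<^sup>2)"
    "expectation (\<lambda>\<omega>. (g (inc W s d k \<omega>))\<^sup>2) = (\<integral>x. (g (sqrt d * x))\<^sup>2 \<partial>std_normal_distribution)"
    "expectation (\<lambda>\<omega>. g (inc W s d k \<omega>)) = 0" for k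
    using integral_increment[OF le g2, of k] integral_increment[OF le g(1), of k] g(2,3)
    unfolding inc_def d by simp_all
  have A: "g \<circ> inc W s d k \<in> borel_measurable (F (s + real (Suc k) * d))" for k
    using s by (intro measurable_comp[OF inc_adapted g(1)]) auto
  have B: "indep_var borel X borel (\<lambda>\<omega>. g (inc W s d k \<omega>))"
    if "X \<in> borel_measurable (F (s + real k * d))" for X :: "'a \<Rightarrow> real" and k
    unfolding inc_def by (rule indep_var_increment[OF le that g(1)])
  have mono: "sets (F (s + real k * d)) \<subseteq> sets (F (s + real (Suc k) * d))" for k
    using le[of k] by (intro sets_F_mono) auto
  note * = martingale_difference_L2[of "\<lambda>k. F (s + real k * d)" H "\<lambda>k \<omega>. g (inc W s d k \<omega>)",
      OF subalg mono H A[unfolded comp_def] i2(1,3) B]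
  show "integrable M (\<lambda>\<omega>. (\<Sum>k<n. H k \<omega> * g (inc W s d k \<omega>))\<^sup>2)"
    by (rule *(1))
  show "expectation (\<lambda>\<omega>. (\<Sum>k<n. H k \<omega> * g (inc W s d k \<omega>))\<^sup>2)
      = (\<Sum>k<n. expectation (\<lambda>\<omega>. (H k \<omega>)\<^sup>2)) * (\<integral>x. (g (sqrt d * x))\<^sup>2 \<partial>std_normal_distribution)"
    by (simp only: *(2) i2(2) sum_distrib_right)
qed

text \<open>Each centred square has variance of order \<open>(h / real (Suc m))\<^sup>2\<close>, and
  there are \<open>Suc m\<close> orthogonal terms, so the total variance tends to 0.\<close>

lemma quadratic_variation:
  assumes s: "0 \<le> s" "0 < h"
  shows "lim_in_prob M (\<lambda>m \<omega>. \<Sum>j<Suc m. (inc W s (h / real (Suc m)) j \<omega>)\<^sup>2) (\<lambda>_. h)"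
proof -
  interpret G: prob_space std_normal_distribution by (rule prob_space_std_normal)
  have G1: "measure std_normal_distribution UNIV = 1" using G.prob_space by simp
  let ?d = "\<lambda>m. h / real (Suc m)"
  let ?X = "\<lambda>m \<omega>. \<Sum>j<Suc m. 1 * ((inc W s (?d m) j \<omega>)\<^sup>2 - ?d m)"
  define c where "c = (\<integral>x. (x\<^sup>2 - 1)\<^sup>2 \<partial>std_normal_distribution)"
  have i4: "integrable std_normal_distribution (\<lambda>x. (x\<^sup>2 - 1)\<^sup>2)"
  proof -
    have "(x\<^sup>2 - 1)\<^sup>2 = x^4 - 2 * x^2 + 1" for x :: real by (simp add: power2_eq_square power4_eq_xxxx algebra_simps)
    then show ?thesis
      by (simp only:) (intro Bochner_Integration.integrable_add Bochner_Integration.integrable_diff integrable_mult_right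
          integrable_std_normal_distribution_moment G.integrable_const)
  qed
  have i2: "integrable std_normal_distribution (\<lambda>x. x\<^sup>2)"
    using integrable_std_normal_distribution_moment[of 2] by simp
  have z2: "(\<integral>x. x\<^sup>2 \<partial>std_normal_distribution) = 1"
    using std_normal_distribution_even_moments(1)[of 1] by simp
  have dp: "0 < ?d m" for m using s by simp
  have sq: "(sqrt (?d m) * x)\<^sup>2 - ?d m = ?d m * (x\<^sup>2 - 1)" for m x
    using dp[of m] by (simp add: power_mult_distrib right_diff_distrib)
  have z: "(\<integral>x. x\<^sup>2 - 1 \<partial>std_normal_distribution) = 0"
    using Bochner_Integration.integral_diff[OF i2 G.integrable_const[of 1]] z2 G1 by simp
  have t: "integrable M (\<lambda>\<omega>. (?X m \<omega>)\<^sup>2)"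
    "expectation (\<lambda>\<omega>. (?X m \<omega>)\<^sup>2) = (\<Sum>k<Suc m. expectation (\<lambda>\<omega>. 1\<^sup>2)) * ((?d m)\<^sup>2 * c)" for m
  proof -
    let ?g = "\<lambda>x. x\<^sup>2 - ?d m"
    have a: "(\<lambda>_. 1) \<in> borel_measurable (F (s + real k * ?d m))" "integrable M (\<lambda>\<omega>. 1\<^sup>2 :: real)" for k
      by simp_all
    have b: "?g \<in> borel_measurable borel" by simp
    have c: "integrable std_normal_distribution (\<lambda>x. (?g (sqrt (?d m) * x))\<^sup>2)"
      unfolding sq power_mult_distrib[of "?d m"] by (rule integrable_mult_right[OF i4])
    have d: "(\<integral>x. ?g (sqrt (?d m) * x) \<partial>std_normal_distribution) = 0"
      unfolding sq integral_mult_right_zero z by simp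
    have e: "(\<integral>x. (?g (sqrt (?d m) * x))\<^sup>2 \<partial>std_normal_distribution) = (?d m)\<^sup>2 * c"
      unfolding sq power_mult_distrib[of "?d m"] integral_mult_right_zero c_def ..
    show "integrable M (\<lambda>\<omega>. (?X m \<omega>)\<^sup>2)"
      by (rule grid_transform_L2(1)[OF s(1) dp a b c d])
    show "expectation (\<lambda>\<omega>. (?X m \<omega>)\<^sup>2) = (\<Sum>k<Suc m. expectation (\<lambda>\<omega>. 1\<^sup>2)) * ((?d m)\<^sup>2 * c)"
      using grid_transform_L2(2)[OF s(1) dp a b c d] unfolding e .
  qed
  have e: "expectation (\<lambda>\<omega>. (?X m \<omega>)\<^sup>2) = h\<^sup>2 * c * inverse (real (Suc m))" for m
  proof -
    have "N * ((h / N)\<^sup>2 * c) = h\<^sup>2 * c * inverse N" if "N \<noteq> 0" for N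
      using that by (simp add: power2_eq_square field_simps)
    from this[of "real (Suc m)"] show ?thesis
      unfolding t(2) by (simp add: prob_space)
  qed
  have "lim_in_prob M ?X (\<lambda>_. 0)"
  proof (rule lim_in_prob_L2[OF _ t(1)])
    show "random_variable borel (?X m)" for m
      using measurable_inc[OF s(1), of "?d m"] dp[of m]
      by (intro borel_measurable_sum borel_measurable_times borel_measurable_diff borel_measurable_power) auto
    show "(\<lambda>m. expectation (\<lambda>\<omega>. (?X m \<omega>)\<^sup>2)) \<longlonglongrightarrow> 0"
      unfolding e using tendsto_mult[OF tendsto_const[of "h\<^sup>2 * c"] LIMSEQ_inverse_real_of_nat] by simp
  qed
  moreover have "?X m \<omega> - 0 = (\<Sum>j<Suc m. (inc W s (?d m) j \<omega>)\<^sup>2) - h" for m \<omega>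
    by (simp only: mult_1 sum_subtractf sum_constant card_lessThan) simp
  ultimately show ?thesis unfolding lim_in_prob_def by (simp only:)
qed

end

subsection \<open>Joint law of the increments of two correlated Brownian motions\<close>

text \<open>The upper bound rests on the product of 1 - x + x^2/2 and 1 + x + x^2/2, which is 1 +
  x^4/4 and hence at least 1.\<close>

lemma exp_neg_bounds:
  fixes x :: real
  assumes "0 \<le> x"
  shows "\<bar>exp (- x) - (1 - x)\<bar> \<le> x\<^sup>2 / 2"
proof -
  have l: "1 - x \<le> exp (- x)" using exp_ge_add_one_self[of "-x"] by simp
  have q: "1 + x + x\<^sup>2 / 2 \<le> exp x" using exp_lower_Taylor_quadratic[OF assms] .
  have p: "0 < 1 + x + x\<^sup>2 / 2" using assms by (simp add: add_pos_nonneg)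
  have "(1 - x + x\<^sup>2 / 2) * (1 + x + x\<^sup>2 / 2) = 1 + x^4 / 4"
    by (simp add: power2_eq_square power4_eq_xxxx algebra_simps)
  then have "1 \<le> (1 - x + x\<^sup>2 / 2) * (1 + x + x\<^sup>2 / 2)" by simp
  then have "inverse (1 + x + x\<^sup>2 / 2) \<le> 1 - x + x\<^sup>2 / 2"
    using p by (simp add: inverse_eq_divide pos_divide_le_eq)
  moreover have "exp (- x) \<le> inverse (1 + x + x\<^sup>2 / 2)"
    unfolding exp_minus using q p by (rule le_imp_inverse_le)
  ultimately show ?thesis using l by (simp add: abs_le_iff)
qed

lemma cmod_one_plus_i: "(cmod (1 + \<i> * of_real v))\<^sup>2 = 1 + v\<^sup>2"
  by (simp add: cmod_power2)

text \<open>Normalised factors stay in the unit disc, so products of them can be compared factor by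
  factor with products of imaginary exponentials.\<close>

lemma cmod_one_plus_i_exp_le: "cmod ((1 + \<i> * of_real v) * of_real (exp (- v\<^sup>2 / 2))) \<le> 1"
proof (rule power2_le_imp_le)
  have "(cmod ((1 + \<i> * of_real v) * of_real (exp (- v\<^sup>2 / 2))))\<^sup>2 = (1 + v\<^sup>2) * (exp (- v\<^sup>2 / 2))\<^sup>2"
    unfolding norm_mult power_mult_distrib cmod_one_plus_i by simp
  also have "(exp (- v\<^sup>2 / 2))\<^sup>2 = exp (- v\<^sup>2)"
    by (simp add: power2_eq_square flip: exp_add)
  also have "(1 + v\<^sup>2) * exp (- v\<^sup>2) \<le> exp (v\<^sup>2) * exp (- v\<^sup>2)"
    by (intro mult_right_mono exp_ge_add_one_self) simp
  also have "\<dots> = 1\<^sup>2" by (simp flip: exp_add)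
  finally show "(cmod ((1 + \<i> * of_real v) * of_real (exp (- v\<^sup>2 / 2))))\<^sup>2 \<le> 1\<^sup>2" .
qed simp

text \<open>The logarithm of 1 + \<i> v is \<i> v + v^2/2 up to third order, so the factor exp (-
  v^2/2) removes exactly the second-order term. For |v| \<le> 1 both sides are compared with the
  quadratic Taylor polynomial \<open>T\<close>; otherwise both have modulus at most 1 and the bound
  is trivial.\<close>

lemma one_plus_i_exp_approx:
  "cmod ((1 + \<i> * of_real v) * of_real (exp (- v\<^sup>2 / 2)) - iexp v) \<le> 2 * \<bar>v\<bar> ^ 3"
proof (cases "\<bar>v\<bar> \<le> 1")
  case False
  then have "1 \<le> \<bar>v\<bar> ^ 3" by (simp add: one_le_power)
  moreover have "cmod ((1 + \<i> * of_real v) * of_real (exp (- v\<^sup>2 / 2)) - iexp v) \<le> 1 + 1"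
    by (rule order_trans[OF norm_triangle_ineq4 add_mono[OF cmod_one_plus_i_exp_le]]) simp
  ultimately show ?thesis by linarith
next
  case True
  define T where "T = 1 + \<i> * complex_of_real v - complex_of_real (v\<^sup>2 / 2)"
  define e where "e = exp (- v\<^sup>2 / 2) - (1 - v\<^sup>2 / 2)"
  have T: "cmod (iexp v - T) \<le> \<bar>v\<bar> ^ 3 / 6"
    using iexp_approx1[of v 2] unfolding T_def
    by (simp add: eval_nat_numeral power_mult_distrib fact_numeral algebra_simps)
  have ea: "\<bar>e\<bar> \<le> \<bar>v\<bar> ^ 3 / 8"
  proof -
    have "\<bar>e\<bar> \<le> (v\<^sup>2 / 2)\<^sup>2 / 2" unfolding e_def using exp_neg_bounds[of "v\<^sup>2 / 2"] by simp
    also have "\<dots> = \<bar>v\<bar> ^ 3 * \<bar>v\<bar> / 8"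
      by (simp add: power2_eq_square power3_eq_cube abs_mult flip: abs_mult)
    also have "\<dots> \<le> \<bar>v\<bar> ^ 3 * 1 / 8" using True by (intro divide_right_mono mult_left_mono) auto
    finally show ?thesis by simp
  qed
  have c: "cmod (1 + \<i> * of_real v) \<le> 2"
    using norm_triangle_ineq[of 1 "\<i> * complex_of_real v"] True by (simp add: norm_mult)
  have "(1 + \<i> * of_real v) * of_real (exp (- v\<^sup>2 / 2)) - T
    = (1 + \<i> * of_real v) * of_real e - \<i> * of_real (v ^ 3 / 2)"
    unfolding T_def e_def by (simp add: power2_eq_square power3_eq_cube algebra_simps)
  then have "cmod ((1 + \<i> * of_real v) * of_real (exp (- v\<^sup>2 / 2)) - T)
     \<le> cmod (1 + \<i> * of_real v) * \<bar>e\<bar> + \<bar>v\<bar> ^ 3 / 2"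
    using norm_triangle_ineq4[of "(1 + \<i> * of_real v) * of_real e" "\<i> * complex_of_real (v ^ 3 / 2)"]
    by (simp only: norm_mult norm_ii norm_of_real mult_1 abs_divide power_abs abs_numeral)
  also have "\<dots> \<le> 2 * (\<bar>v\<bar> ^ 3 / 8) + \<bar>v\<bar> ^ 3 / 2"
    by (intro add_mono mult_mono c ea) auto
  finally have "cmod ((1 + \<i> * of_real v) * of_real (exp (- v\<^sup>2 / 2)) - T) \<le> 2 * (\<bar>v\<bar> ^ 3 / 8) + \<bar>v\<bar> ^ 3 / 2" .
  moreover have "cmod ((1 + \<i> * of_real v) * of_real (exp (- v\<^sup>2 / 2)) - iexp v)
     \<le> cmod ((1 + \<i> * of_real v) * of_real (exp (- v\<^sup>2 / 2)) - T) + cmod (iexp v - T)"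
    using norm_triangle_ineq4[of "(1 + \<i> * of_real v) * of_real (exp (- v\<^sup>2 / 2)) - T" "iexp v - T"]
    by simp
  moreover have "0 \<le> \<bar>v\<bar> ^ 3" by simp
  ultimately show ?thesis using T by linarith
qed

lemma sum_lessThan_add:
  fixes f :: "nat \<Rightarrow> 'b::comm_monoid_add"
  shows "(\<Sum>i<a + b. f i) = (\<Sum>i<a. f i) + (\<Sum>j<b. f (a + j))"
  by (induction b) (auto simp: add.assoc)

locale correlated_brownian = brownian M F W + Z: brownian M F Z
  for M :: "'a measure" and F :: "real \<Rightarrow> 'a measure" and W Z :: "real \<Rightarrow> 'a \<Rightarrow> real" +
  fixes \<rho> :: real
  assumes covar: "0 \<le> s \<Longrightarrow> covariation_is M W Z s (\<lambda>\<omega>. \<rho> * s)"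
begin

text \<open>The covariation is given only on intervals starting at 0. The uniform grids of [0, kh]
  with k(m+1) cells and of [0, (k+1)h] with (k+1)(m+1) cells have the same spacing, so the sum over
  one cell of length h is a difference of two such sums. This is why the joint law is derived for
  cells starting at a multiple of \<open>h\<close>.\<close>

lemma covariation_increment:
  assumes h: "0 < h"
  shows "lim_in_prob M (\<lambda>m \<omega>. \<Sum>j<Suc m. inc W (real k * h) (h / real (Suc m)) j \<omega>
      * inc Z (real k * h) (h / real (Suc m)) j \<omega>) (\<lambda>_. \<rho> * h)"
proof -
  let ?d = "\<lambda>m. h / real (Suc m)"
  have q: "qcov_sum W Z (real l * h) (l * Suc m) \<omega> = (\<Sum>i<l * Suc m. inc W 0 (?d m) i \<omega> * inc Z 0 (?d m) i \<omega>)" for l m \<omega>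
  proof (cases "l = 0")
    case False
    have "real i * (real l * h) / real (l * Suc m) = real i * ?d m" for i
      unfolding of_nat_mult using False by (simp add: field_simps del: of_nat_Suc)
    then show ?thesis unfolding qcov_sum_def inc_def by (simp only: add_0)
  qed (simp add: qcov_sum_def)
  have shift: "inc V 0 (?d m) (k * Suc m + j) \<omega> = inc V (real k * h) (?d m) j \<omega>" for V :: "real \<Rightarrow> 'a \<Rightarrow> real" and m j \<omega>
  proof -
    have "real (k * Suc m + i) * ?d m = real k * h + real i * ?d m" for i
      unfolding of_nat_add of_nat_mult distrib_right by (simp del: of_nat_Suc)
    from this[of j] this[of "Suc j"] show ?thesis unfolding inc_def by simp
  qed
  have split: "qcov_sum W Z (real (Suc k) * h) (Suc k * Suc m) \<omega> + (- 1) * qcov_sum W Z (real k * h) (k * Suc m) \<omega>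
    = (\<Sum>j<Suc m. inc W (real k * h) (?d m) j \<omega> * inc Z (real k * h) (?d m) j \<omega>)" for m \<omega>
  proof -
    have eq: "Suc k * Suc m = k * Suc m + Suc m" by simp
    have "qcov_sum W Z (real (Suc k) * h) (Suc k * Suc m) \<omega> = (\<Sum>i<k * Suc m. inc W 0 (?d m) i \<omega> * inc Z 0 (?d m) i \<omega>)
        + (\<Sum>j<Suc m. inc W (real k * h) (?d m) j \<omega> * inc Z (real k * h) (?d m) j \<omega>)"
      by (subst q, subst eq, subst sum_lessThan_add) (simp only: shift)
    then show ?thesis using q[of k m \<omega>] by linarith
  qed
  have lim: "lim_in_prob M (\<lambda>m. qcov_sum W Z (real l * h) (l * Suc m)) (\<lambda>\<omega>. \<rho> * (real l * h))" for l
  proof (cases "l = 0")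
    case False
    have f: "filterlim (\<lambda>m. l * Suc m) sequentially sequentially"
      using False by (intro filterlim_subseq) (auto simp: strict_mono_def)
    have "lim_in_prob M (qcov_sum W Z (real l * h)) (\<lambda>\<omega>. \<rho> * (real l * h))"
      using covar[of "real l * h"] h unfolding covariation_is_def by simp
    then show ?thesis by (rule lim_in_prob_subseq[OF _ f])
  qed (simp add: lim_in_prob_def qcov_sum_def not_less)
  have meas: "random_variable borel (qcov_sum W Z (real l * h) (l * Suc m))" for l m
  proof -
    have "(\<lambda>\<omega>. \<Sum>i<l * Suc m. inc W 0 (?d m) i \<omega> * inc Z 0 (?d m) i \<omega>) \<in> borel_measurable M"
      using h by (intro borel_measurable_sum borel_measurable_times measurable_inc Z.measurable_inc) auto
    moreover have "qcov_sum W Z (real l * h) (l * Suc m) = (\<lambda>\<omega>. \<Sum>i<l * Suc m. inc W 0 (?d m) i \<omega> * inc Z 0 (?d m) i \<omega>)"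
      by (intro ext q)
    ultimately show ?thesis by metis
  qed
  have "lim_in_prob M (\<lambda>m \<omega>. qcov_sum W Z (real (Suc k) * h) (Suc k * Suc m) \<omega> + (- 1) * qcov_sum W Z (real k * h) (k * Suc m) \<omega>)
    (\<lambda>\<omega>. \<rho> * (real (Suc k) * h) + (- 1) * (\<rho> * (real k * h)))"
    by (intro lim_in_prob_add lim_in_prob_cmult lim meas borel_measurable_times borel_measurable_const)
  moreover have "\<rho> * (real (Suc k) * h) + (- 1) * (\<rho> * (real k * h)) = \<rho> * h"
    by (simp add: algebra_simps)
  ultimately show ?thesis unfolding split by (simp only:)
qed

text \<open>The increments of \<open>W\<close> and of \<open>Z\<close> are each centred and
  independent of the past. Every factor is affine in the two increments, so the product is a
  martingale without any knowledge of their joint law.\<close>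

lemma product_martingale:
  fixes a b s d :: real
  defines "v \<equiv> \<lambda>j \<omega>. a * inc W s d j \<omega> + b * inc Z s d j \<omega>"
  defines "P \<equiv> \<lambda>n \<omega>. \<Prod>j<n. (1 + \<i> * complex_of_real (v j \<omega>))"
  assumes s: "0 \<le> s" "0 < d" and A: "A \<in> sets (F s)"
  shows "P n \<in> borel_measurable (F (s + real n * d))" (is ?m)
    and "integrable M (\<lambda>\<omega>. (cmod (P n \<omega>))\<^sup>2)" (is ?i)
    and "expectation (\<lambda>\<omega>. (cmod (P n \<omega>))\<^sup>2) \<le> (1 + 2 * (a\<^sup>2 + b\<^sup>2) * d) ^ n" (is ?b)
    and "expectation (\<lambda>\<omega>. complex_of_real (indicator A \<omega>) * P n \<omega>) = prob A" (is ?e)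
proof -
  have A': "A \<in> events" using A by (rule sets_F)
  have i1: "integrable std_normal_distribution (\<lambda>x. complex_of_real (sqrt d * x))"
    using integrable_std_normal_distribution_moment[of 1] by simp
  have e1: "(\<integral>x. complex_of_real (sqrt d * x) \<partial>std_normal_distribution) = 0"
    using integral_std_normal_distribution_moment_odd[of 1] by simp
  have i2: "integrable std_normal_distribution (\<lambda>x. (sqrt d * x)\<^sup>2)"
    unfolding power_mult_distrib by (intro integrable_mult_right integrable_std_normal_distribution_moment)
  have e2: "(\<integral>x. (sqrt d * x)\<^sup>2 \<partial>std_normal_distribution) = d"
    unfolding power_mult_distrib using std_normal_distribution_even_moments(1)[of 1] s by simp
  have "?m \<and> ?i \<and> ?b \<and> ?e"
  proof (induction n)
    case 0
    show ?case using A' by (simp add: P_def prob_space)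
  next
    case (Suc n)
    then have Pm: "P n \<in> borel_measurable (F (s + real n * d))" and Pi: "integrable M (\<lambda>\<omega>. (cmod (P n \<omega>))\<^sup>2)"
      and Pb: "expectation (\<lambda>\<omega>. (cmod (P n \<omega>))\<^sup>2) \<le> (1 + 2 * (a\<^sup>2 + b\<^sup>2) * d) ^ n"
      and Pe: "expectation (\<lambda>\<omega>. complex_of_real (indicator A \<omega>) * P n \<omega>) = prob A" by blast+
    let ?s = "s + real n * d" and ?t = "s + real (Suc n) * d"
    have st: "0 \<le> ?s" "?s < ?t" using s by (simp_all add: distrib_right)
    have ts: "?t - ?s = d" by (simp add: distrib_right)
    have step: "P (Suc n) = (\<lambda>\<omega>. P n \<omega> * (1 + \<i> * complex_of_real (v n \<omega>)))" by (simp add: P_def)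
    have vm: "v n \<in> borel_measurable (F ?t)"
      unfolding v_def using s
      by (intro borel_measurable_add borel_measurable_times borel_measurable_const inc_adapted Z.inc_adapted) auto
    have m: "P (Suc n) \<in> borel_measurable (F ?t)"
      unfolding step using measurable_F_mono[OF Pm] st vm
      by (intro borel_measurable_times borel_measurable_add borel_measurable_const borel_measurable_of_real) auto
    have PM: "P n \<in> borel_measurable M" by (rule measurable_F[OF Pm])
    have cm: "(\<lambda>\<omega>. (cmod (P n \<omega>))\<^sup>2) \<in> borel_measurable (F ?s)"
      using Pm by simp
    note W2 = integral_mult_increment[OF st, unfolded ts, of "\<lambda>x. x\<^sup>2", OF _ i2 cm Pi, unfolded e2]
    note Z2 = Z.integral_mult_increment[OF st, unfolded ts, of "\<lambda>x. x\<^sup>2", OF _ i2 cm Pi, unfolded e2]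
    have W2': "integrable M (\<lambda>\<omega>. (cmod (P n \<omega>))\<^sup>2 * (inc W s d n \<omega>)\<^sup>2)"
      "expectation (\<lambda>\<omega>. (cmod (P n \<omega>))\<^sup>2 * (inc W s d n \<omega>)\<^sup>2) = expectation (\<lambda>\<omega>. (cmod (P n \<omega>))\<^sup>2) * d"
      unfolding inc_def by (rule W2; simp)+
    have Z2': "integrable M (\<lambda>\<omega>. (cmod (P n \<omega>))\<^sup>2 * (inc Z s d n \<omega>)\<^sup>2)"
      "expectation (\<lambda>\<omega>. (cmod (P n \<omega>))\<^sup>2 * (inc Z s d n \<omega>)\<^sup>2) = expectation (\<lambda>\<omega>. (cmod (P n \<omega>))\<^sup>2) * d"
      unfolding inc_def by (rule Z2; simp)+
    let ?U = "\<lambda>\<omega>. (cmod (P n \<omega>))\<^sup>2 + ((2 * a\<^sup>2) * ((cmod (P n \<omega>))\<^sup>2 * (inc W s d n \<omega>)\<^sup>2)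
       + (2 * b\<^sup>2) * ((cmod (P n \<omega>))\<^sup>2 * (inc Z s d n \<omega>)\<^sup>2))"
    have Ui: "integrable M ?U"
      by (intro Bochner_Integration.integrable_add integrable_mult_right W2' Z2' Pi)
    have Ue: "expectation ?U = expectation (\<lambda>\<omega>. (cmod (P n \<omega>))\<^sup>2) * (1 + 2 * (a\<^sup>2 + b\<^sup>2) * d)"
      using Pi W2' Z2' by (simp add: algebra_simps)
    have le: "(cmod (P (Suc n) \<omega>))\<^sup>2 \<le> ?U \<omega>" for \<omega>
    proof -
      \<comment> \<open>The cross term is absorbed by doubling the squares, because the dependence
        between the two increments is not yet known; this is the origin of the factor 2 in the L2
        bound.\<close>
      have "(v n \<omega>)\<^sup>2 \<le> 2 * a\<^sup>2 * (inc W s d n \<omega>)\<^sup>2 + 2 * b\<^sup>2 * (inc Z s d n \<omega>)\<^sup>2"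
        unfolding v_def using sum_squares_bound[of "a * inc W s d n \<omega>" "b * inc Z s d n \<omega>"]
        by (simp add: power2_sum power_mult_distrib)
      then have "(cmod (P n \<omega>))\<^sup>2 * (1 + (v n \<omega>)\<^sup>2) \<le>
          (cmod (P n \<omega>))\<^sup>2 * (1 + (2 * a\<^sup>2 * (inc W s d n \<omega>)\<^sup>2 + 2 * b\<^sup>2 * (inc Z s d n \<omega>)\<^sup>2))"
        by (intro mult_left_mono add_left_mono) auto
      then show ?thesis unfolding step norm_mult power_mult_distrib cmod_one_plus_i by (simp add: algebra_simps)
    qed
    have Si: "integrable M (\<lambda>\<omega>. (cmod (P (Suc n) \<omega>))\<^sup>2)"
    proof (rule Bochner_Integration.integrable_bound[OF Ui])
      show "(\<lambda>\<omega>. (cmod (P (Suc n) \<omega>))\<^sup>2) \<in> borel_measurable M"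
        using measurable_F[OF m] by simp
      show "AE \<omega> in M. norm ((cmod (P (Suc n) \<omega>))\<^sup>2) \<le> norm (?U \<omega>)"
        using order_trans[OF le abs_ge_self] by (intro AE_I2) simp
    qed
    have "expectation (\<lambda>\<omega>. (cmod (P (Suc n) \<omega>))\<^sup>2) \<le> expectation ?U"
      by (rule integral_mono[OF Si Ui le])
    also have "\<dots> \<le> (1 + 2 * (a\<^sup>2 + b\<^sup>2) * d) ^ Suc n"
      unfolding Ue power_Suc2 using s by (intro mult_right_mono Pb) (auto intro!: add_nonneg_nonneg)
    finally have Sb: "expectation (\<lambda>\<omega>. (cmod (P (Suc n) \<omega>))\<^sup>2) \<le> (1 + 2 * (a\<^sup>2 + b\<^sup>2) * d) ^ Suc n" .
    let ?G = "\<lambda>\<omega>. complex_of_real (indicator A \<omega>) * P n \<omega>"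
    have "A \<in> sets (F ?s)" using A sets_F_mono[of s ?s] s by auto
    then have Gm: "?G \<in> borel_measurable (F ?s)"
      using Pm by measurable
    have Gi: "integrable M ?G"
    proof (rule Bochner_Integration.integrable_bound)
      show "integrable M (\<lambda>\<omega>. 1 + (cmod (P n \<omega>))\<^sup>2)"
        by (intro Bochner_Integration.integrable_add integrable_const Pi)
      show "?G \<in> borel_measurable M" by (rule measurable_F[OF Gm])
      have "x \<le> 1 + x\<^sup>2" if "0 \<le> x" for x :: real
        using that sum_squares_bound[of x 1] by (simp add: power2_eq_square)
      then show "AE \<omega> in M. norm (?G \<omega>) \<le> norm (1 + (cmod (P n \<omega>))\<^sup>2)"
        by (intro AE_I2) (auto simp: norm_mult indicator_def)
    qed
    have W1: "integrable M (\<lambda>\<omega>. ?G \<omega> * complex_of_real (inc W s d n \<omega>))"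
      "expectation (\<lambda>\<omega>. ?G \<omega> * complex_of_real (inc W s d n \<omega>)) = 0"
      using integral_mult_increment[OF st, unfolded ts, of complex_of_real, OF _ i1 Gm Gi] e1
      unfolding inc_def by simp_all
    have Z1: "integrable M (\<lambda>\<omega>. ?G \<omega> * complex_of_real (inc Z s d n \<omega>))"
      "expectation (\<lambda>\<omega>. ?G \<omega> * complex_of_real (inc Z s d n \<omega>)) = 0"
      using Z.integral_mult_increment[OF st, unfolded ts, of complex_of_real, OF _ i1 Gm Gi] e1
      unfolding inc_def by simp_all
    have "complex_of_real (indicator A \<omega>) * P (Suc n) \<omega> = ?G \<omega>
      + ((\<i> * a) * (?G \<omega> * complex_of_real (inc W s d n \<omega>)) + (\<i> * b) * (?G \<omega> * complex_of_real (inc Z s d n \<omega>)))" for \<omega>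
      unfolding step v_def by (simp add: algebra_simps)
    then have "expectation (\<lambda>\<omega>. complex_of_real (indicator A \<omega>) * P (Suc n) \<omega>) = expectation (\<lambda>\<omega>. ?G \<omega>
      + ((\<i> * a) * (?G \<omega> * complex_of_real (inc W s d n \<omega>)) + (\<i> * b) * (?G \<omega> * complex_of_real (inc Z s d n \<omega>))))"
      by (simp only:)
    also have "\<dots> = expectation ?G + ((\<i> * a) * 0 + (\<i> * b) * 0)"
      unfolding Bochner_Integration.integral_add[OF Gi Bochner_Integration.integrable_add[OF
          integrable_mult_right[OF W1(1)] integrable_mult_right[OF Z1(1)]]]
        Bochner_Integration.integral_add[OF integrable_mult_right[OF W1(1)] integrable_mult_right[OF Z1(1)]]
        integral_mult_right_zero W1(2) Z1(2) ..
    finally have "expectation (\<lambda>\<omega>. complex_of_real (indicator A \<omega>) * P (Suc n) \<omega>) = prob A"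
      using Pe by simp
    with m Si Sb show ?case by blast
  qed
  then show ?m ?i ?b ?e by blast+
qed

text \<open>With \<open>Q\<close> the product of the normalised factors and \<open>S\<close> the sum
  of squares, \<open>P = Q * exp (S / 2)\<close>. Here \<open>Q\<close> tends to the imaginary
  exponential and \<open>S\<close> to the constant \<open>q\<close>, so \<open>P\<close> tends to
  \<open>exp (q / 2)\<close> times that exponential. Since the expectation of \<open>P\<close> over
  \<open>A\<close> is always \<open>prob A\<close>, the expectation of the exponential over
  \<open>A\<close> is \<open>prob A\<close> divided by \<open>exp (q / 2)\<close>.\<close>

lemma char_increment:
  fixes a b h :: real and k :: nat
  defines "s \<equiv> real k * h"
  assumes h: "0 < h" and A: "A \<in> sets (F s)"
  shows "expectation (\<lambda>\<omega>. complex_of_real (indicator A \<omega>)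
      * iexp (a * (W (s + h) \<omega> - W s \<omega>) + b * (Z (s + h) \<omega> - Z s \<omega>)))
    = complex_of_real (prob A * exp (- (a\<^sup>2 + 2 * \<rho> * a * b + b\<^sup>2) * h / 2))"
proof -
  interpret G: prob_space std_normal_distribution by (rule prob_space_std_normal)
  have s: "0 \<le> s" using h by (simp add: s_def)
  define d where "d m = h / real (Suc m)" for m
  have d: "0 < d m" "0 \<le> d m" "real (Suc m) * d m = h" for m using h by (simp_all add: d_def)
  define v where "v m j \<omega> = a * inc W s (d m) j \<omega> + b * inc Z s (d m) j \<omega>" for m j \<omega>
  define P where "P m \<omega> = (\<Prod>j<Suc m. (1 + \<i> * complex_of_real (v m j \<omega>)))" for m \<omega>
  define Q where "Q m \<omega> = (\<Prod>j<Suc m. (1 + \<i> * complex_of_real (v m j \<omega>)) * of_real (exp (- (v m j \<omega>)\<^sup>2 / 2)))" for m \<omega>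
  define S where "S m \<omega> = (\<Sum>j<Suc m. (v m j \<omega>)\<^sup>2)" for m \<omega>
  define V where "V \<omega> = a * (W (s + h) \<omega> - W s \<omega>) + b * (Z (s + h) \<omega> - Z s \<omega>)" for \<omega>
  define q where "q = (a\<^sup>2 + 2 * \<rho> * a * b + b\<^sup>2) * h"
  define E where "E = exp (q / 2)"
  have A' [measurable]: "A \<in> events" using A by (rule sets_F)
  have [measurable]: "random_variable borel (inc W s (d m) j)" "random_variable borel (inc Z s (d m) j)" for m j
    by (rule measurable_inc[OF s d(2)], rule Z.measurable_inc[OF s d(2)])
  have [measurable]: "random_variable borel (v m j)" for m j unfolding v_def by measurable
  have [measurable]: "random_variable borel (P m)" "random_variable borel (Q m)" "random_variable borel (S m)" for m
    unfolding P_def Q_def S_def by measurable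
  have [measurable]: "random_variable borel V"
    unfolding V_def using s h
    by (intro borel_measurable_add borel_measurable_times borel_measurable_const borel_measurable_diff
        measurable_W Z.measurable_W) auto
  have Vsum: "V \<omega> = (\<Sum>j<Suc m. v m j \<omega>)" for m \<omega>
    unfolding v_def sum.distrib sum_distrib_left[symmetric] sum_inc d(3) V_def ..
  have PQ: "P m \<omega> = Q m \<omega> * of_real (exp (S m \<omega> / 2))" for m \<omega>
  proof -
    have "(\<Prod>j<Suc m. complex_of_real (exp (- (v m j \<omega>)\<^sup>2 / 2))) = of_real (exp (- (S m \<omega> / 2)))"
      unfolding S_def of_real_prod[symmetric] exp_sum[OF finite_lessThan, symmetric]
      by (simp only: sum_negf sum_divide_distrib[symmetric] minus_divide_left)
    then have "Q m \<omega> = P m \<omega> * of_real (exp (- (S m \<omega> / 2)))"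
      unfolding Q_def P_def prod.distrib by simp
    then show ?thesis by (simp add: mult.assoc flip: of_real_mult exp_add)
  qed
  have Q1: "cmod (Q m \<omega>) \<le> 1" for m \<omega>
    unfolding Q_def prod_norm[symmetric] by (intro prod_le_1) (simp only: norm_ge_zero cmod_one_plus_i_exp_le)
  note pm = product_martingale[OF s d(1) A, where a = a and b = b, folded v_def]
  have P2: "integrable M (\<lambda>\<omega>. (cmod (P m \<omega>))\<^sup>2)" for m
    unfolding P_def by (rule pm(2))
  have Pe: "expectation (\<lambda>\<omega>. complex_of_real (indicator A \<omega>) * P m \<omega>) = prob A" for m
    unfolding P_def by (rule pm(4))
  define C where "C = exp (2 * (a\<^sup>2 + b\<^sup>2) * h)"
  have PC: "expectation (\<lambda>\<omega>. (cmod (P m \<omega>))\<^sup>2) \<le> C" for m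
  proof -
    have "expectation (\<lambda>\<omega>. (cmod (P m \<omega>))\<^sup>2) \<le> (1 + 2 * (a\<^sup>2 + b\<^sup>2) * d m) ^ Suc m"
      unfolding P_def by (rule pm(3))
    \<comment> \<open>Passing from 1 + x to exp x turns the \<open>Suc m\<close>-fold product into a
      bound free of \<open>m\<close>.\<close>
    also have "\<dots> \<le> exp (2 * (a\<^sup>2 + b\<^sup>2) * d m) ^ Suc m"
      using d(2)[of m] by (intro power_mono exp_ge_add_one_self) (auto intro!: add_nonneg_nonneg)
    also have "\<dots> = C"
      unfolding C_def exp_of_nat_mult[symmetric] d(3)[of m, symmetric] by (simp only: mult.left_commute)
    finally show ?thesis .
  qed

  \<comment> \<open>First error: replacing the random exponent \<open>S m\<close> by its limit. It
    vanishes in probability because \<open>S\<close> converges and \<open>Q\<close> is bounded, and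
    then in L1 because \<open>P\<close> is bounded in L2.\<close>
  define X where "X m \<omega> = cmod (P m \<omega> - Q m \<omega> * of_real E)" for m \<omega>
  have [measurable]: "random_variable borel (X m)" for m unfolding X_def by measurable
  have XS: "X m \<omega> \<le> \<bar>exp (S m \<omega> / 2) - E\<bar>" for m \<omega>
  proof -
    have "X m \<omega> = cmod (Q m \<omega>) * \<bar>exp (S m \<omega> / 2) - E\<bar>"
      unfolding X_def PQ right_diff_distrib[symmetric] of_real_diff[symmetric] norm_mult norm_of_real ..
    also have "\<dots> \<le> 1 * \<bar>exp (S m \<omega> / 2) - E\<bar>" by (intro mult_right_mono Q1) simp
    finally show ?thesis by simp
  qed
  \<comment> \<open>Expanding the squares of \<open>v\<close> gives two quadratic variations and a
    covariation; this is where the correlation enters.\<close>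
  have Slim: "lim_in_prob M S (\<lambda>_. q)"
  proof -
    have "lim_in_prob M (\<lambda>m \<omega>. a\<^sup>2 * (\<Sum>j<Suc m. (inc W s (d m) j \<omega>)\<^sup>2)
        + ((2 * a * b) * (\<Sum>j<Suc m. inc W s (d m) j \<omega> * inc Z s (d m) j \<omega>) + b\<^sup>2 * (\<Sum>j<Suc m. (inc Z s (d m) j \<omega>)\<^sup>2)))
      (\<lambda>_. a\<^sup>2 * h + ((2 * a * b) * (\<rho> * h) + b\<^sup>2 * h))"
      by (intro lim_in_prob_add lim_in_prob_cmult; (unfold d_def s_def)?;
          (rule quadratic_variation Z.quadratic_variation covariation_increment)?;
          (unfold d_def[symmetric] s_def[symmetric])?; (use s h in \<open>(measurable | simp)\<close>)?)
    moreover have "a\<^sup>2 * (\<Sum>j<Suc m. (inc W s (d m) j \<omega>)\<^sup>2)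
        + ((2 * a * b) * (\<Sum>j<Suc m. inc W s (d m) j \<omega> * inc Z s (d m) j \<omega>) + b\<^sup>2 * (\<Sum>j<Suc m. (inc Z s (d m) j \<omega>)\<^sup>2))
        = S m \<omega>" for m \<omega>
      unfolding S_def sum_distrib_left sum.distrib[symmetric] v_def
      by (intro sum.cong refl) (simp add: power2_eq_square algebra_simps)
    moreover have "a\<^sup>2 * h + ((2 * a * b) * (\<rho> * h) + b\<^sup>2 * h) = q"
      by (simp add: q_def algebra_simps)
    ultimately show ?thesis by (simp only:)
  qed
  have Xlim: "lim_in_prob M X (\<lambda>_. 0)"
    unfolding lim_in_prob_def
  proof (intro allI impI)
    fix e :: real assume e: "e > 0"
    have "isCont (\<lambda>x. exp (x / 2)) q" by (intro continuous_intros) simp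
    then obtain \<delta> where \<delta>: "\<delta> > 0" "\<And>x. \<bar>x - q\<bar> < \<delta> \<Longrightarrow> \<bar>exp (x / 2) - E\<bar> < e"
      using e unfolding E_def continuous_at_eps_delta dist_real_def by meson
    have lim: "(\<lambda>m. prob {\<omega> \<in> space M. \<delta>/2 < \<bar>S m \<omega> - q\<bar>}) \<longlonglongrightarrow> 0"
      by (rule Slim[unfolded lim_in_prob_def, rule_format]) (use \<delta>(1) in simp)
    have le: "prob {\<omega> \<in> space M. e < \<bar>X m \<omega> - 0\<bar>} \<le> prob {\<omega> \<in> space M. \<delta>/2 < \<bar>S m \<omega> - q\<bar>}" for m
    proof (intro finite_measure_mono subsetI)
      fix \<omega> assume "\<omega> \<in> {\<omega> \<in> space M. e < \<bar>X m \<omega> - 0\<bar>}"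
      then have \<omega>: "\<omega> \<in> space M" and "e < X m \<omega>" by (auto simp: X_def)
      then have "e < \<bar>exp (S m \<omega> / 2) - E\<bar>" using XS[of m \<omega>] by linarith
      then have "\<not> \<bar>S m \<omega> - q\<bar> < \<delta>" using \<delta>(2)[of "S m \<omega>"] by linarith
      then have "\<delta>/2 < \<bar>S m \<omega> - q\<bar>" using \<delta>(1) by linarith
      then show "\<omega> \<in> {\<omega> \<in> space M. \<delta>/2 < \<bar>S m \<omega> - q\<bar>}" using \<omega> by blast
    qed measurable
    show "(\<lambda>m. prob {\<omega> \<in> space M. e < \<bar>X m \<omega> - 0\<bar>}) \<longlonglongrightarrow> 0"
      by (rule tendsto_sandwich[OF _ _ tendsto_const lim]; intro always_eventually allI le) simp
  qed
  have X2: "(X m \<omega>)\<^sup>2 \<le> 2 * (cmod (P m \<omega>))\<^sup>2 + 2 * E\<^sup>2" for m \<omega>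
  proof -
    have "X m \<omega> \<le> cmod (P m \<omega>) + cmod (Q m \<omega>) * E"
      unfolding X_def using norm_triangle_ineq4[of "P m \<omega>" "Q m \<omega> * of_real E"] by (simp add: norm_mult E_def)
    also have "\<dots> \<le> cmod (P m \<omega>) + 1 * E" by (intro add_left_mono mult_right_mono Q1) (simp add: E_def)
    finally have "(X m \<omega>)\<^sup>2 \<le> (cmod (P m \<omega>) + E)\<^sup>2" by (intro power_mono) (simp_all add: X_def)
    also have "\<dots> \<le> 2 * (cmod (P m \<omega>))\<^sup>2 + 2 * E\<^sup>2"
      using sum_squares_bound[of "cmod (P m \<omega>)" E] by (simp add: power2_sum)
    finally show ?thesis .
  qed
  have bi: "integrable M (\<lambda>\<omega>. 2 * (cmod (P m \<omega>))\<^sup>2 + 2 * E\<^sup>2)" for m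
    by (intro Bochner_Integration.integrable_add integrable_mult_right P2 integrable_const)
  have X2i: "integrable M (\<lambda>\<omega>. (X m \<omega>)\<^sup>2)" for m
  proof (rule Bochner_Integration.integrable_bound[OF bi[of m]])
    show "AE \<omega> in M. norm ((X m \<omega>)\<^sup>2) \<le> norm (2 * (cmod (P m \<omega>))\<^sup>2 + 2 * E\<^sup>2)"
      unfolding real_norm_def abs_of_nonneg[OF zero_le_power2]
      by (intro AE_I2 order_trans[OF X2 abs_ge_self])
  qed measurable
  have X2b: "expectation (\<lambda>\<omega>. (X m \<omega>)\<^sup>2) \<le> 2 * C + 2 * E\<^sup>2" for m
  proof -
    have "expectation (\<lambda>\<omega>. (X m \<omega>)\<^sup>2) \<le> expectation (\<lambda>\<omega>. 2 * (cmod (P m \<omega>))\<^sup>2 + 2 * E\<^sup>2)"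
      by (rule integral_mono[OF X2i bi X2])
    also have "\<dots> = 2 * expectation (\<lambda>\<omega>. (cmod (P m \<omega>))\<^sup>2) + 2 * E\<^sup>2"
      unfolding Bochner_Integration.integral_add[OF integrable_mult_right[OF P2] integrable_const] integral_mult_right_zero
      by (simp add: prob_space)
    also have "\<dots> \<le> 2 * C + 2 * E\<^sup>2" using PC[of m] by simp
    finally show ?thesis .
  qed
  have XL1: "(\<lambda>m. expectation (\<lambda>\<omega>. \<bar>X m \<omega>\<bar>)) \<longlonglongrightarrow> 0"
    by (rule L1_tendsto_0_of_L2_bounded[OF _ Xlim X2i X2b]) measurable
  have X1i: "integrable M (X m)" for m
    by (rule square_integrable_imp_integrable[OF _ X2i]) simp

  \<comment> \<open>Second error: replacing \<open>Q\<close> by the imaginary exponential. Each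
    factor contributes an expected error of order \<open>sqrt (d m) ^ 3\<close>, which makes order
    \<open>sqrt (d m)\<close> in total.\<close>
  define R where "R m \<omega> = cmod (Q m \<omega> - iexp (V \<omega>))" for m \<omega>
  have [measurable]: "random_variable borel (R m)" for m unfolding R_def by measurable
  have R2: "R m \<omega> \<le> 2" for m \<omega>
    unfolding R_def by (rule order_trans[OF norm_triangle_ineq4]) (use Q1[of m \<omega>] in simp)
  have Ri: "integrable M (R m)" for m
  proof (rule integrable_const_bound[where B = 2])
    have "\<bar>R m \<omega>\<bar> = R m \<omega>" for \<omega> by (simp add: R_def)
    then show "AE \<omega> in M. norm (R m \<omega>) \<le> 2" using R2 by simp
  qed measurable
  have RL1: "(\<lambda>m. expectation (R m)) \<longlonglongrightarrow> 0"
  proof -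
    define \<kappa> where "\<kappa> = (\<integral>x. \<bar>x\<bar> ^ 3 \<partial>std_normal_distribution)"
    have i3: "integrable std_normal_distribution (\<lambda>x. \<bar>x\<bar> ^ 3)"
      using integrable_abs[OF integrable_std_normal_distribution_moment[of 3]] by (simp add: power_abs)
    have sc: "\<bar>sqrt (d m) * x\<bar> ^ 3 = sqrt (d m) ^ 3 * \<bar>x\<bar> ^ 3" for m x
      using d(2)[of m] by (simp add: abs_mult power_mult_distrib)
    have st: "0 \<le> s + real j * d m" "s + real j * d m < s + real (Suc j) * d m"
      "s + real (Suc j) * d m - (s + real j * d m) = d m" for j m
      using s d[of m] by (simp_all add: distrib_right)
    have g3: "(\<lambda>x::real. \<bar>x\<bar> ^ 3) \<in> borel_measurable borel" by measurable
    have W3: "integrable M (\<lambda>\<omega>. \<bar>inc W s (d m) j \<omega>\<bar> ^ 3)"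
      "expectation (\<lambda>\<omega>. \<bar>inc W s (d m) j \<omega>\<bar> ^ 3) = sqrt (d m) ^ 3 * \<kappa>" for m j
      using integral_increment[OF st(1,2)[of j m] g3] integrable_mult_right[OF i3, of "sqrt (d m) ^ 3"]
      unfolding inc_def st(3) sc integral_mult_right_zero \<kappa>_def by simp_all
    have Z3: "integrable M (\<lambda>\<omega>. \<bar>inc Z s (d m) j \<omega>\<bar> ^ 3)"
      "expectation (\<lambda>\<omega>. \<bar>inc Z s (d m) j \<omega>\<bar> ^ 3) = sqrt (d m) ^ 3 * \<kappa>" for m j
      using Z.integral_increment[OF st(1,2)[of j m] g3] integrable_mult_right[OF i3, of "sqrt (d m) ^ 3"]
      unfolding inc_def st(3) sc integral_mult_right_zero \<kappa>_def by simp_all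
    let ?b = "\<lambda>m j \<omega>. (8 * \<bar>a\<bar> ^ 3) * \<bar>inc W s (d m) j \<omega>\<bar> ^ 3 + (8 * \<bar>b\<bar> ^ 3) * \<bar>inc Z s (d m) j \<omega>\<bar> ^ 3"
    have bi: "integrable M (?b m j)" for m j
      by (intro Bochner_Integration.integrable_add integrable_mult_right W3 Z3)
    have be: "expectation (?b m j) = (8 * \<bar>a\<bar> ^ 3 + 8 * \<bar>b\<bar> ^ 3) * \<kappa> * sqrt (d m) ^ 3" for m j
      unfolding Bochner_Integration.integral_add[OF integrable_mult_right[OF W3(1)] integrable_mult_right[OF Z3(1)]]
        integral_mult_right_zero W3(2) Z3(2) by (simp add: algebra_simps)
    have cube: "(x + y) ^ 3 \<le> 4 * (x ^ 3 + y ^ 3)" if "0 \<le> x" "0 \<le> y" for x y :: real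
    proof -
      have "4 * (x ^ 3 + y ^ 3) - (x + y) ^ 3 = 3 * ((x + y) * (x - y)\<^sup>2)"
        by (simp add: power2_eq_square power3_eq_cube algebra_simps)
      moreover have "0 \<le> 3 * ((x + y) * (x - y)\<^sup>2)" using that by simp
      ultimately show ?thesis by linarith
    qed
    have vb: "2 * \<bar>v m j \<omega>\<bar> ^ 3 \<le> ?b m j \<omega>" for m j \<omega>
    proof -
      have "\<bar>v m j \<omega>\<bar> ^ 3 \<le> (\<bar>a\<bar> * \<bar>inc W s (d m) j \<omega>\<bar> + \<bar>b\<bar> * \<bar>inc Z s (d m) j \<omega>\<bar>) ^ 3"
        unfolding v_def abs_mult[symmetric] by (intro power_mono abs_triangle_ineq) simp
      also have "\<dots> \<le> 4 * ((\<bar>a\<bar> * \<bar>inc W s (d m) j \<omega>\<bar>) ^ 3 + (\<bar>b\<bar> * \<bar>inc Z s (d m) j \<omega>\<bar>) ^ 3)"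
        by (intro cube) auto
      finally show ?thesis by (simp add: power_mult_distrib algebra_simps)
    qed
    have Rb: "R m \<omega> \<le> (\<Sum>j<Suc m. ?b m j \<omega>)" for m \<omega>
    proof -
      have "iexp (V \<omega>) = (\<Prod>j<Suc m. iexp (v m j \<omega>))"
        unfolding Vsum[of \<omega> m] of_real_sum sum_distrib_left by (rule exp_sum) simp
      then have "R m \<omega> \<le> (\<Sum>j<Suc m. cmod ((1 + \<i> * complex_of_real (v m j \<omega>)) * of_real (exp (- (v m j \<omega>)\<^sup>2 / 2)) - iexp (v m j \<omega>)))"
        unfolding R_def Q_def
        by (simp only:) (intro norm_prod_diff cmod_one_plus_i_exp_le, simp)
      also have "\<dots> \<le> (\<Sum>j<Suc m. ?b m j \<omega>)"
        by (intro sum_mono order_trans[OF one_plus_i_exp_approx vb])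
      finally show ?thesis .
    qed
    have le: "expectation (R m) \<le> (8 * \<bar>a\<bar> ^ 3 + 8 * \<bar>b\<bar> ^ 3) * \<kappa> * h * sqrt (d m)" for m
    proof -
      have "expectation (R m) \<le> expectation (\<lambda>\<omega>. \<Sum>j<Suc m. ?b m j \<omega>)"
        by (intro integral_mono Ri Rb Bochner_Integration.integrable_sum bi)
      also have "\<dots> = (\<Sum>j<Suc m. expectation (?b m j))"
        by (rule Bochner_Integration.integral_sum) (rule bi)
      also have "\<dots> = real (Suc m) * ((8 * \<bar>a\<bar> ^ 3 + 8 * \<bar>b\<bar> ^ 3) * \<kappa> * sqrt (d m) ^ 3)"
        unfolding be by simp
      also have "sqrt (d m) ^ 3 = d m * sqrt (d m)"
        using d(2)[of m] by (simp add: power3_eq_cube)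
      also have "real (Suc m) * ((8 * \<bar>a\<bar> ^ 3 + 8 * \<bar>b\<bar> ^ 3) * \<kappa> * (d m * sqrt (d m)))
          = (8 * \<bar>a\<bar> ^ 3 + 8 * \<bar>b\<bar> ^ 3) * \<kappa> * (real (Suc m) * d m) * sqrt (d m)"
        by (simp only: ac_simps)
      finally show ?thesis unfolding d(3) .
    qed
    have d0: "d \<longlonglongrightarrow> 0"
      unfolding d_def using tendsto_mult[OF tendsto_const[of h] LIMSEQ_inverse_real_of_nat]
      by (simp add: divide_inverse)
    have lim: "(\<lambda>m. (8 * \<bar>a\<bar> ^ 3 + 8 * \<bar>b\<bar> ^ 3) * \<kappa> * h * sqrt (d m)) \<longlonglongrightarrow> 0"
      using tendsto_mult[OF tendsto_const[of "(8 * \<bar>a\<bar> ^ 3 + 8 * \<bar>b\<bar> ^ 3) * \<kappa> * h"] tendsto_real_sqrt[OF d0]] by simp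
    show ?thesis
      by (rule tendsto_sandwich[OF _ _ tendsto_const lim]; intro always_eventually allI le) (simp add: R_def)
  qed

  have bound: "cmod (of_real (prob A) - of_real E * expectation (\<lambda>\<omega>. complex_of_real (indicator A \<omega>) * iexp (V \<omega>)))
      \<le> expectation (\<lambda>\<omega>. \<bar>X m \<omega>\<bar>) + E * expectation (R m)" for m
  proof -
    have Pi: "integrable M (\<lambda>\<omega>. complex_of_real (indicator A \<omega>) * P m \<omega>)"
    proof (rule Bochner_Integration.integrable_bound)
      show "integrable M (\<lambda>\<omega>. 1 + (cmod (P m \<omega>))\<^sup>2)"
        by (intro Bochner_Integration.integrable_add integrable_const P2)
      have "x \<le> 1 + x\<^sup>2" if "0 \<le> x" for x :: real
        using that sum_squares_bound[of x 1] by (simp add: power2_eq_square)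
      then show "AE \<omega> in M. norm (complex_of_real (indicator A \<omega>) * P m \<omega>) \<le> norm (1 + (cmod (P m \<omega>))\<^sup>2)"
        by (intro AE_I2) (auto simp: norm_mult indicator_def)
    qed measurable
    have Vi: "integrable M (\<lambda>\<omega>. complex_of_real (indicator A \<omega>) * iexp (V \<omega>))"
      by (rule integrable_const_bound[where B = 1]) (auto simp: norm_mult indicator_def)
    have "of_real (prob A) - of_real E * expectation (\<lambda>\<omega>. complex_of_real (indicator A \<omega>) * iexp (V \<omega>))
      = expectation (\<lambda>\<omega>. complex_of_real (indicator A \<omega>) * P m \<omega> - of_real E * (complex_of_real (indicator A \<omega>) * iexp (V \<omega>)))"
      unfolding Bochner_Integration.integral_diff[OF Pi integrable_mult_right[OF Vi]] Pe integral_mult_right_zero ..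
    also have "cmod \<dots> \<le> expectation (\<lambda>\<omega>. cmod (complex_of_real (indicator A \<omega>) * P m \<omega> - of_real E * (complex_of_real (indicator A \<omega>) * iexp (V \<omega>))))"
      by (rule integral_norm_bound)
    also have "\<dots> \<le> expectation (\<lambda>\<omega>. \<bar>X m \<omega>\<bar> + E * R m \<omega>)"
    proof (rule integral_mono)
      show "integrable M (\<lambda>\<omega>. cmod (complex_of_real (indicator A \<omega>) * P m \<omega> - of_real E * (complex_of_real (indicator A \<omega>) * iexp (V \<omega>))))"
        by (intro integrable_norm Bochner_Integration.integrable_diff integrable_mult_right Pi Vi)
      show "integrable M (\<lambda>\<omega>. \<bar>X m \<omega>\<bar> + E * R m \<omega>)"
        by (intro Bochner_Integration.integrable_add integrable_mult_right Ri integrable_abs[OF X1i])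
      fix \<omega>
      have "cmod (P m \<omega> - of_real E * iexp (V \<omega>)) \<le> cmod (P m \<omega> - Q m \<omega> * of_real E) + cmod (of_real E * (Q m \<omega> - iexp (V \<omega>)))"
        using norm_triangle_ineq[of "P m \<omega> - Q m \<omega> * of_real E" "of_real E * (Q m \<omega> - iexp (V \<omega>))"]
        by (simp add: algebra_simps)
      then have "cmod (P m \<omega> - of_real E * iexp (V \<omega>)) \<le> \<bar>X m \<omega>\<bar> + E * R m \<omega>"
        unfolding X_def R_def norm_mult by (simp add: E_def)
      moreover have "0 \<le> \<bar>X m \<omega>\<bar> + E * R m \<omega>" by (simp add: E_def R_def)
      ultimately show "cmod (complex_of_real (indicator A \<omega>) * P m \<omega> - of_real E * (complex_of_real (indicator A \<omega>) * iexp (V \<omega>))) \<le> \<bar>X m \<omega>\<bar> + E * R m \<omega>"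
        by (cases "\<omega> \<in> A") simp_all
    qed
    also have "\<dots> = expectation (\<lambda>\<omega>. \<bar>X m \<omega>\<bar>) + E * expectation (R m)"
      unfolding Bochner_Integration.integral_add[OF integrable_abs[OF X1i] integrable_mult_right[OF Ri]] integral_mult_right_zero ..
    finally show ?thesis .
  qed
  have "(\<lambda>m. expectation (\<lambda>\<omega>. \<bar>X m \<omega>\<bar>) + E * expectation (R m)) \<longlonglongrightarrow> 0"
    using tendsto_add[OF XL1 tendsto_mult[OF tendsto_const[of E] RL1]] by simp
  then have "cmod (of_real (prob A) - of_real E * expectation (\<lambda>\<omega>. complex_of_real (indicator A \<omega>) * iexp (V \<omega>))) \<le> 0"
    by (rule LIMSEQ_le_const) (use bound in blast)
  then have "of_real (prob A) = complex_of_real E * expectation (\<lambda>\<omega>. complex_of_real (indicator A \<omega>) * iexp (V \<omega>))" by simp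
  then have "expectation (\<lambda>\<omega>. complex_of_real (indicator A \<omega>) * iexp (V \<omega>)) = of_real (prob A / E)"
    by (simp add: E_def field_simps)
  also have "prob A / E = prob A * exp (- (a\<^sup>2 + 2 * \<rho> * a * b + b\<^sup>2) * h / 2)"
  proof -
    have "- (a\<^sup>2 + 2 * \<rho> * a * b + b\<^sup>2) * h / 2 = - (q / 2)"
      unfolding q_def by (simp add: algebra_simps)
    then show ?thesis unfolding E_def by (simp only: exp_minus divide_inverse)
  qed
  finally show ?thesis unfolding V_def .
qed

end

section \<open>Laws determined by weighted characteristic functions\<close>

lemma iexp_add: "iexp (x + y) = iexp x * iexp y"
  by (simp add: distrib_left exp_add)

lemma cos_iexp: "complex_of_real (cos x) = (iexp x + iexp (- x)) / 2"
  unfolding cos_of_real[symmetric] cos_exp_eq by simp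

lemma sin_iexp: "complex_of_real (sin x) = (iexp x - iexp (- x)) / (2 * \<i>)"
  unfolding sin_of_real[symmetric] sin_exp_eq by simp

lemma iexp_cos_sin: "iexp x = complex_of_real (cos x) + \<i> * complex_of_real (sin x)"
  unfolding cis_conv_exp[symmetric] by (simp add: complex_eq_iff)

text \<open>A bounded weight becomes a probability density after adding a constant and normalising.
  Under this density \<open>X\<close> has the characteristic function of \<open>\<mu>\<close>, so
  Levy's uniqueness theorem applies; subtracting the constant again gives the claim for the signed
  weight.\<close>

lemma (in prob_space) weighted_law_unique:
  fixes w X :: "'a \<Rightarrow> real"
  assumes [measurable]: "random_variable borel w" "random_variable borel X"
    and K: "\<And>\<omega>. \<bar>w \<omega>\<bar> \<le> K"
    and law: "distr M borel X = \<mu>"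
    and ch: "\<And>u. expectation (\<lambda>\<omega>. complex_of_real (w \<omega>) * iexp (u * X \<omega>)) = complex_of_real c * char \<mu> u"
    and B: "B \<in> sets borel"
  shows "expectation (\<lambda>\<omega>. w \<omega> * indicator B (X \<omega>)) = c * measure \<mu> B"
proof -
  have \<mu>: "real_distribution \<mu>" unfolding law[symmetric] by (rule real_distribution_distr) simp
  interpret \<mu>: real_distribution \<mu> by (rule \<mu>)
  have Bm [measurable]: "B \<in> sets borel" by (rule B)
  have wi: "integrable M w" by (rule integrable_const_bound[where B = K]) (use K in auto)
  have wei: "integrable M (\<lambda>\<omega>. complex_of_real (w \<omega>) * iexp (u * X \<omega>))" for u
    by (rule integrable_const_bound[where B = K]) (use K in \<open>auto simp: norm_mult\<close>)
  have ei: "integrable M (\<lambda>\<omega>. iexp (u * X \<omega>))" for u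
    by (rule integrable_const_bound[where B = 1]) auto
  have ce: "expectation (\<lambda>\<omega>. iexp (u * X \<omega>)) = char \<mu> u" for u
    unfolding law[symmetric] char_def by (subst integral_distr) auto
  \<comment> \<open>\<open>K + 1\<close> rather than \<open>K\<close>: the shifted weight is then at
    least 1, so the normalising constant \<open>c + L\<close> cannot vanish.\<close>
  define L where "L = K + 1"
  have pos: "0 < w \<omega> + L" for \<omega> using K[of \<omega>] unfolding L_def by linarith
  have ch': "expectation (\<lambda>\<omega>. complex_of_real (w \<omega> + L) * iexp (u * X \<omega>)) = complex_of_real (c + L) * char \<mu> u" for u
  proof -
    have "expectation (\<lambda>\<omega>. complex_of_real (w \<omega> + L) * iexp (u * X \<omega>))
      = expectation (\<lambda>\<omega>. complex_of_real (w \<omega>) * iexp (u * X \<omega>) + complex_of_real L * iexp (u * X \<omega>))"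
      by (simp add: distrib_right)
    also have "\<dots> = complex_of_real c * char \<mu> u + complex_of_real L * char \<mu> u"
      unfolding Bochner_Integration.integral_add[OF wei integrable_mult_right[OF ei]] integral_mult_right_zero ch ce ..
    finally show ?thesis by (simp add: distrib_right)
  qed
  have wLi: "integrable M (\<lambda>\<omega>. w \<omega> + L)" using wi by simp
  \<comment> \<open>Frequency 0 identifies the mean of \<open>w\<close> as \<open>c\<close>.\<close>
  have EwL: "expectation (\<lambda>\<omega>. w \<omega> + L) = c + L"
  proof -
    have "complex_of_real (expectation (\<lambda>\<omega>. w \<omega> + L)) = complex_of_real (c + L)"
      unfolding integral_complex_of_real[symmetric] using ch'[of 0] by (simp add: \<mu>.char_zero)
    then show ?thesis by (simp only: of_real_eq_iff)
  qed
  have cpos: "1 \<le> c + L"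
  proof -
    have "1 = expectation (\<lambda>\<omega>. 1 :: real)" by (simp add: prob_space)
    also have "\<dots> \<le> expectation (\<lambda>\<omega>. w \<omega> + L)"
    proof (rule integral_mono[OF _ wLi])
      show "1 \<le> w \<omega> + L" for \<omega> using K[of \<omega>] unfolding L_def by linarith
    qed simp
    finally show ?thesis unfolding EwL .
  qed
  define p where "p \<omega> = (w \<omega> + L) / (c + L)" for \<omega>
  have p0: "0 \<le> p \<omega>" for \<omega> unfolding p_def using pos[of \<omega>] cpos by simp
  have [measurable]: "random_variable borel p" unfolding p_def by measurable
  have pi: "integrable M p" unfolding p_def by (intro integrable_divide wLi)
  have pe: "expectation p = 1" unfolding p_def using EwL cpos by simp
  let ?D = "density M (\<lambda>\<omega>. ennreal (p \<omega>))"
  interpret D: prob_space ?D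
  proof
    have "(\<integral>\<^sup>+\<omega>. ennreal (p \<omega>) \<partial>M) = 1"
      using nn_integral_eq_integral[OF pi] p0 pe by simp
    then show "emeasure ?D (space ?D) = 1"
      by (simp add: emeasure_density cong: nn_integral_cong)
  qed
  have "char (distr ?D borel X) u = char \<mu> u" for u
  proof -
    have "char (distr ?D borel X) u = (\<integral>\<omega>. iexp (u * X \<omega>) \<partial>?D)"
      unfolding char_def by (subst integral_distr) auto
    also have "\<dots> = expectation (\<lambda>\<omega>. p \<omega> *\<^sub>R iexp (u * X \<omega>))"
      by (rule integral_density) (use p0 in auto)
    also have "\<dots> = expectation (\<lambda>\<omega>. complex_of_real (1 / (c + L)) * (complex_of_real (w \<omega> + L) * iexp (u * X \<omega>)))"
      unfolding p_def by (simp add: scaleR_conv_of_real)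
    also have "\<dots> = char \<mu> u"
    proof -
      have "complex_of_real (c + L) \<noteq> 0" using cpos by (simp del: of_real_add)
      then show ?thesis unfolding integral_mult_right_zero ch' by (simp del: of_real_add)
    qed
    finally show ?thesis .
  qed
  then have "distr ?D borel X = \<mu>"
    by (intro Levy_uniqueness \<mu> D.real_distribution_distr ext) auto
  then have "measure \<mu> B = measure (distr ?D borel X) B" by simp
  also have "\<dots> = (\<integral>\<omega>. indicator B (X \<omega>) \<partial>?D)"
  proof -
    have "measure (distr ?D borel X) B = measure ?D (X -` B \<inter> space M)"
      by (subst measure_distr) auto
    also have "\<dots> = (\<integral>\<omega>. indicator (X -` B \<inter> space M) \<omega> \<partial>?D)" by simp
    also have "\<dots> = (\<integral>\<omega>. indicator B (X \<omega>) \<partial>?D)"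
      by (intro Bochner_Integration.integral_cong) (auto simp: indicator_def)
    finally show ?thesis .
  qed
  also have "\<dots> = expectation (\<lambda>\<omega>. p \<omega> * indicator B (X \<omega>))"
    by (subst integral_density) (use p0 in auto)
  also have "\<dots> = expectation (\<lambda>\<omega>. 1 / (c + L) * (w \<omega> * indicator B (X \<omega>) + L * indicator B (X \<omega>)))"
    unfolding p_def by (simp add: distrib_right add_divide_distrib)
  also have "\<dots> = 1 / (c + L) * (expectation (\<lambda>\<omega>. w \<omega> * indicator B (X \<omega>)) + L * measure \<mu> B)"
  proof -
    have 1: "integrable M (\<lambda>\<omega>. w \<omega> * indicator B (X \<omega>))"
      by (rule integrable_const_bound[where B = K])
         (use K order_trans[OF abs_ge_zero K] in \<open>auto simp: indicator_def\<close>)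
    have 2: "integrable M (\<lambda>\<omega>. indicator B (X \<omega>) :: real)"
      by (rule integrable_const_bound[where B = 1]) (auto simp: indicator_def)
    have 3: "expectation (\<lambda>\<omega>. indicator B (X \<omega>)) = measure \<mu> B"
    proof -
      have "measure \<mu> B = prob (X -` B \<inter> space M)" unfolding law[symmetric] by (subst measure_distr) auto
      also have "\<dots> = expectation (indicator (X -` B \<inter> space M))" by simp
      also have "\<dots> = expectation (\<lambda>\<omega>. indicator B (X \<omega>))"
        by (intro Bochner_Integration.integral_cong) (auto simp: indicator_def)
      finally show ?thesis by simp
    qed
    show ?thesis
      unfolding integral_mult_right_zero Bochner_Integration.integral_add[OF 1 integrable_mult_right[OF 2]] 3 ..
  qed
  finally show ?thesis using cpos by (simp add: field_simps)
qed

section \<open>The component of W orthogonal to Z\<close>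

context correlated_brownian
begin

text \<open>Left unnormalised: dividing by \<open>sqrt (1 - \<rho>\<^sup>2)\<close> would exclude
  perfect correlation, where the increments of this component vanish almost surely.\<close>

definition orth :: "real \<Rightarrow> 'a \<Rightarrow> real" where
  "orth u \<omega> = W u \<omega> - \<rho> * Z u \<omega>"

text \<open>The joint characteristic function of \<open>U\<close> and \<open>\<zeta>\<close> over an
  event of the past factorises. The joint law follows from two uses of one-dimensional uniqueness:
  first in \<open>\<zeta>\<close>, with the indicator of \<open>A\<close> times a cosine or sine of
  \<open>u * U\<close> as weight, then in \<open>U\<close>, with the indicators of \<open>A\<close>
  and of \<open>\<zeta>\<close> in \<open>D\<close> as weight.\<close>

lemma orthogonal_increments:
  fixes h :: real and k :: nat
  defines "s \<equiv> real k * h" and "\<sigma> \<equiv> sqrt ((1 - \<rho>\<^sup>2) * h)"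
  assumes h: "0 < h" and \<rho>: "\<rho> \<in> {-1..1}"
  shows "distr M borel (\<lambda>\<omega>. orth (s + h) \<omega> - orth s \<omega>) = normal_law \<sigma>"
    and "\<lbrakk>A \<in> sets (F s); C \<in> sets borel; D \<in> sets borel\<rbrakk> \<Longrightarrow>
      expectation (\<lambda>\<omega>. indicator A \<omega> * indicator D (Z (s + h) \<omega> - Z s \<omega>) * indicator C (orth (s + h) \<omega> - orth s \<omega>))
      = prob A * measure (normal_law (sqrt h)) D * measure (normal_law \<sigma>) C"
proof -
  have s: "0 \<le> s" "s < s + h" "s + h - s = h" using h by (auto simp: s_def)
  have \<rho>2: "0 \<le> 1 - \<rho>\<^sup>2" using \<rho> by (auto simp: abs_square_le_1)
  have \<sigma>2: "\<sigma>\<^sup>2 = (1 - \<rho>\<^sup>2) * h" unfolding \<sigma>_def using \<rho>2 h by simp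
  define \<zeta> where "\<zeta> \<omega> = Z (s + h) \<omega> - Z s \<omega>" for \<omega>
  define U where "U \<omega> = orth (s + h) \<omega> - orth s \<omega>" for \<omega>
  have [measurable]: "random_variable borel (W s)" "random_variable borel (W (s + h))"
     "random_variable borel (Z s)" "random_variable borel (Z (s + h))"
    using s by (auto intro!: measurable_W Z.measurable_W)
  have [measurable]: "random_variable borel \<zeta>" "random_variable borel U"
    unfolding \<zeta>_def U_def orth_def by measurable
  have law\<zeta>: "distr M borel \<zeta> = normal_law (sqrt h)"
    using Z.distr_increment[OF s(1,2)] unfolding s(3) \<zeta>_def .
  have ch: "expectation (\<lambda>\<omega>. complex_of_real (indicator A \<omega>) * iexp (u * U \<omega> + b * \<zeta> \<omega>))
    = complex_of_real (prob A * exp (- (\<sigma> * u)\<^sup>2 / 2)) * char (normal_law (sqrt h)) b" if A: "A \<in> sets (F s)" for A u b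
  proof -
    \<comment> \<open>The frequencies \<open>u\<close> for \<open>W\<close> and
      \<open>b - \<rho> * u\<close> for \<open>Z\<close> diagonalise the quadratic form of
      \<open>char_increment\<close>.\<close>
    have lin: "u * U \<omega> + b * \<zeta> \<omega> = u * (W (s + h) \<omega> - W s \<omega>) + (b - \<rho> * u) * (Z (s + h) \<omega> - Z s \<omega>)" for \<omega>
      unfolding U_def \<zeta>_def orth_def by (simp add: algebra_simps)
    have quad: "- (u\<^sup>2 + 2 * \<rho> * u * (b - \<rho> * u) + (b - \<rho> * u)\<^sup>2) * h / 2
        = - (\<sigma> * u)\<^sup>2 / 2 + - (sqrt h * b)\<^sup>2 / 2"
      unfolding power_mult_distrib \<sigma>2 real_sqrt_pow2[OF less_imp_le[OF h]]
      by (simp add: power2_eq_square field_simps)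
    show ?thesis
      unfolding lin char_increment[OF h A[unfolded s_def], of u "b - \<rho> * u", folded s_def]
        quad exp_add char_normal_law by simp
  qed
  show lawU: "distr M borel (\<lambda>\<omega>. orth (s + h) \<omega> - orth s \<omega>) = normal_law \<sigma>"
  proof -
    have "char (distr M borel U) u = char (normal_law \<sigma>) u" for u
    proof -
      have "space M \<in> sets (F s)" using sets.top[of "F s"] by simp
      from ch[OF this, of u 0] have "expectation (\<lambda>\<omega>. complex_of_real (indicator (space M) \<omega>) * iexp (u * U \<omega>)) = char (normal_law \<sigma>) u"
        by (simp add: prob_space char_normal_law)
      moreover have "expectation (\<lambda>\<omega>. complex_of_real (indicator (space M) \<omega>) * iexp (u * U \<omega>)) = expectation (\<lambda>\<omega>. iexp (u * U \<omega>))"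
        by (intro Bochner_Integration.integral_cong) auto
      moreover have "char (distr M borel U) u = expectation (\<lambda>\<omega>. iexp (u * U \<omega>))"
        unfolding char_def by (subst integral_distr) auto
      ultimately show ?thesis by simp
    qed
    then have "distr M borel U = normal_law \<sigma>"
      by (intro Levy_uniqueness real_distribution_distr real_distribution_normal_law ext) auto
    then show ?thesis unfolding U_def .
  qed
  assume A: "A \<in> sets (F s)" and C: "C \<in> sets borel" and D: "D \<in> sets borel"
  have [measurable]: "A \<in> events" "C \<in> sets borel" "D \<in> sets borel" using A C D by (auto intro: sets_F)
  let ?g = "measure (normal_law (sqrt h)) D"
  let ?E = "\<lambda>u b \<omega>. complex_of_real (indicator A \<omega>) * iexp (u * U \<omega> + b * \<zeta> \<omega>)"
  have Ei: "integrable M (?E u b)" for u b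
    by (rule integrable_const_bound[where B = 1]) (auto simp: norm_mult indicator_def)
  \<comment> \<open>Weights in \<open>weighted_law_unique\<close> are real, so the imaginary
    exponential of \<open>u * U\<close> is treated through its cosine and sine. The sine gives 0
    because the Gaussian factor is even in \<open>u\<close>.\<close>
  have cos: "expectation (\<lambda>\<omega>. indicator A \<omega> * cos (u * U \<omega>) * indicator D (\<zeta> \<omega>))
      = prob A * exp (- (\<sigma> * u)\<^sup>2 / 2) * ?g" for u
  proof (rule weighted_law_unique[OF _ _ _ law\<zeta> _ D, where K = 1])
    show "\<bar>indicator A \<omega> * cos (u * U \<omega>)\<bar> \<le> 1" for \<omega> by (auto simp: indicator_def)
    fix b
    have eq: "complex_of_real (indicator A \<omega> * cos (u * U \<omega>)) * iexp (b * \<zeta> \<omega>) = (1/2) * ?E u b \<omega> + (1/2) * ?E (-u) b \<omega>" for \<omega>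
    proof -
      have gen: "i * ((p + q) / 2) * r = (1/2) * (i * (p * r)) + (1/2) * (i * (q * r))" for i p q r :: complex
        by (simp add: field_simps)
      show ?thesis unfolding of_real_mult[of "indicator A \<omega>"] cos_iexp mult_minus_left iexp_add by (rule gen)
    qed
    show "expectation (\<lambda>\<omega>. complex_of_real (indicator A \<omega> * cos (u * U \<omega>)) * iexp (b * \<zeta> \<omega>))
        = complex_of_real (prob A * exp (- (\<sigma> * u)\<^sup>2 / 2)) * char (normal_law (sqrt h)) b"
      unfolding eq Bochner_Integration.integral_add[OF integrable_mult_right[OF Ei] integrable_mult_right[OF Ei]]
        integral_mult_right_zero ch[OF A] by simp
  qed measurable
  have sin: "expectation (\<lambda>\<omega>. indicator A \<omega> * sin (u * U \<omega>) * indicator D (\<zeta> \<omega>)) = 0 * ?g" for u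
  proof (rule weighted_law_unique[OF _ _ _ law\<zeta> _ D, where K = 1])
    show "\<bar>indicator A \<omega> * sin (u * U \<omega>)\<bar> \<le> 1" for \<omega> by (auto simp: indicator_def)
    fix b
    have eq: "complex_of_real (indicator A \<omega> * sin (u * U \<omega>)) * iexp (b * \<zeta> \<omega>)
      = (- \<i>/2) * ?E u b \<omega> + (\<i>/2) * ?E (-u) b \<omega>" for \<omega>
    proof -
      have gen: "i * ((p - q) / (2 * \<i>)) * r = (- \<i>/2) * (i * (p * r)) + (\<i>/2) * (i * (q * r))" for i p q r :: complex
        by (simp add: field_simps)
      show ?thesis unfolding of_real_mult[of "indicator A \<omega>"] sin_iexp mult_minus_left iexp_add by (rule gen)
    qed
    show "expectation (\<lambda>\<omega>. complex_of_real (indicator A \<omega> * sin (u * U \<omega>)) * iexp (b * \<zeta> \<omega>))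
        = complex_of_real 0 * char (normal_law (sqrt h)) b"
      unfolding eq Bochner_Integration.integral_add[OF integrable_mult_right[OF Ei] integrable_mult_right[OF Ei]]
        integral_mult_right_zero ch[OF A] by simp
  qed measurable
  have "expectation (\<lambda>\<omega>. indicator A \<omega> * indicator D (\<zeta> \<omega>) * indicator C (U \<omega>)) = prob A * ?g * measure (normal_law \<sigma>) C"
  proof (rule weighted_law_unique[OF _ _ _ lawU[folded U_def] _ C, where K = 1])
    show "\<bar>indicator A \<omega> * indicator D (\<zeta> \<omega>) :: real\<bar> \<le> 1" for \<omega> by (auto simp: indicator_def)
    fix u
    have eq: "complex_of_real (indicator A \<omega> * indicator D (\<zeta> \<omega>)) * iexp (u * U \<omega>)
      = complex_of_real (indicator A \<omega> * cos (u * U \<omega>) * indicator D (\<zeta> \<omega>))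
        + \<i> * complex_of_real (indicator A \<omega> * sin (u * U \<omega>) * indicator D (\<zeta> \<omega>))" for \<omega>
      unfolding iexp_cos_sin by (simp add: algebra_simps)
    have 1: "integrable M (\<lambda>\<omega>. complex_of_real (indicator A \<omega> * cos (u * U \<omega>) * indicator D (\<zeta> \<omega>)))"
      by (rule integrable_const_bound[where B = 1]) (auto simp: norm_mult indicator_def)
    have 2: "integrable M (\<lambda>\<omega>. complex_of_real (indicator A \<omega> * sin (u * U \<omega>) * indicator D (\<zeta> \<omega>)))"
      by (rule integrable_const_bound[where B = 1]) (auto simp: norm_mult indicator_def)
    show "expectation (\<lambda>\<omega>. complex_of_real (indicator A \<omega> * indicator D (\<zeta> \<omega>)) * iexp (u * U \<omega>))
        = complex_of_real (prob A * ?g) * char (normal_law \<sigma>) u"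
      unfolding eq Bochner_Integration.integral_add[OF 1 integrable_mult_right[OF 2]] integral_mult_right_zero
        integral_complex_of_real cos sin char_normal_law by simp
  qed measurable
  then show "expectation (\<lambda>\<omega>. indicator A \<omega> * indicator D (Z (s + h) \<omega> - Z s \<omega>) * indicator C (orth (s + h) \<omega> - orth s \<omega>))
      = prob A * measure (normal_law (sqrt h)) D * measure (normal_law \<sigma>) C"
    unfolding \<zeta>_def U_def .
qed

text \<open>The product formula is known on triple rectangles. For a fixed set \<open>C\<close> it
  identifies the law of past and \<open>\<zeta>\<close>, restricted to \<open>U\<close> in
  \<open>C\<close>, as a multiple of a product measure. This passes from rectangles to all
  measurable sets of pairs, and so makes \<open>U\<close> independent of the pair.\<close>

lemma nn_integral_increments:
  fixes h :: real and k :: nat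
  defines "s \<equiv> real k * h" and "\<sigma> \<equiv> sqrt ((1 - \<rho>\<^sup>2) * h)"
  assumes h: "0 < h" and \<rho>: "\<rho> \<in> {-1..1}"
    and f [measurable]: "f \<in> borel_measurable ((F s \<Otimes>\<^sub>M borel) \<Otimes>\<^sub>M borel)"
  shows "(\<integral>\<^sup>+\<omega>. f ((\<omega>, Z (s + h) \<omega> - Z s \<omega>), orth (s + h) \<omega> - orth s \<omega>) \<partial>M)
    = (\<integral>\<^sup>+\<omega>. (\<integral>\<^sup>+z. (\<integral>\<^sup>+x. f ((\<omega>, sqrt h * z), \<sigma> * x) \<partial>std_normal_distribution) \<partial>std_normal_distribution) \<partial>M)"
proof -
  have s: "0 \<le> s" "s < s + h" "s + h - s = h" using h by (auto simp: s_def)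
  note oi = orthogonal_increments[OF h \<rho>, where k = k, folded s_def \<sigma>_def]
  define \<zeta> where "\<zeta> \<omega> = Z (s + h) \<omega> - Z s \<omega>" for \<omega>
  define U where "U \<omega> = orth (s + h) \<omega> - orth s \<omega>" for \<omega>
  have [measurable]: "random_variable borel (W s)" "random_variable borel (W (s + h))"
     "random_variable borel (Z s)" "random_variable borel (Z (s + h))"
    using s by (auto intro!: measurable_W Z.measurable_W)
  have [measurable]: "random_variable borel \<zeta>" "random_variable borel U"
    unfolding \<zeta>_def U_def orth_def by measurable
  have id [measurable]: "(\<lambda>\<omega>. \<omega>) \<in> measurable M (F s)"
    using measurable_F[OF measurable_ident_sets[OF refl], of s] by auto
  interpret \<mu>: prob_space "distr M (F s) (\<lambda>\<omega>. \<omega>)" by (rule prob_space_distr) (rule id)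
  interpret \<gamma>: real_distribution "normal_law (sqrt h)" by (rule real_distribution_normal_law)
  interpret \<nu>: real_distribution "normal_law \<sigma>" by (rule real_distribution_normal_law)
  have law\<zeta>: "distr M borel \<zeta> = normal_law (sqrt h)"
    using Z.distr_increment[OF s(1,2)] unfolding s(3) \<zeta>_def .
  have lawU: "distr M borel U = normal_law \<sigma>" using oi(1) unfolding U_def .
  have rect: "prob (A \<inter> (\<zeta> -` D \<inter> space M) \<inter> (U -` C \<inter> space M))
      = prob A * measure (normal_law (sqrt h)) D * measure (normal_law \<sigma>) C"
    if A: "A \<in> sets (F s)" and C: "C \<in> sets borel" and D: "D \<in> sets borel" for A C D
  proof -
    have [measurable]: "A \<in> events" "C \<in> sets borel" "D \<in> sets borel" using A C D by (auto intro: sets_F)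
    have "prob (A \<inter> (\<zeta> -` D \<inter> space M) \<inter> (U -` C \<inter> space M))
      = expectation (indicator (A \<inter> (\<zeta> -` D \<inter> space M) \<inter> (U -` C \<inter> space M)))" by simp
    also have "\<dots> = expectation (\<lambda>\<omega>. indicator A \<omega> * indicator D (\<zeta> \<omega>) * indicator C (U \<omega>))"
      by (intro Bochner_Integration.integral_cong) (auto simp: indicator_def)
    finally show ?thesis using oi(2)[OF A C D] unfolding \<zeta>_def U_def by simp
  qed
  have pair: "scale_measure (emeasure (normal_law \<sigma>) C) (distr M (F s) (\<lambda>\<omega>. \<omega>)) \<Otimes>\<^sub>M normal_law (sqrt h)
    = distr (density M (indicator (U -` C \<inter> space M))) (F s \<Otimes>\<^sub>M borel) (\<lambda>\<omega>. (\<omega>, \<zeta> \<omega>))" if C: "C \<in> sets borel" for C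
  proof (rule pair_measure_eqI)
    have [measurable]: "C \<in> sets borel" by (rule C)
    show "sigma_finite_measure (scale_measure (emeasure (normal_law \<sigma>) C) (distr M (F s) (\<lambda>\<omega>. \<omega>)))"
      using \<mu>.emeasure_finite
      by (intro finite_measure.axioms(1) finite_measureI)
         (auto simp: ennreal_mult_eq_top_iff \<nu>.emeasure_eq_measure \<mu>.emeasure_eq_measure space_scale_measure)
    show "sigma_finite_measure (normal_law (sqrt h))" by unfold_locales
    show "sets (scale_measure (emeasure (normal_law \<sigma>) C) (distr M (F s) (\<lambda>\<omega>. \<omega>)) \<Otimes>\<^sub>M normal_law (sqrt h))
      = sets (distr (density M (indicator (U -` C \<inter> space M))) (F s \<Otimes>\<^sub>M borel) (\<lambda>\<omega>. (\<omega>, \<zeta> \<omega>)))"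
      by (simp cong: sets_pair_measure_cong)
    fix A D assume "A \<in> sets (scale_measure (emeasure (normal_law \<sigma>) C) (distr M (F s) (\<lambda>\<omega>. \<omega>)))" "D \<in> sets (normal_law (sqrt h))"
    then have A: "A \<in> sets (F s)" and D: "D \<in> sets borel" by auto
    have [measurable]: "A \<in> sets (F s)" "A \<in> events" "D \<in> sets borel" using A D by (auto intro: sets_F)
    have Asp: "A \<inter> space M = A" using sets.sets_into_space[OF A] by auto
    have "emeasure (distr (density M (indicator (U -` C \<inter> space M))) (F s \<Otimes>\<^sub>M borel) (\<lambda>\<omega>. (\<omega>, \<zeta> \<omega>))) (A \<times> D)
      = emeasure (density M (indicator (U -` C \<inter> space M))) ((\<lambda>\<omega>. (\<omega>, \<zeta> \<omega>)) -` (A \<times> D) \<inter> space M)"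
      by (subst emeasure_distr) auto
    also have "(\<lambda>\<omega>. (\<omega>, \<zeta> \<omega>)) -` (A \<times> D) \<inter> space M = A \<inter> (\<zeta> -` D \<inter> space M)" using Asp by auto
    also have "emeasure (density M (indicator (U -` C \<inter> space M))) (A \<inter> (\<zeta> -` D \<inter> space M))
      = emeasure M (A \<inter> (\<zeta> -` D \<inter> space M) \<inter> (U -` C \<inter> space M))"
      by (subst emeasure_density)
         (auto simp: mult.commute simp flip: nn_integral_indicator indicator_inter_arith intro!: nn_integral_cong split: split_indicator)
    also have "\<dots> = ennreal (prob A * measure (normal_law (sqrt h)) D * measure (normal_law \<sigma>) C)"
      unfolding emeasure_eq_measure rect[OF A C D] ..
    finally show "emeasure (scale_measure (emeasure (normal_law \<sigma>) C) (distr M (F s) (\<lambda>\<omega>. \<omega>))) A * emeasure (normal_law (sqrt h)) D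
      = emeasure (distr (density M (indicator (U -` C \<inter> space M))) (F s \<Otimes>\<^sub>M borel) (\<lambda>\<omega>. (\<omega>, \<zeta> \<omega>))) (A \<times> D)"
      by (simp add: emeasure_distr Asp emeasure_eq_measure \<nu>.emeasure_eq_measure \<gamma>.emeasure_eq_measure
          flip: ennreal_mult)
  qed
  have indep: "distr M (F s \<Otimes>\<^sub>M borel) (\<lambda>\<omega>. (\<omega>, \<zeta> \<omega>)) \<Otimes>\<^sub>M distr M borel U
    = distr M ((F s \<Otimes>\<^sub>M borel) \<Otimes>\<^sub>M borel) (\<lambda>\<omega>. ((\<omega>, \<zeta> \<omega>), U \<omega>))"
  proof (rule distr_pair_eqI)
    fix H C assume H: "H \<in> sets (F s \<Otimes>\<^sub>M (borel :: real measure))" and C: "C \<in> sets (borel :: real measure)"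
    have [measurable]: "H \<in> sets (F s \<Otimes>\<^sub>M borel)" "C \<in> sets borel" by fact+
    have H': "H \<in> sets (distr M (F s) (\<lambda>\<omega>. \<omega>) \<Otimes>\<^sub>M normal_law (sqrt h))"
      using H by (simp cong: sets_pair_measure_cong)
    let ?pre = "(\<lambda>\<omega>. (\<omega>, \<zeta> \<omega>)) -` H \<inter> space M"
    have [measurable]: "?pre \<in> events" by measurable
    have em: "emeasure M (?pre \<inter> (U -` C' \<inter> space M))
        = emeasure (normal_law \<sigma>) C' * emeasure (distr M (F s) (\<lambda>\<omega>. \<omega>) \<Otimes>\<^sub>M normal_law (sqrt h)) H"
      if C': "C' \<in> sets borel" for C'
    proof -
      have [measurable]: "C' \<in> sets borel" by (rule C')
      have "emeasure M (?pre \<inter> (U -` C' \<inter> space M)) = emeasure (density M (indicator (U -` C' \<inter> space M))) ?pre"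
        by (subst emeasure_density)
           (auto simp: mult.commute simp flip: nn_integral_indicator indicator_inter_arith intro!: nn_integral_cong split: split_indicator)
      also have "\<dots> = emeasure (distr (density M (indicator (U -` C' \<inter> space M))) (F s \<Otimes>\<^sub>M borel) (\<lambda>\<omega>. (\<omega>, \<zeta> \<omega>))) H"
        by (subst emeasure_distr) auto
      also have "\<dots> = emeasure (scale_measure (emeasure (normal_law \<sigma>) C') (distr M (F s) (\<lambda>\<omega>. \<omega>)) \<Otimes>\<^sub>M normal_law (sqrt h)) H"
        unfolding pair[OF C'] ..
      also have "\<dots> = (\<integral>\<^sup>+x. emeasure (normal_law (sqrt h)) (Pair x -` H) \<partial>scale_measure (emeasure (normal_law \<sigma>) C') (distr M (F s) (\<lambda>\<omega>. \<omega>)))"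
        using H by (intro \<gamma>.emeasure_pair_measure_alt) (simp cong: sets_pair_measure_cong)
      also have "\<dots> = emeasure (normal_law \<sigma>) C' * (\<integral>\<^sup>+x. emeasure (normal_law (sqrt h)) (Pair x -` H) \<partial>distr M (F s) (\<lambda>\<omega>. \<omega>))"
        by (rule nn_integral_scale_measure) (rule \<gamma>.measurable_emeasure_Pair[OF H'])
      also have "(\<integral>\<^sup>+x. emeasure (normal_law (sqrt h)) (Pair x -` H) \<partial>distr M (F s) (\<lambda>\<omega>. \<omega>))
         = emeasure (distr M (F s) (\<lambda>\<omega>. \<omega>) \<Otimes>\<^sub>M normal_law (sqrt h)) H"
        by (rule \<gamma>.emeasure_pair_measure_alt[OF H', symmetric])
      finally show ?thesis .
    qed
    \<comment> \<open>Choosing \<open>C'\<close> to be the whole line removes the restriction on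
      \<open>U\<close> and gives the law of the pair alone.\<close>
    have "emeasure M ?pre = emeasure (distr M (F s) (\<lambda>\<omega>. \<omega>) \<Otimes>\<^sub>M normal_law (sqrt h)) H"
      using em[of UNIV] \<nu>.emeasure_space_1 by (simp add: Int_absorb2)
    moreover have "emeasure M (U -` C \<inter> space M) = emeasure (normal_law \<sigma>) C"
      unfolding lawU[symmetric] by (subst emeasure_distr) auto
    ultimately have "emeasure M (?pre \<inter> (U -` C \<inter> space M)) = emeasure M ?pre * emeasure M (U -` C \<inter> space M)"
      unfolding em[OF C] by (simp add: mult.commute)
    then show "prob (?pre \<inter> (U -` C \<inter> space M)) = prob ?pre * prob (U -` C \<inter> space M)"
      by (simp add: emeasure_eq_measure flip: ennreal_mult)
  qed measurable
  have [measurable]: "(\<lambda>p. \<integral>\<^sup>+x. f (p, x) \<partial>normal_law \<sigma>) \<in> borel_measurable (F s \<Otimes>\<^sub>M borel)"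
    by measurable
  have "(\<integral>\<^sup>+\<omega>. f ((\<omega>, \<zeta> \<omega>), U \<omega>) \<partial>M) = (\<integral>\<^sup>+\<omega>. (\<integral>\<^sup>+x. f ((\<omega>, \<zeta> \<omega>), x) \<partial>distr M borel U) \<partial>M)"
    by (rule nn_integral_distr_pair[OF _ _ _ indep]) measurable
  also have "\<dots> = (\<integral>\<^sup>+\<omega>. (\<integral>\<^sup>+x. f ((\<omega>, Z (s + h) \<omega> - Z s \<omega>), x) \<partial>normal_law \<sigma>) \<partial>M)"
    unfolding lawU \<zeta>_def ..
  also have "\<dots> = (\<integral>\<^sup>+\<omega>. (\<integral>\<^sup>+z. (\<integral>\<^sup>+x. f ((\<omega>, sqrt h * z), x) \<partial>normal_law \<sigma>) \<partial>std_normal_distribution) \<partial>M)"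
    using Z.nn_integral_increment[OF s(1,2), of "\<lambda>p. \<integral>\<^sup>+x. f (p, x) \<partial>normal_law \<sigma>"] unfolding s(3) by simp
  also have "\<dots> = (\<integral>\<^sup>+\<omega>. (\<integral>\<^sup>+z. (\<integral>\<^sup>+x. f ((\<omega>, sqrt h * z), \<sigma> * x) \<partial>std_normal_distribution) \<partial>std_normal_distribution) \<partial>M)"
  proof (intro nn_integral_cong nn_integral_normal_law)
    fix \<omega> and z :: real assume "\<omega> \<in> space M"
    then show "(\<lambda>x. f ((\<omega>, sqrt h * z), x)) \<in> borel_measurable borel"
      by (intro measurable_compose[OF measurable_Pair1' f]) (simp add: space_pair_measure)
  qed
  finally show ?thesis unfolding \<zeta>_def U_def .
qed

end

subsection \<open>The discrete change of measure\<close>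

text \<open>One step of the Markov chain followed both by the discretised \<open>\<Gamma>\<close> and, under the changed
  measure, by the discretised geometric Brownian motion; paths above the level \<open>m\<close> are killed.\<close>

definition trans_op :: "real \<Rightarrow> real \<Rightarrow> real \<Rightarrow> (real \<Rightarrow> ennreal) \<Rightarrow> real \<Rightarrow> ennreal" where
  "trans_op \<beta> h m g y = indicator {..m} y
    * (\<integral>\<^sup>+z. g (y * exp (sqrt h * z - h / 2) / (1 + \<beta> * h * y)) \<partial>std_normal_distribution)"

lemma trans_op_measurable:
  assumes [measurable]: "g \<in> borel_measurable borel"
  shows "trans_op \<beta> h m g \<in> borel_measurable borel"
proof -
  interpret G: prob_space std_normal_distribution by (rule prob_space_std_normal)
  show ?thesis unfolding trans_op_def by measurable
qed

lemma inc_0: "inc V 0 h k \<omega> = V (real k * h + h) \<omega> - V (real k * h) \<omega>"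
  by (simp add: inc_def algebra_simps)

section \<open>The chain of the discretised Gamma\<close>

context brownian
begin

definition gbm :: "real \<Rightarrow> 'a \<Rightarrow> real" where
  "gbm u \<omega> = exp (W u \<omega> - u / 2)"

lemma gbm_pos [simp]: "0 < gbm u \<omega>"
  by (simp add: gbm_def)

lemma gbm_adapted: "0 \<le> s \<Longrightarrow> s \<le> t \<Longrightarrow> gbm s \<in> borel_measurable (F t)"
  unfolding gbm_def using adapted[of s t] by measurable

lemma measurable_gbm: "0 \<le> s \<Longrightarrow> random_variable borel (gbm s)"
  by (rule measurable_F[OF gbm_adapted[of s s]]) simp_all

lemma gbm_step: "gbm (real (Suc k) * h) \<omega> = gbm (real k * h) \<omega> * exp (inc W 0 h k \<omega> - h / 2)"
  unfolding gbm_def inc_def exp_add[symmetric] by (simp add: algebra_simps add_divide_distrib)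

lemma gbm_0: "AE \<omega> in M. gbm 0 \<omega> = 1"
proof -
  have "AE \<omega> in M. W 0 \<omega> = 0" using bm by (simp add: bm_filt_def)
  then show ?thesis by eventually_elim (simp add: gbm_def)
qed

definition gam :: "real \<Rightarrow> real \<Rightarrow> nat \<Rightarrow> 'a \<Rightarrow> real" where
  "gam \<beta> h k \<omega> = gbm (real k * h) \<omega> / (1 + \<beta> * h * (\<Sum>j<k. gbm (real j * h) \<omega>))"

lemma gam_adapted:
  assumes h: "0 < h" and jk: "j \<le> k"
  shows "gam \<beta> h j \<in> borel_measurable (F (real k * h))"
proof -
  have [measurable]: "gbm (real i * h) \<in> borel_measurable (F (real k * h))" if "i \<le> j" for i
    using h jk that by (intro gbm_adapted) (auto intro!: mult_right_mono)
  have "(\<lambda>\<omega>. \<Sum>i<j. gbm (real i * h) \<omega>) \<in> borel_measurable (F (real k * h))"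
    by (intro borel_measurable_sum) simp
  then show ?thesis unfolding gam_def by measurable
qed

text \<open>The denominator \<open>S\<close> is multiplied by
  \<open>1 + \<beta> * h * gam \<beta> h k\<close> in each step; equivalently, the reciprocal of
  \<open>gam\<close> follows an affine recursion. Hence \<open>gam\<close> is a Markov chain driven
  by single increments, although its formula involves the whole past.\<close>

lemma gam_step:
  assumes "0 < h" "0 < \<beta>"
  shows "gam \<beta> h (Suc k) \<omega> = gam \<beta> h k \<omega> * exp (inc W 0 h k \<omega> - h / 2) / (1 + \<beta> * h * gam \<beta> h k \<omega>)"
proof -
  define S where "S = 1 + \<beta> * h * (\<Sum>j<k. gbm (real j * h) \<omega>)"
  have S: "0 < S" unfolding S_def using assms
    by (intro add_pos_nonneg mult_nonneg_nonneg sum_nonneg) (auto intro: less_imp_le)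
  have "1 + \<beta> * h * (\<Sum>j<Suc k. gbm (real j * h) \<omega>) = S + \<beta> * h * gbm (real k * h) \<omega>"
    unfolding S_def by (simp add: algebra_simps)
  also have "\<dots> = S * (1 + \<beta> * h * (gbm (real k * h) \<omega> / S))" using S by (simp add: field_simps)
  finally show ?thesis unfolding gam_def gbm_step S_def[symmetric] by simp
qed

text \<open>Integrating out the last increment applies \<open>trans_op\<close> once to the terminal
  function; the induction therefore runs over all \<open>g\<close>.\<close>

lemma chain_gam:
  assumes h: "0 < h" and \<beta>: "0 < \<beta>" and g: "g \<in> borel_measurable borel"
  shows "(\<integral>\<^sup>+\<omega>. (\<Prod>j<k. indicator {..m} (gam \<beta> h j \<omega>)) * g (gam \<beta> h k \<omega>) \<partial>M) = (trans_op \<beta> h m ^^ k) g 1"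
  using g
proof (induction k arbitrary: g)
  case 0
  have "(\<integral>\<^sup>+\<omega>. g (gam \<beta> h 0 \<omega>) \<partial>M) = (\<integral>\<^sup>+\<omega>. g 1 \<partial>M)"
    using gbm_0 by (intro nn_integral_cong_AE) (auto simp: gam_def)
  then show ?case by (simp add: emeasure_space_1)
next
  case (Suc k)
  note [measurable] = Suc.prems
  let ?s = "real k * h"
  let ?C = "\<lambda>k \<omega>. (\<Prod>j<k. indicator {..m} (gam \<beta> h j \<omega>)) :: ennreal"
  have s: "0 \<le> ?s" "?s < ?s + h" "?s + h - ?s = h" using h by auto
  have [measurable]: "gam \<beta> h j \<in> borel_measurable (F ?s)" if "j \<le> k" for j
    by (rule gam_adapted[OF h that])
  \<comment> \<open>The killing factor with index \<open>Suc k\<close> tests the positions 0 to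
    \<open>k\<close> only, so it is known before the increment that is integrated out.\<close>
  have [measurable]: "?C (Suc k) \<in> borel_measurable (F ?s)"
    by (intro borel_measurable_prod_ennreal) (use h in \<open>auto intro!: measurable_compose[OF gam_adapted] borel_measurable_indicator\<close>)
  let ?f = "\<lambda>(\<omega>, x). ?C (Suc k) \<omega> * g (gam \<beta> h k \<omega> * exp (x - h / 2) / (1 + \<beta> * h * gam \<beta> h k \<omega>))"
  have f [measurable]: "?f \<in> borel_measurable (F ?s \<Otimes>\<^sub>M borel)" by measurable
  have "(\<integral>\<^sup>+\<omega>. ?C (Suc k) \<omega> * g (gam \<beta> h (Suc k) \<omega>) \<partial>M) = (\<integral>\<^sup>+\<omega>. ?f (\<omega>, W (?s + h) \<omega> - W ?s \<omega>) \<partial>M)"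
    unfolding gam_step[OF h \<beta>] inc_0 by simp
  also have "\<dots> = (\<integral>\<^sup>+\<omega>. (\<integral>\<^sup>+z. ?f (\<omega>, sqrt h * z) \<partial>std_normal_distribution) \<partial>M)"
    using nn_integral_increment[OF s(1,2) f] unfolding s(3) .
  also have "\<dots> = (\<integral>\<^sup>+\<omega>. ?C k \<omega> * trans_op \<beta> h m g (gam \<beta> h k \<omega>) \<partial>M)"
    by (intro nn_integral_cong) (simp add: trans_op_def nn_integral_cmult mult.assoc)
  also have "\<dots> = (trans_op \<beta> h m ^^ k) (trans_op \<beta> h m g) 1"
    by (rule Suc.IH[OF trans_op_measurable[OF Suc.prems]])
  finally show ?case by (simp add: funpow_swap1)
qed

end

section \<open>Tilting the geometric Brownian motion\<close>

locale hull_white = correlated_brownian M F W Z \<rho>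
  for M :: "'a measure" and F :: "real \<Rightarrow> 'a measure" and W Z :: "real \<Rightarrow> 'a \<Rightarrow> real" and \<rho> :: real +
  fixes \<alpha> \<beta> :: real
  assumes \<rho>: "\<rho> \<in> {-1..1}" and \<alpha>: "0 < \<alpha>" and \<beta>: "0 < \<beta>" and \<beta>2: "\<beta>\<^sup>2 = \<alpha> - \<alpha>\<^sup>2 * (1 - \<rho>\<^sup>2)"
begin

text \<open>The drift \<open>\<beta> Y dt\<close> is discretised as \<open>ln (1 + \<beta> h Y)\<close>, which turns the chain under the
  changed measure into exactly \<open>gam\<close>.\<close>

definition lam :: "real \<Rightarrow> real \<Rightarrow> real" where
  "lam h y = ln (1 + \<beta> * h * y) / (\<beta> * h)"

lemma lam_nonneg: "0 < h \<Longrightarrow> 0 \<le> y \<Longrightarrow> 0 \<le> lam h y"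
  unfolding lam_def using \<beta> by (intro divide_nonneg_pos ln_ge_zero) auto

lemma lam_le: "0 < h \<Longrightarrow> 0 \<le> y \<Longrightarrow> lam h y \<le> y"
  unfolding lam_def using \<beta> ln_add_one_self_le_self[of "\<beta> * h * y"] by (simp add: divide_le_eq ac_simps)

lemma lam_measurable [measurable]: "lam h \<in> borel_measurable borel"
  unfolding lam_def by measurable

abbreviation Y :: "real \<Rightarrow> nat \<Rightarrow> 'a \<Rightarrow> real" where
  "Y h k \<equiv> Z.gbm (real k * h)"

text \<open>The last term is half the conditional variance of the first two. With c = \<beta> +
  \<rho> \<alpha> that variance is \<alpha>^2 - 2 \<rho> \<alpha> c + c^2, which is \<alpha>, times
  \<open>(lam h (Y h j \<omega>))\<^sup>2 * h\<close>.\<close>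

definition log_step :: "real \<Rightarrow> nat \<Rightarrow> 'a \<Rightarrow> real" where
  "log_step h j \<omega> = \<alpha> * lam h (Y h j \<omega>) * inc W 0 h j \<omega> - (\<beta> + \<rho> * \<alpha>) * lam h (Y h j \<omega>) * inc Z 0 h j \<omega>
     - \<alpha> / 2 * (lam h (Y h j \<omega>))\<^sup>2 * h"

definition log_dens :: "real \<Rightarrow> nat \<Rightarrow> 'a \<Rightarrow> real" where
  "log_dens h k \<omega> = (\<Sum>j<k. log_step h j \<omega>)"

text \<open>The product stops before \<open>k\<close>, so that the weight with index
  \<open>Suc k\<close> is known at time \<open>real k * h\<close>; the final position is tested by
  the terminal function instead.\<close>

definition below :: "real \<Rightarrow> real \<Rightarrow> nat \<Rightarrow> 'a \<Rightarrow> ennreal" where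
  "below h m k \<omega> = (\<Prod>j<k. indicator {..m} (Y h j \<omega>))"

lemma Y_adapted: "0 < h \<Longrightarrow> j \<le> k \<Longrightarrow> Y h j \<in> borel_measurable (F (real k * h))"
  by (intro Z.gbm_adapted) (auto intro!: mult_right_mono)

lemma log_dens_adapted:
  assumes h: "0 < h"
  shows "log_dens h k \<in> borel_measurable (F (real k * h))"
  unfolding log_dens_def
proof (intro borel_measurable_sum)
  fix j assume "j \<in> {..<k}"
  then have j: "Suc j \<le> k" by simp
  then have t: "0 + real (Suc j) * h \<le> real k * h" using h by (simp del: of_nat_Suc)
  have [measurable]: "Y h j \<in> borel_measurable (F (real k * h))" "inc W 0 h j \<in> borel_measurable (F (real k * h))"
     "inc Z 0 h j \<in> borel_measurable (F (real k * h))"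
    using Y_adapted[OF h, of j k] inc_adapted[OF _ _ t] Z.inc_adapted[OF _ _ t] j h by auto
  show "log_step h j \<in> borel_measurable (F (real k * h))"
    unfolding log_step_def by measurable
qed

lemma below_adapted: "0 < h \<Longrightarrow> k \<le> Suc l \<Longrightarrow> below h m k \<in> borel_measurable (F (real l * h))"
  unfolding below_def
  by (intro borel_measurable_prod_ennreal) (auto intro!: measurable_compose[OF Y_adapted] borel_measurable_indicator)

text \<open>In terms of independent standard normals \<open>x\<close> and \<open>z\<close>, the
  terms with \<rho> \<alpha> cancel in the coefficient of \<open>z\<close> and leave - \<beta>. The
  value of \<beta> then makes \<open>p\<^sup>2 + q\<^sup>2\<close> match the compensator of
  \<open>log_step\<close>, so that the density of a step is a product of two Gaussian tilts.\<close>

lemma step_factorises: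
  fixes l h x z :: real
  assumes h: "0 < h"
  defines "p \<equiv> \<alpha> * l * sqrt ((1 - \<rho>\<^sup>2) * h)" and "q \<equiv> - \<beta> * l * sqrt h"
  shows "\<alpha> * l * (sqrt ((1 - \<rho>\<^sup>2) * h) * x + \<rho> * (sqrt h * z)) - (\<beta> + \<rho> * \<alpha>) * l * (sqrt h * z) - \<alpha> / 2 * l\<^sup>2 * h
      = (p * x - p\<^sup>2 / 2) + (q * z - q\<^sup>2 / 2)" (is ?eq)
    and "p\<^sup>2 + q\<^sup>2 = \<alpha> * l\<^sup>2 * h" (is ?sq)
proof -
  have \<rho>2: "0 \<le> (1 - \<rho>\<^sup>2) * h" using \<rho> h by (auto simp: abs_square_le_1)
  have p2: "p\<^sup>2 = \<alpha>\<^sup>2 * l\<^sup>2 * ((1 - \<rho>\<^sup>2) * h)" unfolding p_def power_mult_distrib real_sqrt_pow2[OF \<rho>2] ..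
  have q2: "q\<^sup>2 = (\<alpha> - \<alpha>\<^sup>2 * (1 - \<rho>\<^sup>2)) * l\<^sup>2 * h"
    unfolding q_def power_mult_distrib real_sqrt_pow2[OF less_imp_le[OF h]] using \<beta>2 by simp
  show sq: ?sq unfolding p2 q2 by (simp add: algebra_simps)
  have "\<alpha> / 2 * l\<^sup>2 * h = p\<^sup>2 / 2 + q\<^sup>2 / 2" using sq by simp
  then show ?eq unfolding p_def[symmetric] by (simp add: p_def q_def algebra_simps)
qed

text \<open>The exponent \<open>c\<close> is free because two values are needed: for
  \<open>c = 1\<close> the extra factor is 1 and only the shift of \<open>z\<close> remains, and
  \<open>c = 2\<close> gives second moments.\<close>

lemma nn_integral_log_step:
  fixes c :: real
  assumes h: "0 < h" and f: "f \<in> borel_measurable (F (real k * h) \<Otimes>\<^sub>M borel)"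
  shows "(\<integral>\<^sup>+\<omega>. ennreal (exp (c * log_step h k \<omega>)) * f (\<omega>, inc Z 0 h k \<omega>) \<partial>M)
    = (\<integral>\<^sup>+\<omega>. (\<integral>\<^sup>+z. ennreal (exp (c * (c - 1) * (\<alpha> / 2 * (lam h (Y h k \<omega>))\<^sup>2 * h)))
        * f (\<omega>, sqrt h * (z - c * \<beta> * lam h (Y h k \<omega>) * sqrt h)) \<partial>std_normal_distribution) \<partial>M)"
proof -
  interpret G: prob_space std_normal_distribution by (rule prob_space_std_normal)
  let ?s = "real k * h"
  let ?\<sigma> = "sqrt ((1 - \<rho>\<^sup>2) * h)"
  note [measurable] = f
  have Ym [measurable]: "Y h k \<in> borel_measurable (F ?s)" by (rule Y_adapted[OF h]) simp
  have fm: "(\<lambda>x. f (\<omega>, x)) \<in> borel_measurable borel" if "\<omega> \<in> space M" for \<omega>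
    by (rule measurable_compose[OF measurable_Pair1' f]) (use that in simp)
  let ?g = "\<lambda>p. ennreal (exp (c * (\<alpha> * lam h (Y h k (fst (fst p))) * (snd p + \<rho> * snd (fst p))
      - (\<beta> + \<rho> * \<alpha>) * lam h (Y h k (fst (fst p))) * snd (fst p) - \<alpha> / 2 * (lam h (Y h k (fst (fst p))))\<^sup>2 * h))) * f (fst p)"
  have g: "?g \<in> borel_measurable ((F ?s \<Otimes>\<^sub>M borel) \<Otimes>\<^sub>M borel)" by measurable
  have "(\<integral>\<^sup>+\<omega>. ennreal (exp (c * log_step h k \<omega>)) * f (\<omega>, inc Z 0 h k \<omega>) \<partial>M)
    = (\<integral>\<^sup>+\<omega>. ?g ((\<omega>, Z (?s + h) \<omega> - Z ?s \<omega>), orth (?s + h) \<omega> - orth ?s \<omega>) \<partial>M)"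
    unfolding log_step_def inc_0 orth_def by (intro nn_integral_cong) (simp add: algebra_simps)
  also have "\<dots> = (\<integral>\<^sup>+\<omega>. (\<integral>\<^sup>+z. (\<integral>\<^sup>+x. ?g ((\<omega>, sqrt h * z), ?\<sigma> * x) \<partial>std_normal_distribution) \<partial>std_normal_distribution) \<partial>M)"
    by (rule nn_integral_increments[OF h \<rho> g])
  also have "\<dots> = (\<integral>\<^sup>+\<omega>. (\<integral>\<^sup>+z. ennreal (exp (c * (c - 1) * (\<alpha> / 2 * (lam h (Y h k \<omega>))\<^sup>2 * h)))
        * f (\<omega>, sqrt h * (z - c * \<beta> * lam h (Y h k \<omega>) * sqrt h)) \<partial>std_normal_distribution) \<partial>M)"
  proof (rule nn_integral_cong)
    fix \<omega> assume \<omega>: "\<omega> \<in> space M"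
    let ?l = "lam h (Y h k \<omega>)"
    define p where "p = \<alpha> * ?l * ?\<sigma>"
    define q where "q = - \<beta> * ?l * sqrt h"
    note fac = step_factorises[OF h, of ?l, folded p_def q_def]
    have [measurable]: "(\<lambda>x. f (\<omega>, x)) \<in> borel_measurable borel" by (rule fm[OF \<omega>])
    have "?g ((\<omega>, sqrt h * z), ?\<sigma> * x) = ennreal (exp (c * (c - 1) * (\<alpha> / 2 * ?l\<^sup>2 * h)))
       * (ennreal (exp ((c * p) * x - (c * p)\<^sup>2 / 2)) * (ennreal (exp ((c * q) * z - (c * q)\<^sup>2 / 2)) * f (\<omega>, sqrt h * z)))" for x z
    proof -
      \<comment> \<open>Raising a Gaussian tilt with parameter \<open>p\<close> to the power
        \<open>c\<close> gives the tilt with parameter \<open>c * p\<close> and the factor exp (c (c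
        - 1) p^2 / 2).\<close>
      have "c * ((p * x - p\<^sup>2 / 2) + (q * z - q\<^sup>2 / 2)) = c * (c - 1) * ((p\<^sup>2 + q\<^sup>2) / 2)
          + (((c * p) * x - (c * p)\<^sup>2 / 2) + ((c * q) * z - (c * q)\<^sup>2 / 2))"
        by (simp add: power2_eq_square field_simps)
      moreover have "(p\<^sup>2 + q\<^sup>2) / 2 = \<alpha> / 2 * ?l\<^sup>2 * h" unfolding fac(2) by simp
      ultimately have E: "c * (\<alpha> * ?l * (?\<sigma> * x + \<rho> * (sqrt h * z)) - (\<beta> + \<rho> * \<alpha>) * ?l * (sqrt h * z) - \<alpha> / 2 * ?l\<^sup>2 * h)
          = c * (c - 1) * (\<alpha> / 2 * ?l\<^sup>2 * h) + (((c * p) * x - (c * p)\<^sup>2 / 2) + ((c * q) * z - (c * q)\<^sup>2 / 2))"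
        unfolding fac(1) by simp
      show ?thesis
        unfolding fst_conv snd_conv E unfolding exp_add
          ennreal_mult[OF exp_ge_zero mult_nonneg_nonneg[OF exp_ge_zero exp_ge_zero]]
          ennreal_mult[OF exp_ge_zero exp_ge_zero] mult.assoc ..
    qed
    then have "(\<integral>\<^sup>+z. (\<integral>\<^sup>+x. ?g ((\<omega>, sqrt h * z), ?\<sigma> * x) \<partial>std_normal_distribution) \<partial>std_normal_distribution)
      = (\<integral>\<^sup>+z. ennreal (exp (c * (c - 1) * (\<alpha> / 2 * ?l\<^sup>2 * h)))
       * ((\<integral>\<^sup>+x. ennreal (exp ((c * p) * x - (c * p)\<^sup>2 / 2)) * 1 \<partial>std_normal_distribution)
         * (ennreal (exp ((c * q) * z - (c * q)\<^sup>2 / 2)) * f (\<omega>, sqrt h * z))) \<partial>std_normal_distribution)"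
      by (simp add: nn_integral_cmult nn_integral_multc)
    \<comment> \<open>\<open>f\<close> sees only \<open>\<omega>\<close> and \<open>z\<close>, so
      the tilt of the orthogonal variable \<open>x\<close> integrates to 1; the other tilt becomes
      the shift of \<open>z\<close>.\<close>
    also have "(\<integral>\<^sup>+x. ennreal (exp ((c * p) * x - (c * p)\<^sup>2 / 2)) * 1 \<partial>std_normal_distribution) = 1"
      using G.emeasure_space_1 by (subst std_normal_shift) (auto simp: space_density)
    also have "(\<integral>\<^sup>+z. ennreal (exp (c * (c - 1) * (\<alpha> / 2 * ?l\<^sup>2 * h)))
         * (1 * (ennreal (exp ((c * q) * z - (c * q)\<^sup>2 / 2)) * f (\<omega>, sqrt h * z))) \<partial>std_normal_distribution)
      = ennreal (exp (c * (c - 1) * (\<alpha> / 2 * ?l\<^sup>2 * h)))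
         * (\<integral>\<^sup>+z. ennreal (exp ((c * q) * z - (c * q)\<^sup>2 / 2)) * f (\<omega>, sqrt h * z) \<partial>std_normal_distribution)"
      by (simp add: nn_integral_cmult)
    also have "(\<integral>\<^sup>+z. ennreal (exp ((c * q) * z - (c * q)\<^sup>2 / 2)) * f (\<omega>, sqrt h * z) \<partial>std_normal_distribution)
      = (\<integral>\<^sup>+z. f (\<omega>, sqrt h * (z + c * q)) \<partial>std_normal_distribution)"
      by (rule std_normal_shift) measurable
    also have "ennreal (exp (c * (c - 1) * (\<alpha> / 2 * ?l\<^sup>2 * h))) * (\<integral>\<^sup>+z. f (\<omega>, sqrt h * (z + c * q)) \<partial>std_normal_distribution)
      = (\<integral>\<^sup>+z. ennreal (exp (c * (c - 1) * (\<alpha> / 2 * ?l\<^sup>2 * h))) * f (\<omega>, sqrt h * (z + c * q)) \<partial>std_normal_distribution)"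
      by (rule nn_integral_cmult[symmetric]) measurable
    finally show "(\<integral>\<^sup>+z. (\<integral>\<^sup>+x. ?g ((\<omega>, sqrt h * z), ?\<sigma> * x) \<partial>std_normal_distribution) \<partial>std_normal_distribution)
      = (\<integral>\<^sup>+z. ennreal (exp (c * (c - 1) * (\<alpha> / 2 * ?l\<^sup>2 * h))) * f (\<omega>, sqrt h * (z - c * \<beta> * ?l * sqrt h)) \<partial>std_normal_distribution)"
      by (simp add: q_def mult.assoc)
  qed
  finally show ?thesis .
qed

text \<open>The right-hand side is the one in \<open>chain_gam\<close>. The tilt shifts
  \<open>z\<close> by \<open>- \<beta> * lam h y * sqrt h\<close> at position \<open>y\<close>,
  which multiplies the next position by \<open>exp (- \<beta> * h * lam h y)\<close>; by the choice
  of \<open>lam\<close> this is the division by \<open>1 + \<beta> * h * y\<close> in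
  \<open>trans_op\<close>.\<close>

lemma chain_gbm:
  assumes h: "0 < h" and g: "g \<in> borel_measurable borel"
  shows "(\<integral>\<^sup>+\<omega>. ennreal (exp (log_dens h k \<omega>)) * below h m k \<omega> * g (Y h k \<omega>) \<partial>M) = (trans_op \<beta> h m ^^ k) g 1"
  using g
proof (induction k arbitrary: g)
  case 0
  have "(\<integral>\<^sup>+\<omega>. g (Y h 0 \<omega>) \<partial>M) = (\<integral>\<^sup>+\<omega>. g 1 \<partial>M)"
    using Z.gbm_0 by (intro nn_integral_cong_AE) auto
  then show ?case by (simp add: emeasure_space_1 log_dens_def below_def)
next
  case (Suc k)
  note [measurable] = Suc.prems log_dens_adapted[OF h, of k] below_adapted[OF h, of "Suc k" k m]
  let ?s = "real k * h"
  have [measurable]: "Y h k \<in> borel_measurable (F ?s)" by (rule Y_adapted[OF h]) simp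
  let ?f = "\<lambda>(\<omega>, \<zeta>). ennreal (exp (log_dens h k \<omega>)) * below h m (Suc k) \<omega> * g (Y h k \<omega> * exp (\<zeta> - h / 2))"
  have f: "?f \<in> borel_measurable (F ?s \<Otimes>\<^sub>M borel)" by measurable
  have "(\<integral>\<^sup>+\<omega>. ennreal (exp (log_dens h (Suc k) \<omega>)) * below h m (Suc k) \<omega> * g (Y h (Suc k) \<omega>) \<partial>M)
    = (\<integral>\<^sup>+\<omega>. ennreal (exp (1 * log_step h k \<omega>)) * ?f (\<omega>, inc Z 0 h k \<omega>) \<partial>M)"
    unfolding Z.gbm_step
    by (intro nn_integral_cong) (simp add: log_dens_def exp_add ennreal_mult ac_simps)
  also have "\<dots> = (\<integral>\<^sup>+\<omega>. (\<integral>\<^sup>+z. ennreal (exp (1 * (1 - 1) * (\<alpha> / 2 * (lam h (Y h k \<omega>))\<^sup>2 * h)))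
        * ?f (\<omega>, sqrt h * (z - 1 * \<beta> * lam h (Y h k \<omega>) * sqrt h)) \<partial>std_normal_distribution) \<partial>M)"
    by (rule nn_integral_log_step[OF h f])
  also have "\<dots> = (\<integral>\<^sup>+\<omega>. ennreal (exp (log_dens h k \<omega>)) * below h m k \<omega> * trans_op \<beta> h m g (Y h k \<omega>) \<partial>M)"
  proof (rule nn_integral_cong)
    fix \<omega> assume "\<omega> \<in> space M"
    have pos: "0 < 1 + \<beta> * h * Y h k \<omega>" using h \<beta> by (intro add_pos_pos mult_pos_pos) auto
    have eq: "Y h k \<omega> * exp (sqrt h * (z - 1 * \<beta> * lam h (Y h k \<omega>) * sqrt h) - h / 2)
      = Y h k \<omega> * exp (sqrt h * z - h / 2) / (1 + \<beta> * h * Y h k \<omega>)" for z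
    proof -
      have "sqrt h * (z - 1 * \<beta> * lam h (Y h k \<omega>) * sqrt h) - h / 2
          = (sqrt h * z - h / 2) - \<beta> * lam h (Y h k \<omega>) * (sqrt h * sqrt h)"
        by (simp add: algebra_simps)
      also have "\<beta> * lam h (Y h k \<omega>) * (sqrt h * sqrt h) = ln (1 + \<beta> * h * Y h k \<omega>)"
        unfolding lam_def using h \<beta> by simp
      finally show ?thesis
        by (simp only: exp_diff[of "sqrt h * z - h / 2"] exp_ln[OF pos] times_divide_eq_right)
    qed
    show "(\<integral>\<^sup>+z. ennreal (exp (1 * (1 - 1) * (\<alpha> / 2 * (lam h (Y h k \<omega>))\<^sup>2 * h)))
        * ?f (\<omega>, sqrt h * (z - 1 * \<beta> * lam h (Y h k \<omega>) * sqrt h)) \<partial>std_normal_distribution)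
      = ennreal (exp (log_dens h k \<omega>)) * below h m k \<omega> * trans_op \<beta> h m g (Y h k \<omega>)"
      unfolding prod.case eq by (simp add: trans_op_def nn_integral_cmult below_def mult.assoc)
  qed
  also have "\<dots> = (trans_op \<beta> h m ^^ k) (trans_op \<beta> h m g) 1"
    by (rule Suc.IH[OF trans_op_measurable[OF Suc.prems]])
  finally show ?case by (simp add: funpow_swap1)
qed

text \<open>With exponent 2 a step costs \<open>exp (\<alpha> * l\<^sup>2 * h)\<close>, where
  \<open>l\<close> is the value of \<open>lam\<close>, and \<open>l\<close> is at most
  \<open>m\<close> on surviving paths because \<open>lam h y \<le> y\<close>. The bound involves the
  grid only through the elapsed time \<open>h * real k\<close>, so it is uniform over
  refinements.\<close>

lemma dens_L2_bound:
  assumes h: "0 < h"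
  shows "(\<integral>\<^sup>+\<omega>. ennreal (exp (2 * log_dens h k \<omega>)) * below h m k \<omega> \<partial>M) \<le> ennreal (exp (\<alpha> * m\<^sup>2 * h * real k))"
proof (induction k)
  case 0
  show ?case by (simp add: emeasure_space_1 log_dens_def below_def)
next
  case (Suc k)
  note [measurable] = log_dens_adapted[OF h, of k] below_adapted[OF h, of "Suc k" k m]
  let ?s = "real k * h"
  let ?K = "ennreal (exp (\<alpha> * m\<^sup>2 * h))"
  let ?f = "\<lambda>(\<omega>, \<zeta> :: real). ennreal (exp (2 * log_dens h k \<omega>)) * below h m (Suc k) \<omega>"
  have f: "?f \<in> borel_measurable (F ?s \<Otimes>\<^sub>M borel)" by measurable
  have "(\<integral>\<^sup>+\<omega>. ennreal (exp (2 * log_dens h (Suc k) \<omega>)) * below h m (Suc k) \<omega> \<partial>M)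
    = (\<integral>\<^sup>+\<omega>. ennreal (exp (2 * log_step h k \<omega>)) * ?f (\<omega>, inc Z 0 h k \<omega>) \<partial>M)"
    by (intro nn_integral_cong) (simp add: log_dens_def distrib_left exp_add ennreal_mult ac_simps)
  also have "\<dots> = (\<integral>\<^sup>+\<omega>. (\<integral>\<^sup>+z. ennreal (exp (2 * (2 - 1) * (\<alpha> / 2 * (lam h (Y h k \<omega>))\<^sup>2 * h)))
        * ?f (\<omega>, sqrt h * (z - 2 * \<beta> * lam h (Y h k \<omega>) * sqrt h)) \<partial>std_normal_distribution) \<partial>M)"
    by (rule nn_integral_log_step[OF h f])
  also have "\<dots> \<le> (\<integral>\<^sup>+\<omega>. ?K * (ennreal (exp (2 * log_dens h k \<omega>)) * below h m k \<omega>) \<partial>M)"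
  proof (rule nn_integral_mono)
    fix \<omega>
    have le: "ennreal (exp (2 * (2 - 1) * (\<alpha> / 2 * (lam h (Y h k \<omega>))\<^sup>2 * h))) * (b * indicator {..m} (Y h k \<omega>)) \<le> ?K * b" for b
    proof (cases "Y h k \<omega> \<le> m")
      case True
      have "(lam h (Y h k \<omega>))\<^sup>2 \<le> m\<^sup>2"
        using lam_nonneg[OF h less_imp_le[OF Z.gbm_pos]] order_trans[OF lam_le[OF h less_imp_le[OF Z.gbm_pos]] True]
        by (intro power_mono) auto
      then have "2 * (2 - 1) * (\<alpha> / 2 * (lam h (Y h k \<omega>))\<^sup>2 * h) \<le> \<alpha> * m\<^sup>2 * h" using \<alpha> h by simp
      then show ?thesis using True by (auto intro!: mult_right_mono)
    qed simp
    have "(\<integral>\<^sup>+z. ennreal (exp (2 * (2 - 1) * (\<alpha> / 2 * (lam h (Y h k \<omega>))\<^sup>2 * h)))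
        * ?f (\<omega>, sqrt h * (z - 2 * \<beta> * lam h (Y h k \<omega>) * sqrt h)) \<partial>std_normal_distribution)
      = ennreal (exp (2 * (2 - 1) * (\<alpha> / 2 * (lam h (Y h k \<omega>))\<^sup>2 * h))) * (ennreal (exp (2 * log_dens h k \<omega>)) * below h m (Suc k) \<omega>)"
      using prob_space.emeasure_space_1[OF prob_space_std_normal] by (simp add: space_density)
    also have "\<dots> \<le> ?K * (ennreal (exp (2 * log_dens h k \<omega>)) * below h m k \<omega>)"
      using le[of "ennreal (exp (2 * log_dens h k \<omega>)) * below h m k \<omega>"] by (simp add: below_def mult.assoc)
    finally show "(\<integral>\<^sup>+z. ennreal (exp (2 * (2 - 1) * (\<alpha> / 2 * (lam h (Y h k \<omega>))\<^sup>2 * h)))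
        * ?f (\<omega>, sqrt h * (z - 2 * \<beta> * lam h (Y h k \<omega>) * sqrt h)) \<partial>std_normal_distribution)
      \<le> ?K * (ennreal (exp (2 * log_dens h k \<omega>)) * below h m k \<omega>)" .
  qed
  also have "\<dots> = ?K * (\<integral>\<^sup>+\<omega>. ennreal (exp (2 * log_dens h k \<omega>)) * below h m k \<omega> \<partial>M)"
  proof (rule nn_integral_cmult)
    show "(\<lambda>\<omega>. ennreal (exp (2 * log_dens h k \<omega>)) * below h m k \<omega>) \<in> borel_measurable M"
      using measurable_F[OF log_dens_adapted[OF h, of k]] measurable_F[OF below_adapted[OF h, of k k m]] by measurable
  qed
  also have "\<dots> \<le> ?K * ennreal (exp (\<alpha> * m\<^sup>2 * h * real k))" by (rule mult_left_mono[OF Suc]) simp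
  also have "\<dots> = ennreal (exp (\<alpha> * m\<^sup>2 * h * real (Suc k)))"
    by (simp add: algebra_simps flip: ennreal_mult exp_add)
  finally show ?case .
qed

end

subsection \<open>Limits along refining grids\<close>

text \<open>Uniform continuity bounds the error on one cell by \<open>\<epsilon> * h\<close>; the
  induction adds these errors over growing initial intervals.\<close>

lemma left_riemann_sum_tendsto:
  fixes f :: "real \<Rightarrow> real"
  assumes t: "0 < t" and cont: "continuous_on {0..t} f"
  shows "(\<lambda>n. \<Sum>k<Suc n. f (real k * (t / real (Suc n))) * (t / real (Suc n))) \<longlonglongrightarrow> integral {0..t} f"
proof (rule LIMSEQ_I)
  fix e :: real assume e: "0 < e"
  define \<epsilon> where "\<epsilon> = e / (2 * t)"
  have \<epsilon>: "0 < \<epsilon>" "t * \<epsilon> < e" using e t by (simp_all add: \<epsilon>_def)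
  have "uniformly_continuous_on {0..t} f" using cont by (intro compact_uniformly_continuous) auto
  then obtain \<delta> where \<delta>: "0 < \<delta>" "\<And>x y. x \<in> {0..t} \<Longrightarrow> y \<in> {0..t} \<Longrightarrow> dist y x < \<delta> \<Longrightarrow> dist (f y) (f x) < \<epsilon>"
    using \<epsilon>(1) unfolding uniformly_continuous_on_def by meson
  have "(\<lambda>n. t / real (Suc n)) \<longlonglongrightarrow> 0"
    using tendsto_mult[OF tendsto_const[of t] LIMSEQ_inverse_real_of_nat] by (simp add: divide_inverse)
  from order_tendstoD(2)[OF this \<delta>(1)] obtain n0 where n0: "\<And>n. n0 \<le> n \<Longrightarrow> t / real (Suc n) < \<delta>"
    unfolding eventually_sequentially by blast
  have "\<bar>(\<Sum>k<Suc n. f (real k * (t / real (Suc n))) * (t / real (Suc n))) - integral {0..t} f\<bar> < e" if n: "n0 \<le> n" for n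
  proof -
    define h where "h = t / real (Suc n)"
    have h: "0 < h" "h < \<delta>" "real (Suc n) * h = t" using t n0[OF n] by (simp_all add: h_def)
    have "\<bar>(\<Sum>j<k. f (real j * h) * h) - integral {0..real k * h} f\<bar> \<le> real k * (\<epsilon> * h)" if "k \<le> Suc n" for k
      using that
    proof (induction k)
      case (Suc k)
      let ?a = "real k * h" and ?b = "real (Suc k) * h"
      have "?b \<le> real (Suc n) * h" using Suc.prems h(1) by (intro mult_right_mono) auto
      then have bt: "?b \<le> t" unfolding h(3) .
      have ab: "0 \<le> ?a" "?a \<le> ?b" "?b - ?a = h"
        using h(1) by (simp_all add: distrib_right)
      have cb: "continuous_on {0..?b} f" by (rule continuous_on_subset[OF cont]) (use ab bt in auto)
      have ca: "continuous_on {?a..?b} f" by (rule continuous_on_subset[OF cont]) (use ab bt in auto)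
      have comb: "integral {0..?a} f + integral {?a..?b} f = integral {0..?b} f"
        using ab cb by (intro Henstock_Kurzweil_Integration.integral_combine integrable_continuous_interval)
      have "norm (integral {?a..?b} (\<lambda>x. f x - f ?a)) \<le> \<epsilon> * (?b - ?a)"
      proof (rule integral_bound)
        show "continuous_on {?a..?b} (\<lambda>x. f x - f ?a)" by (intro continuous_intros ca)
        fix x assume x: "x \<in> {?a..?b}"
        then have "dist x ?a < \<delta>" using ab h by (auto simp: dist_real_def)
        moreover have "x \<in> {0..t}" "?a \<in> {0..t}"
          using x ab(1,2) bt unfolding atLeastAtMost_iff by linarith+
        ultimately have "dist (f x) (f ?a) < \<epsilon>" by (intro \<delta>(2))
        then show "norm (f x - f ?a) \<le> \<epsilon>" by (simp add: dist_norm)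
      qed (rule ab(2))
      moreover have "integral {?a..?b} (\<lambda>x. f x - f ?a) = integral {?a..?b} f - h * f ?a"
        using ab ca by (subst integral_diff) (auto intro!: integrable_continuous_interval)
      ultimately have "\<bar>integral {?a..?b} f - h * f ?a\<bar> \<le> \<epsilon> * h" unfolding ab(3) by simp
      moreover have "\<bar>(\<Sum>j<k. f (real j * h) * h) - integral {0..?a} f\<bar> \<le> real k * (\<epsilon> * h)"
        using Suc by simp
      moreover have "(\<Sum>j<Suc k. f (real j * h) * h) - integral {0..?b} f
        = ((\<Sum>j<k. f (real j * h) * h) - integral {0..?a} f) - (integral {?a..?b} f - h * f ?a)"
        unfolding comb[symmetric] by simp
      moreover have "real (Suc k) * (\<epsilon> * h) = real k * (\<epsilon> * h) + \<epsilon> * h" by (simp add: distrib_right)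
      ultimately show ?case by linarith
    qed simp
    from this[of "Suc n"] have "\<bar>(\<Sum>j<Suc n. f (real j * h) * h) - integral {0..t} f\<bar> \<le> real (Suc n) * (\<epsilon> * h)"
      unfolding h(3) by simp
    also have "\<dots> = t * \<epsilon>" using h(3) by (simp only: mult.left_commute) (simp add: mult.commute)
    finally show ?thesis using \<epsilon>(2) unfolding h_def by linarith
  qed
  then show "\<exists>n0. \<forall>n\<ge>n0. norm ((\<Sum>k<Suc n. f (real k * (t / real (Suc n))) * (t / real (Suc n))) - integral {0..t} f) < e"
    unfolding real_norm_def by blast
qed

context brownian
begin

lemma gbm_moment:
  assumes u: "0 \<le> u"
  shows "integrable M (\<lambda>\<omega>. gbm u \<omega> ^ p)"
    and "expectation (\<lambda>\<omega>. gbm u \<omega> ^ p) = exp ((real p ^ 2 - real p) / 2 * u)"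
proof -
  have "integrable M (\<lambda>\<omega>. gbm u \<omega> ^ p) \<and> expectation (\<lambda>\<omega>. gbm u \<omega> ^ p) = exp ((real p ^ 2 - real p) / 2 * u)"
  \<comment> \<open>The law of increments is given for intervals of positive length only, and
    \<open>W 0\<close> vanishes only almost surely.\<close>
  proof (cases "u = 0")
    case True
    have m: "(\<lambda>\<omega>. gbm u \<omega> ^ p) \<in> borel_measurable M" using measurable_gbm[OF u] by measurable
    have ae: "AE \<omega> in M. gbm u \<omega> ^ p = 1" using gbm_0 unfolding True by eventually_elim simp
    have "integrable M (\<lambda>\<omega>. gbm u \<omega> ^ p) \<longleftrightarrow> integrable M (\<lambda>_. 1 :: real)"
      using ae by (intro integrable_cong_AE m) auto
    moreover have "expectation (\<lambda>\<omega>. gbm u \<omega> ^ p) = expectation (\<lambda>_. 1)"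
      using ae by (intro integral_cong_AE m) auto
    ultimately show ?thesis using True by (simp add: prob_space)
  next
    case False
    then have u': "(0::real) \<le> 0" "0 < u" using u by auto
    define c where "c = exp (- (real p * u / 2))"
    have gm: "(\<lambda>x::real. exp (real p * x)) \<in> borel_measurable borel" by measurable
    have sc: "exp (real p * (sqrt (u - 0) * x)) = exp ((real p * sqrt u) * x)" for x by simp
    have i: "integrable M (\<lambda>\<omega>. exp (real p * (W u \<omega> - W 0 \<omega>)))"
      unfolding integral_increment(1)[OF u' gm] sc by (rule std_normal_mgf(1))
    have e: "expectation (\<lambda>\<omega>. exp (real p * (W u \<omega> - W 0 \<omega>))) = exp ((real p * sqrt u)\<^sup>2 / 2)"
      unfolding integral_increment(2)[OF u' gm] sc by (rule std_normal_mgf(2))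
    have m: "(\<lambda>\<omega>. gbm u \<omega> ^ p) \<in> borel_measurable M" using measurable_gbm[OF u] by measurable
    have ae: "AE \<omega> in M. gbm u \<omega> ^ p = c * exp (real p * (W u \<omega> - W 0 \<omega>))"
    proof -
      have "AE \<omega> in M. W 0 \<omega> = 0" using bm by (simp add: bm_filt_def)
      then show ?thesis
      proof eventually_elim
        case (elim \<omega>)
        have "gbm u \<omega> ^ p = exp (real p * (W u \<omega> - u / 2))" unfolding gbm_def exp_of_nat_mult ..
        also have "\<dots> = exp (- (real p * u / 2) + real p * (W u \<omega> - W 0 \<omega>))"
          using elim by (simp add: algebra_simps)
        finally show ?case unfolding exp_add c_def .
      qed
    qed
    have i': "integrable M (\<lambda>\<omega>. c * exp (real p * (W u \<omega> - W 0 \<omega>)))" by (rule integrable_mult_right[OF i])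
    have "integrable M (\<lambda>\<omega>. gbm u \<omega> ^ p)"
      by (rule integrable_cong_AE_imp[OF i' m]) (use ae in \<open>auto elim: eventually_mono\<close>)
    moreover have "expectation (\<lambda>\<omega>. gbm u \<omega> ^ p) = c * exp ((real p * sqrt u)\<^sup>2 / 2)"
      using integral_cong_AE[OF m borel_measurable_integrable[OF i'] ae] unfolding integral_mult_right_zero e .
    moreover have "c * exp ((real p * sqrt u)\<^sup>2 / 2) = exp ((real p ^ 2 - real p) / 2 * u)"
    proof -
      have "- (real p * u / 2) + (real p * sqrt u)\<^sup>2 / 2 = (real p ^ 2 - real p) / 2 * u"
        using u by (simp add: power_mult_distrib field_simps)
      then show ?thesis unfolding c_def exp_add[symmetric] by simp
    qed
    ultimately show ?thesis by simp
  qed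
  then show "integrable M (\<lambda>\<omega>. gbm u \<omega> ^ p)"
    "expectation (\<lambda>\<omega>. gbm u \<omega> ^ p) = exp ((real p ^ 2 - real p) / 2 * u)" by auto
qed

lemma continuous_gbm: "AE \<omega> in M. continuous_on {0..t} (\<lambda>u. gbm u \<omega>)"
proof -
  have "AE \<omega> in M. continuous_on {0..} (\<lambda>t. W t \<omega>)" using bm by (simp add: bm_filt_def)
  then show ?thesis
  proof eventually_elim
    case (elim \<omega>)
    then have "continuous_on {0..t} (\<lambda>u. W u \<omega>)" by (rule continuous_on_subset) auto
    then show ?case unfolding gbm_def by (intro continuous_intros) auto
  qed
qed

lemma bounded_gbm:
  "AE \<omega> in M. \<exists>m::nat. \<forall>u\<in>{0..t}. gbm u \<omega> \<le> real m"
  using continuous_gbm[of t]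
proof eventually_elim
  case (elim \<omega>)
  have "compact ((\<lambda>u. gbm u \<omega>) ` {0..t})" by (rule compact_continuous_image[OF elim]) simp
  then obtain K where K: "\<And>u. u \<in> {0..t} \<Longrightarrow> norm (gbm u \<omega>) \<le> K"
    using compact_imp_bounded bounded_iff by (metis image_eqI)
  obtain m :: nat where "K \<le> real m" using real_arch_simple by blast
  moreover have "gbm u \<omega> \<le> K" if "u \<in> {0..t}" for u
    using K[OF that] gbm_pos[of u \<omega>] by simp
  ultimately show ?case by (intro exI[of _ m]) (meson order_trans)
qed

end

section \<open>Limits of the discretised integrals\<close>

context hull_white
begin

text \<open>This is x - x^2 \<le> ln (1 + x) \<le> x for x = \<open>\<beta> * h * y\<close>, divided
  by \<open>\<beta> * h\<close>.\<close>

lemma lam_diff: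
  assumes h: "0 < h" and y: "0 \<le> y"
  shows "\<bar>lam h y - y\<bar> \<le> \<beta> * h * y\<^sup>2"
proof -
  let ?x = "\<beta> * h * y"
  have x: "0 \<le> ?x" using h \<beta> y by simp
  have "?x - ?x\<^sup>2 \<le> ln (1 + ?x)"
  proof (cases "?x \<le> 1")
    case True then show ?thesis by (rule ln_one_plus_pos_lower_bound[OF x])
  next
    case False
    then have "?x * 1 \<le> ?x * ?x" by (intro mult_left_mono) auto
    moreover have "0 \<le> ln (1 + ?x)" using x by (intro ln_ge_zero) auto
    ultimately show ?thesis by (simp add: power2_eq_square)
  qed
  then have "(?x - ?x\<^sup>2) / (\<beta> * h) \<le> lam h y" unfolding lam_def using h \<beta> by (intro divide_right_mono) auto
  moreover have "(?x - ?x\<^sup>2) / (\<beta> * h) = y - \<beta> * h * y\<^sup>2" using h \<beta> by (simp add: power2_eq_square field_simps)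
  ultimately show ?thesis using lam_le[OF h y] by linarith
qed

context
  fixes t :: real
  assumes t: "0 < t"
begin

text \<open>\<open>Suc n\<close> cells keep the spacing meaningful at \<open>n = 0\<close>; the
  endpoint \<open>t\<close> is the grid point with index \<open>Suc n\<close>.\<close>

definition mesh :: "nat \<Rightarrow> real" where
  "mesh n = t / real (Suc n)"

lemma mesh: "0 < mesh n" "real (Suc n) * mesh n = t"
  using t by (simp_all add: mesh_def)

lemma mesh_le: "k \<le> Suc n \<Longrightarrow> real k * mesh n \<le> t"
  using mult_right_mono[of "real k" "real (Suc n)" "mesh n"] mesh(1)[of n] unfolding mesh(2) by simp

lemma mesh_lim: "mesh \<longlonglongrightarrow> 0"
  unfolding mesh_def using tendsto_mult[OF tendsto_const[of t] LIMSEQ_inverse_real_of_nat] by (simp add: divide_inverse)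

text \<open>\<open>V\<close> stands for \<open>W\<close> and for \<open>Z\<close>. By
  \<open>lam_diff\<close> and the grid isometry the second moment is at most a constant times
  \<open>(mesh n)\<^sup>2\<close>.\<close>

lemma lam_error_lim:
  assumes V: "brownian M F V"
  shows "lim_in_prob M (\<lambda>n \<omega>. \<Sum>j<Suc n. (lam (mesh n) (Y (mesh n) j \<omega>) - Y (mesh n) j \<omega>) * inc V 0 (mesh n) j \<omega>) (\<lambda>_. 0)"
proof -
  interpret V: brownian M F V by (rule V)
  let ?H = "\<lambda>n j \<omega>. lam (mesh n) (Y (mesh n) j \<omega>) - Y (mesh n) j \<omega>"
  have nn: "0 \<le> real j * mesh n" for j n using mesh(1)[of n] by simp
  have Hm: "?H n j \<in> borel_measurable (F (0 + real j * mesh n))" for n j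
    unfolding add_0 using Y_adapted[OF mesh(1), of j j n] by measurable
  have H2: "(?H n j \<omega>)\<^sup>2 \<le> (\<beta> * mesh n)\<^sup>2 * Y (mesh n) j \<omega> ^ 4" for n j \<omega>
  proof -
    have "(?H n j \<omega>)\<^sup>2 = \<bar>?H n j \<omega>\<bar>\<^sup>2" by simp
    also have "\<dots> \<le> (\<beta> * mesh n * (Y (mesh n) j \<omega>)\<^sup>2)\<^sup>2"
      by (intro power_mono lam_diff mesh) (auto intro: less_imp_le)
    finally show ?thesis by (simp add: power_mult_distrib flip: power_mult)
  qed
  have Yi: "integrable M (\<lambda>\<omega>. (\<beta> * mesh n)\<^sup>2 * Y (mesh n) j \<omega> ^ 4)" for n j
    by (intro integrable_mult_right Z.gbm_moment nn)
  have Hi: "integrable M (\<lambda>\<omega>. (?H n j \<omega>)\<^sup>2)" for n j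
  proof (rule Bochner_Integration.integrable_bound[OF Yi[of n j]])
    show "(\<lambda>\<omega>. (?H n j \<omega>)\<^sup>2) \<in> borel_measurable M" using measurable_F[OF Hm[of n j]] by measurable
    show "AE \<omega> in M. norm ((?H n j \<omega>)\<^sup>2) \<le> norm ((\<beta> * mesh n)\<^sup>2 * Y (mesh n) j \<omega> ^ 4)"
      unfolding real_norm_def abs_of_nonneg[OF zero_le_power2] by (intro AE_I2 order_trans[OF H2 abs_ge_self])
  qed
  \<comment> \<open>The fourth moment of \<open>Y\<close> grows at rate (4^2 - 4)/2 = 6.\<close>
  have He: "expectation (\<lambda>\<omega>. (?H n j \<omega>)\<^sup>2) \<le> (\<beta> * mesh n)\<^sup>2 * exp (6 * t)" if "j \<le> Suc n" for n j
  proof -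
    have "expectation (\<lambda>\<omega>. (?H n j \<omega>)\<^sup>2) \<le> expectation (\<lambda>\<omega>. (\<beta> * mesh n)\<^sup>2 * Y (mesh n) j \<omega> ^ 4)"
      by (rule integral_mono[OF Hi Yi H2])
    also have "\<dots> = (\<beta> * mesh n)\<^sup>2 * exp (6 * (real j * mesh n))"
      unfolding integral_mult_right_zero Z.gbm_moment(2)[OF nn] by simp
    also have "\<dots> \<le> (\<beta> * mesh n)\<^sup>2 * exp (6 * t)" using mesh_le[OF that] by (intro mult_left_mono) auto
    finally show ?thesis .
  qed
  have g: "(\<lambda>x::real. x) \<in> borel_measurable borel" "integrable std_normal_distribution (\<lambda>x. (sqrt d * x)\<^sup>2)"
    "(\<integral>x. sqrt d * x \<partial>std_normal_distribution) = 0" for d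
    using integrable_std_normal_distribution_moment[of 2] integral_std_normal_distribution_moment_odd[of 1]
    by (simp_all add: power_mult_distrib)
  have v: "(\<integral>x. (sqrt (mesh n) * x)\<^sup>2 \<partial>std_normal_distribution) = mesh n" for n
    unfolding power_mult_distrib using std_normal_distribution_even_moments(1)[of 1] mesh(1)[of n] by simp
  note T = V.grid_transform_L2[OF order_refl mesh(1) Hm Hi g]
  show ?thesis
  proof (rule lim_in_prob_L2)
    show "random_variable borel (\<lambda>\<omega>. \<Sum>j<Suc n. ?H n j \<omega> * inc V 0 (mesh n) j \<omega>)" for n
      using mesh(1)[of n]
      by (intro borel_measurable_sum borel_measurable_times measurable_F[OF Hm] V.measurable_inc) auto
    show "integrable M (\<lambda>\<omega>. (\<Sum>j<Suc n. ?H n j \<omega> * inc V 0 (mesh n) j \<omega>)\<^sup>2)" for n by (rule T(1))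
    have le: "expectation (\<lambda>\<omega>. (\<Sum>j<Suc n. ?H n j \<omega> * inc V 0 (mesh n) j \<omega>)\<^sup>2) \<le> \<beta>\<^sup>2 * t * exp (6 * t) * (mesh n)\<^sup>2" for n
    proof -
      have "(\<Sum>j<Suc n. expectation (\<lambda>\<omega>. (?H n j \<omega>)\<^sup>2)) \<le> (\<Sum>j<Suc n. (\<beta> * mesh n)\<^sup>2 * exp (6 * t))"
        by (intro sum_mono He) auto
      also have "\<dots> = real (Suc n) * ((\<beta> * mesh n)\<^sup>2 * exp (6 * t))" by simp
      finally have "(\<Sum>j<Suc n. expectation (\<lambda>\<omega>. (?H n j \<omega>)\<^sup>2)) * mesh n \<le> real (Suc n) * ((\<beta> * mesh n)\<^sup>2 * exp (6 * t)) * mesh n"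
        using mesh(1)[of n] by (intro mult_right_mono) auto
      also have "\<dots> = (real (Suc n) * mesh n) * ((\<beta> * mesh n)\<^sup>2 * exp (6 * t))" by (simp only: ac_simps)
      also have "\<dots> = \<beta>\<^sup>2 * t * exp (6 * t) * (mesh n)\<^sup>2" unfolding mesh(2) power_mult_distrib by (simp only: ac_simps)
      finally show ?thesis unfolding T(2) v .
    qed
    have lim: "(\<lambda>n. \<beta>\<^sup>2 * t * exp (6 * t) * (mesh n)\<^sup>2) \<longlonglongrightarrow> 0"
      using tendsto_mult[OF tendsto_const[of "\<beta>\<^sup>2 * t * exp (6 * t)"] tendsto_power[OF mesh_lim, of 2]] by simp
    show "(\<lambda>n. expectation (\<lambda>\<omega>. (\<Sum>j<Suc n. ?H n j \<omega> * inc V 0 (mesh n) j \<omega>)\<^sup>2)) \<longlonglongrightarrow> 0"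
      by (rule tendsto_sandwich[OF _ _ tendsto_const lim]; intro always_eventually allI le) simp
  qed
qed

text \<open>Discrete form of Y_t - 1 = \<integral> Y dZ. The increments of \<open>Y\<close>
  telescope, and they differ from \<open>Y\<close> times the increments of \<open>Z\<close> by
  \<open>Y\<close> times a centred remainder with variance of order
  \<open>(mesh n)\<^sup>2\<close>.\<close>

lemma gbm_ito_lim:
  "lim_in_prob M (\<lambda>n \<omega>. \<Sum>j<Suc n. Y (mesh n) j \<omega> * inc Z 0 (mesh n) j \<omega>) (\<lambda>\<omega>. Z.gbm t \<omega> - 1)"
proof -
  let ?r = "\<lambda>n x. exp (x - mesh n / 2) - 1 - x"
  have nn: "0 \<le> real j * mesh n" for j n using mesh(1)[of n] by simp
  have Hm: "Y (mesh n) j \<in> borel_measurable (F (0 + real j * mesh n))" for n j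
    using Y_adapted[OF mesh(1), of j j n] by simp
  have Hi: "integrable M (\<lambda>\<omega>. (Y (mesh n) j \<omega>)\<^sup>2)" for n j
    by (rule Z.gbm_moment(1)[OF nn])
  have He: "expectation (\<lambda>\<omega>. (Y (mesh n) j \<omega>)\<^sup>2) \<le> exp t" if "j \<le> Suc n" for n j
    unfolding Z.gbm_moment(2)[OF nn] using mesh_le[OF that] by simp
  have sq: "mesh n = (sqrt (mesh n))\<^sup>2" for n using mesh(1)[of n] by simp
  have r: "?r n (sqrt (mesh n) * x) = exp (sqrt (mesh n) * x - (sqrt (mesh n))\<^sup>2 / 2) - 1 - sqrt (mesh n) * x" for n x
    using sq[of n] by simp
  have g: "?r n \<in> borel_measurable borel" "integrable std_normal_distribution (\<lambda>x. (?r n (sqrt (mesh n) * x))\<^sup>2)"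
    "(\<integral>x. ?r n (sqrt (mesh n) * x) \<partial>std_normal_distribution) = 0" for n
    unfolding r using std_normal_exp_remainder(1,2)[of "sqrt (mesh n)"] by (simp_all only:) measurable
  have v: "(\<integral>x. (?r n (sqrt (mesh n) * x))\<^sup>2 \<partial>std_normal_distribution) = exp (mesh n) - 1 - mesh n" for n
  proof -
    have "(\<integral>x. (?r n (sqrt (mesh n) * x))\<^sup>2 \<partial>std_normal_distribution) = exp ((sqrt (mesh n))\<^sup>2) - 1 - (sqrt (mesh n))\<^sup>2"
      unfolding r by (rule std_normal_exp_remainder(3))
    then show ?thesis unfolding sq[symmetric] .
  qed
  note T = Z.grid_transform_L2[OF order_refl mesh(1) Hm Hi g]
  have meas: "random_variable borel (\<lambda>\<omega>. \<Sum>j<Suc n. Y (mesh n) j \<omega> * ?r n (inc Z 0 (mesh n) j \<omega>))" for n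
    using mesh(1)[of n]
    by (intro borel_measurable_sum borel_measurable_times measurable_F[OF Hm] measurable_compose[OF Z.measurable_inc g(1)]) auto
  have measY: "random_variable borel (\<lambda>\<omega>. \<Sum>j<Suc n. Y (mesh n) j \<omega> * inc Z 0 (mesh n) j \<omega>)" for n
    using mesh(1)[of n]
    by (intro borel_measurable_sum borel_measurable_times measurable_F[OF Hm] Z.measurable_inc) auto
  have zero: "lim_in_prob M (\<lambda>n \<omega>. \<Sum>j<Suc n. Y (mesh n) j \<omega> * ?r n (inc Z 0 (mesh n) j \<omega>)) (\<lambda>_. 0)"
  proof (rule lim_in_prob_L2[OF meas T(1)])
    have le: "expectation (\<lambda>\<omega>. (\<Sum>j<Suc n. Y (mesh n) j \<omega> * ?r n (inc Z 0 (mesh n) j \<omega>))\<^sup>2) \<le> exp t * t * mesh n"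
      if small: "mesh n \<le> 1" for n
    proof -
      have "(\<Sum>j<Suc n. expectation (\<lambda>\<omega>. (Y (mesh n) j \<omega>)\<^sup>2)) \<le> (\<Sum>j<Suc n. exp t)"
        by (intro sum_mono He) auto
      then have a: "(\<Sum>j<Suc n. expectation (\<lambda>\<omega>. (Y (mesh n) j \<omega>)\<^sup>2)) \<le> real (Suc n) * exp t" by simp
      \<comment> \<open>\<open>exp_bound\<close> needs an argument of at most 1, so the estimate is
        obtained only from some \<open>n\<close> on.\<close>
      have b: "exp (mesh n) - 1 - mesh n \<le> (mesh n)\<^sup>2"
        using exp_bound[of "mesh n"] mesh(1)[of n] small by simp
      have c: "0 \<le> exp (mesh n) - 1 - mesh n" using exp_ge_add_one_self[of "mesh n"] by linarith
      have "(\<Sum>j<Suc n. expectation (\<lambda>\<omega>. (Y (mesh n) j \<omega>)\<^sup>2)) * (exp (mesh n) - 1 - mesh n)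
        \<le> (real (Suc n) * exp t) * (mesh n)\<^sup>2" by (intro mult_mono a b c) simp
      also have "\<dots> = exp t * (real (Suc n) * mesh n) * mesh n" unfolding power2_eq_square by (simp only: ac_simps)
      finally show ?thesis unfolding T(2) v mesh(2) .
    qed
    have lim: "(\<lambda>n. exp t * t * mesh n) \<longlonglongrightarrow> 0"
      using tendsto_mult[OF tendsto_const[of "exp t * t"] mesh_lim] by simp
    have "eventually (\<lambda>n. mesh n < 1) sequentially" using order_tendstoD(2)[OF mesh_lim, of 1] by simp
    then have ev: "eventually (\<lambda>n. expectation (\<lambda>\<omega>. (\<Sum>j<Suc n. Y (mesh n) j \<omega> * ?r n (inc Z 0 (mesh n) j \<omega>))\<^sup>2) \<le> exp t * t * mesh n) sequentially"
      by eventually_elim (rule le, simp)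
    show "(\<lambda>n. expectation (\<lambda>\<omega>. (\<Sum>j<Suc n. Y (mesh n) j \<omega> * ?r n (inc Z 0 (mesh n) j \<omega>))\<^sup>2)) \<longlonglongrightarrow> 0"
      by (rule tendsto_sandwich[OF _ ev tendsto_const lim]) (intro always_eventually allI, simp)
  qed
  have gt: "random_variable borel (\<lambda>\<omega>. Z.gbm t \<omega> - 1)" using Z.measurable_gbm[of t] t by simp
  have tele: "(\<Sum>j<Suc n. Y (mesh n) j \<omega> * ?r n (inc Z 0 (mesh n) j \<omega>)) = Z.gbm t \<omega> - Z.gbm 0 \<omega>
      - (\<Sum>j<Suc n. Y (mesh n) j \<omega> * inc Z 0 (mesh n) j \<omega>)" for n \<omega>
  proof -
    have "Y (mesh n) j \<omega> * ?r n (inc Z 0 (mesh n) j \<omega>) = (Y (mesh n) (Suc j) \<omega> - Y (mesh n) j \<omega>) - Y (mesh n) j \<omega> * inc Z 0 (mesh n) j \<omega>" for j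
      unfolding Z.gbm_step by (simp add: algebra_simps)
    then have "(\<Sum>j<Suc n. Y (mesh n) j \<omega> * ?r n (inc Z 0 (mesh n) j \<omega>))
      = (\<Sum>j<Suc n. Y (mesh n) (Suc j) \<omega> - Y (mesh n) j \<omega>) - (\<Sum>j<Suc n. Y (mesh n) j \<omega> * inc Z 0 (mesh n) j \<omega>)"
      by (simp only: sum_subtractf)
    also have "(\<Sum>j<Suc n. Y (mesh n) (Suc j) \<omega> - Y (mesh n) j \<omega>) = Z.gbm t \<omega> - Z.gbm 0 \<omega>"
      by (subst sum_lessThan_telescope) (simp only: mesh(2), simp)
    finally show ?thesis .
  qed
  \<comment> \<open>The sign is flipped because the telescoping identity contains the Riemann sum
    with a minus sign.\<close>
  have "lim_in_prob M (\<lambda>n \<omega>. (- 1) * (\<Sum>j<Suc n. Y (mesh n) j \<omega> * ?r n (inc Z 0 (mesh n) j \<omega>))) (\<lambda>_. (- 1) * 0)"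
    by (rule lim_in_prob_cmult[OF zero])
  note * = lim_in_prob_cong_AE[OF _ _ measY gt _ this]
  show ?thesis
  proof (rule *)
    show "AE \<omega> in M. (- 1) * (\<Sum>j<Suc n. Y (mesh n) j \<omega> * ?r n (inc Z 0 (mesh n) j \<omega>)) - (- 1) * 0
        = (\<Sum>j<Suc n. Y (mesh n) j \<omega> * inc Z 0 (mesh n) j \<omega>) - (Z.gbm t \<omega> - 1)" for n
      using Z.gbm_0 unfolding tele by eventually_elim simp
    show "random_variable borel (\<lambda>\<omega>. (- 1) * (\<Sum>j<Suc n. Y (mesh n) j \<omega> * ?r n (inc Z 0 (mesh n) j \<omega>)))" for n
      by (rule borel_measurable_times[OF borel_measurable_const meas])
  qed (rule borel_measurable_const)
qed

text \<open>Pathwise: on a path bounded by \<open>m\<close>, factorising the difference of squares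
  and using \<open>lam_diff\<close> bounds the error of a cell by 2 \<beta> m^3 times
  \<open>(mesh n)\<^sup>2\<close>. Replacing \<open>lam\<close> by \<open>Y\<close> therefore does
  not change the limit of the Riemann sums.\<close>

lemma lam_square_lim:
  "AE \<omega> in M. (\<lambda>n. \<Sum>j<Suc n. (lam (mesh n) (Y (mesh n) j \<omega>))\<^sup>2 * mesh n) \<longlonglongrightarrow> integral {0..t} (\<lambda>u. (Z.gbm u \<omega>)\<^sup>2)"
  using Z.continuous_gbm[of t] Z.bounded_gbm[of t]
proof eventually_elim
  case (elim \<omega>)
  then obtain m :: nat where m: "\<And>u. u \<in> {0..t} \<Longrightarrow> Z.gbm u \<omega> \<le> real m" by blast
  have "continuous_on {0..t} (\<lambda>u. (Z.gbm u \<omega>)\<^sup>2)" using elim by (intro continuous_intros)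
  from left_riemann_sum_tendsto[OF t this]
  have R: "(\<lambda>n. \<Sum>j<Suc n. (Y (mesh n) j \<omega>)\<^sup>2 * mesh n) \<longlonglongrightarrow> integral {0..t} (\<lambda>u. (Z.gbm u \<omega>)\<^sup>2)"
    unfolding mesh_def .
  have le: "\<bar>(\<Sum>j<Suc n. (lam (mesh n) (Y (mesh n) j \<omega>))\<^sup>2 * mesh n) - (\<Sum>j<Suc n. (Y (mesh n) j \<omega>)\<^sup>2 * mesh n)\<bar>
      \<le> 2 * \<beta> * real m ^ 3 * t * mesh n" for n
  proof -
    have "\<bar>(lam (mesh n) (Y (mesh n) j \<omega>))\<^sup>2 * mesh n - (Y (mesh n) j \<omega>)\<^sup>2 * mesh n\<bar> \<le> 2 * \<beta> * real m ^ 3 * mesh n * mesh n"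
      if j: "j \<in> {..<Suc n}" for j
    proof -
      let ?y = "Y (mesh n) j \<omega>" and ?l = "lam (mesh n) (Y (mesh n) j \<omega>)"
      have y: "0 \<le> ?y" "?y \<le> real m" using m[of "real j * mesh n"] mesh_le[of j n] mesh(1)[of n] j by (auto intro: less_imp_le)
      have l: "0 \<le> ?l" "?l \<le> ?y" using lam_nonneg[OF mesh(1) y(1)] lam_le[OF mesh(1) y(1)] by auto
      have "\<bar>?l\<^sup>2 - ?y\<^sup>2\<bar> = \<bar>?l - ?y\<bar> * (?l + ?y)"
        using l y by (simp add: power2_eq_square square_diff_square_factored abs_mult mult.commute)
      also have "\<dots> \<le> (\<beta> * mesh n * ?y\<^sup>2) * (2 * real m)"
        using l y lam_diff[OF mesh(1)[of n] y(1)] \<beta> mesh(1)[of n] by (intro mult_mono) auto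
      also have "\<dots> \<le> (\<beta> * mesh n * (real m)\<^sup>2) * (2 * real m)"
        using y \<beta> mesh(1)[of n] by (intro mult_right_mono mult_left_mono power_mono) auto
      finally have "\<bar>?l\<^sup>2 - ?y\<^sup>2\<bar> \<le> 2 * \<beta> * real m ^ 3 * mesh n" by (simp add: power2_eq_square power3_eq_cube ac_simps)
      then have "\<bar>?l\<^sup>2 - ?y\<^sup>2\<bar> * mesh n \<le> 2 * \<beta> * real m ^ 3 * mesh n * mesh n"
        using mesh(1)[of n] by (intro mult_right_mono) auto
      then show ?thesis using mesh(1)[of n] by (simp add: abs_mult flip: left_diff_distrib)
    qed
    then have "\<bar>(\<Sum>j<Suc n. (lam (mesh n) (Y (mesh n) j \<omega>))\<^sup>2 * mesh n - (Y (mesh n) j \<omega>)\<^sup>2 * mesh n)\<bar>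
       \<le> (\<Sum>j<Suc n. 2 * \<beta> * real m ^ 3 * mesh n * mesh n)"
      by (intro order_trans[OF sum_abs] sum_mono)
    also have "\<dots> = real (Suc n) * (2 * \<beta> * real m ^ 3 * mesh n * mesh n)" by simp
    also have "\<dots> = 2 * \<beta> * real m ^ 3 * (real (Suc n) * mesh n) * mesh n" by (simp only: ac_simps)
    finally show ?thesis unfolding sum_subtractf mesh(2) .
  qed
  have lim: "(\<lambda>n. 2 * \<beta> * real m ^ 3 * t * mesh n) \<longlonglongrightarrow> 0"
    using tendsto_mult[OF tendsto_const[of "2 * \<beta> * real m ^ 3 * t"] mesh_lim] by simp
  have "(\<lambda>n. (\<Sum>j<Suc n. (lam (mesh n) (Y (mesh n) j \<omega>))\<^sup>2 * mesh n) - (\<Sum>j<Suc n. (Y (mesh n) j \<omega>)\<^sup>2 * mesh n)) \<longlonglongrightarrow> 0"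
    by (rule Lim_null_comparison[OF _ lim]) (intro always_eventually allI, unfold real_norm_def, rule le)
  from tendsto_add[OF this R] show ?case by (simp only: diff_add_cancel add_0)
qed

end

end

section \<open>Limits of killed and truncated expectations\<close>

context prob_space
begin

lemma nn_integral_min_tendsto:
  fixes X :: "nat \<Rightarrow> 'a \<Rightarrow> real"
  assumes [measurable]: "\<And>n. random_variable borel (X n)" "random_variable borel L"
    and lim: "AE \<omega> in M. (\<lambda>n. X n \<omega>) \<longlonglongrightarrow> L \<omega>"
  shows "(\<lambda>n. \<integral>\<^sup>+\<omega>. ennreal (min (X n \<omega>) K) \<partial>M) \<longlonglongrightarrow> (\<integral>\<^sup>+\<omega>. ennreal (min (L \<omega>) K) \<partial>M)"
proof (rule nn_integral_dominated_convergence[where w = "\<lambda>_. ennreal K"])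
  show "AE \<omega> in M. (\<lambda>n. ennreal (min (X n \<omega>) K)) \<longlonglongrightarrow> ennreal (min (L \<omega>) K)"
    using lim by eventually_elim (intro tendsto_ennrealI tendsto_min tendsto_const)
  show "(\<integral>\<^sup>+\<omega>. ennreal K \<partial>M) < \<infinity>" by (simp add: emeasure_space_1)
qed (auto intro!: ennreal_leI)

text \<open>A cutoff with values 0 and 1 that does not vary with \<open>n\<close> carries the
  pathwise limit along, so Fatou's lemma applies to the product.\<close>

lemma nn_integral_Fatou_cutoff:
  fixes X :: "nat \<Rightarrow> 'a \<Rightarrow> real" and C :: "'a \<Rightarrow> ennreal"
  assumes [measurable]: "\<And>n. random_variable borel (X n)" "random_variable borel C"
    and C: "\<And>\<omega>. C \<omega> \<in> {0, 1}" and lim: "AE \<omega> in M. (\<lambda>n. X n \<omega>) \<longlonglongrightarrow> L \<omega>"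
  shows "(\<integral>\<^sup>+\<omega>. ennreal (L \<omega>) * C \<omega> \<partial>M) \<le> liminf (\<lambda>n. \<integral>\<^sup>+\<omega>. ennreal (X n \<omega>) * C \<omega> \<partial>M)"
proof -
  have "AE \<omega> in M. ennreal (L \<omega>) * C \<omega> = liminf (\<lambda>n. ennreal (X n \<omega>) * C \<omega>)"
    using lim
  proof eventually_elim
    case (elim \<omega>)
    have "(\<lambda>n. ennreal (X n \<omega>) * C \<omega>) \<longlonglongrightarrow> ennreal (L \<omega>) * C \<omega>"
      using C[of \<omega>] tendsto_ennrealI[OF elim] by auto
    then show ?case by (rule lim_imp_Liminf[symmetric, rotated]) simp
  qed
  then have "(\<integral>\<^sup>+\<omega>. ennreal (L \<omega>) * C \<omega> \<partial>M) = (\<integral>\<^sup>+\<omega>. liminf (\<lambda>n. ennreal (X n \<omega>) * C \<omega>) \<partial>M)"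
    by (rule nn_integral_cong_AE)
  also have "\<dots> \<le> liminf (\<lambda>n. \<integral>\<^sup>+\<omega>. ennreal (X n \<omega>) * C \<omega> \<partial>M)"
    by (rule nn_integral_liminf) measurable
  finally show ?thesis .
qed

text \<open>Fatou once more, now in the killing level: almost every path is eventually not
  killed.\<close>

lemma nn_integral_le_of_cutoffs:
  fixes f :: "'a \<Rightarrow> ennreal" and C :: "nat \<Rightarrow> 'a \<Rightarrow> ennreal"
  assumes [measurable]: "random_variable borel f" "\<And>m. random_variable borel (C m)"
    and C: "AE \<omega> in M. eventually (\<lambda>m. C m \<omega> = 1) sequentially"
    and le: "\<And>m. (\<integral>\<^sup>+\<omega>. f \<omega> * C m \<omega> \<partial>M) \<le> R"
  shows "(\<integral>\<^sup>+\<omega>. f \<omega> \<partial>M) \<le> R"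
proof -
  have "AE \<omega> in M. f \<omega> = liminf (\<lambda>m. f \<omega> * C m \<omega>)"
    using C
  proof eventually_elim
    case (elim \<omega>)
    then have "eventually (\<lambda>m. f \<omega> * C m \<omega> = f \<omega>) sequentially" by eventually_elim simp
    then have "(\<lambda>m. f \<omega> * C m \<omega>) \<longlonglongrightarrow> f \<omega>" by (rule tendsto_eventually)
    then show ?case by (rule lim_imp_Liminf[symmetric, rotated]) simp
  qed
  then have "(\<integral>\<^sup>+\<omega>. f \<omega> \<partial>M) = (\<integral>\<^sup>+\<omega>. liminf (\<lambda>m. f \<omega> * C m \<omega>) \<partial>M)"
    by (rule nn_integral_cong_AE)
  also have "\<dots> \<le> liminf (\<lambda>m. \<integral>\<^sup>+\<omega>. f \<omega> * C m \<omega> \<partial>M)"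
    by (rule nn_integral_liminf) measurable
  also have "\<dots> \<le> liminf (\<lambda>m::nat. R)"
    by (intro Liminf_mono always_eventually allI le)
  also have "\<dots> = R" by (rule lim_imp_Liminf) simp_all
  finally show ?thesis .
qed

end

context brownian
begin

lemma gam_nonneg: "0 < h \<Longrightarrow> 0 < \<beta> \<Longrightarrow> 0 \<le> gam \<beta> h k \<omega>"
  unfolding gam_def
  by (intro divide_nonneg_nonneg add_nonneg_nonneg mult_nonneg_nonneg sum_nonneg) (auto intro: less_imp_le)

text \<open>Lets a cutoff defined through \<open>gbm\<close> also control the chain
  \<open>gam\<close>.\<close>

lemma gam_le_gbm: "0 < h \<Longrightarrow> 0 < \<beta> \<Longrightarrow> gam \<beta> h k \<omega> \<le> gbm (real k * h) \<omega>"
proof -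
  assume h: "0 < h" "0 < \<beta>"
  let ?d = "1 + \<beta> * h * (\<Sum>j<k. gbm (real j * h) \<omega>)"
  have "1 \<le> ?d" using h by (simp add: sum_nonneg less_imp_le)
  then show ?thesis unfolding gam_def
    using divide_left_mono[of 1 ?d "gbm (real k * h) \<omega>"] by (simp add: less_imp_le)
qed

lemma measurable_gam: "0 < h \<Longrightarrow> random_variable borel (gam \<beta> h k)"
  by (rule measurable_F[OF gam_adapted[of h k k]]) simp_all

lemma gam_lim:
  assumes t: "0 < t" and \<beta>: "0 < \<beta>"
  shows "AE \<omega> in M. (\<lambda>n. gam \<beta> (t / real (Suc n)) (Suc n) \<omega>) \<longlonglongrightarrow> gbm t \<omega> / (1 + \<beta> * integral {0..t} (\<lambda>s. gbm s \<omega>))"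
  using continuous_gbm[of t]
proof eventually_elim
  case (elim \<omega>)
  have R: "(\<lambda>n. \<Sum>k<Suc n. gbm (real k * (t / real (Suc n))) \<omega> * (t / real (Suc n))) \<longlonglongrightarrow> integral {0..t} (\<lambda>s. gbm s \<omega>)"
    by (rule left_riemann_sum_tendsto[OF t elim])
  have "0 \<le> integral {0..t} (\<lambda>s. gbm s \<omega>)"
    using integrable_continuous_interval[OF elim] by (rule integral_nonneg) (auto intro: less_imp_le)
  then have "0 \<le> \<beta> * integral {0..t} (\<lambda>s. gbm s \<omega>)" using \<beta> by simp
  then have ne: "1 + \<beta> * integral {0..t} (\<lambda>s. gbm s \<omega>) \<noteq> 0" by linarith
  have "(\<lambda>n. gbm t \<omega> / (1 + \<beta> * (\<Sum>k<Suc n. gbm (real k * (t / real (Suc n))) \<omega> * (t / real (Suc n)))))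
      \<longlonglongrightarrow> gbm t \<omega> / (1 + \<beta> * integral {0..t} (\<lambda>s. gbm s \<omega>))"
    by (intro tendsto_intros R ne)
  moreover have "gbm t \<omega> / (1 + \<beta> * (\<Sum>k<Suc n. gbm (real k * (t / real (Suc n))) \<omega> * (t / real (Suc n))))
      = gam \<beta> (t / real (Suc n)) (Suc n) \<omega>" for n
  proof -
    have "real (Suc n) * (t / real (Suc n)) = t" by simp
    moreover have "\<beta> * (t / real (Suc n)) * (\<Sum>j<Suc n. gbm (real j * (t / real (Suc n))) \<omega>)
        = \<beta> * (\<Sum>k<Suc n. gbm (real k * (t / real (Suc n))) \<omega> * (t / real (Suc n)))"
      unfolding sum_distrib_right[symmetric] by (simp only: ac_simps)
    ultimately show ?thesis unfolding gam_def by (simp only:)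
  qed
  ultimately show ?case by (simp only:)
qed

text \<open>One event for all grids at once: countably many conditions, hence measurable, and the
  same for every \<open>n\<close>, so that it can be held fixed while the grid is refined.\<close>

definition cutoff :: "real \<Rightarrow> real \<Rightarrow> 'a \<Rightarrow> ennreal" where
  "cutoff t m = indicator {\<omega> \<in> space M. \<forall>n k. k \<le> Suc n \<longrightarrow> gbm (real k * (t / real (Suc n))) \<omega> \<le> m}"

lemma cutoff_01: "cutoff t m \<omega> \<in> {0, 1}"
proof -
  have "indicator S \<omega> \<in> {0, 1 :: ennreal}" for S :: "'a set" by (simp add: indicator_def)
  then show ?thesis unfolding cutoff_def .
qed

lemma measurable_cutoff: "0 < t \<Longrightarrow> random_variable borel (cutoff t m)"
proof -
  assume "0 < t"
  then have [measurable]: "random_variable borel (gbm (real k * (t / real (Suc n))))" for k n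
    by (intro measurable_gbm) simp
  show ?thesis unfolding cutoff_def by measurable
qed

lemma cutoff_le: "cutoff t m \<omega> \<noteq> 0 \<Longrightarrow> k \<le> Suc n \<Longrightarrow> gbm (real k * (t / real (Suc n))) \<omega> \<le> m"
  by (auto simp: cutoff_def indicator_def split: if_splits)

text \<open>A continuous path is bounded on [0,t], and one bound serves the points of every
  grid.\<close>

lemma cutoff_exhaust:
  assumes t: "0 < t"
  shows "AE \<omega> in M. eventually (\<lambda>m. cutoff t (real m) \<omega> = 1) sequentially"
  using bounded_gbm[of t] AE_space
proof eventually_elim
  case (elim \<omega>)
  then obtain m0 :: nat where m0: "\<And>u. u \<in> {0..t} \<Longrightarrow> gbm u \<omega> \<le> real m0" by blast
  have "cutoff t (real m) \<omega> = 1" if m: "m0 \<le> m" for m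
  proof -
    have "gbm (real k * (t / real (Suc n))) \<omega> \<le> real m" if k: "k \<le> Suc n" for k n
    proof -
      have "real k * (t / real (Suc n)) \<le> real (Suc n) * (t / real (Suc n))"
        using k t by (intro mult_right_mono) auto
      then have "real k * (t / real (Suc n)) \<in> {0..t}" using t by simp
      from m0[OF this] m show ?thesis by simp
    qed
    then show ?thesis using elim by (simp add: cutoff_def del: of_nat_Suc)
  qed
  then show ?case unfolding eventually_sequentially by blast
qed

end

context hull_white
begin

text \<open>The sums against \<open>Z\<close> tend to - (\<beta> + \<rho> \<alpha>) (Y_t - 1), which
  the added endpoint term cancels; what survives is \<alpha> times the logarithm of X_t.
  \<open>A\<close> is a measurable version of the time integral.\<close>

lemma log_dens_lim:
  assumes t: "0 < t" and I: "ito_integral_is M (\<lambda>u \<omega>. exp (Z u \<omega> - u / 2)) W t I"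
    and Am: "random_variable borel A" and A: "AE \<omega> in M. A \<omega> = integral {0..t} (\<lambda>u. (Z.gbm u \<omega>)\<^sup>2)"
  shows "lim_in_prob M (\<lambda>n \<omega>. log_dens (mesh t n) (Suc n) \<omega> + (\<beta> + \<rho> * \<alpha>) * (Z.gbm t \<omega> - 1))
    (\<lambda>\<omega>. \<alpha> * I \<omega> - \<alpha> / 2 * A \<omega>)"
proof -
  let ?h = "mesh t" and ?c = "\<beta> + \<rho> * \<alpha>"
  have h: "0 < ?h n" "0 \<le> ?h n" for n using mesh(1)[OF t, of n] by auto
  have Im: "random_variable borel I" using I by (simp add: ito_integral_is_def)
  have gm: "random_variable borel (\<lambda>\<omega>. Z.gbm t \<omega> - 1)" using Z.measurable_gbm[of t] t by simp
  have Ym: "random_variable borel (Y (?h n) j)" for n j using h[of n] by (intro Z.measurable_gbm) simp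
  have lm: "random_variable borel (\<lambda>\<omega>. lam (?h n) (Y (?h n) j \<omega>))" for n j
    by (rule measurable_compose[OF Ym lam_measurable])
  have iW: "random_variable borel (inc W 0 (?h n) j)" and iZ: "random_variable borel (inc Z 0 (?h n) j)" for n j
    using h[of n] by (auto intro!: measurable_inc Z.measurable_inc)
  \<comment> \<open>The integral \<open>I\<close> is used along the indices \<open>Suc n\<close>,
    whose uniform partitions are the grids of spacing \<open>mesh t n\<close>.\<close>
  have W1: "lim_in_prob M (\<lambda>n \<omega>. \<Sum>j<Suc n. Y (?h n) j \<omega> * inc W 0 (?h n) j \<omega>) I"
  proof -
    have "riemann_sum (\<lambda>u \<omega>. exp (Z u \<omega> - u / 2)) W t (Suc n) = (\<lambda>\<omega>. \<Sum>j<Suc n. Y (?h n) j \<omega> * inc W 0 (?h n) j \<omega>)" for n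
      unfolding fun_eq_iff riemann_sum_def Z.gbm_def inc_def add_0 mesh_def[OF t] times_divide_eq_right by simp
    moreover have "lim_in_prob M (\<lambda>n. riemann_sum (\<lambda>u \<omega>. exp (Z u \<omega> - u / 2)) W t (Suc n)) I"
      using I lim_in_prob_subseq[OF _ filterlim_Suc] unfolding ito_integral_is_def by blast
    ultimately show ?thesis by (simp only:)
  qed
  have W2: "lim_in_prob M (\<lambda>n \<omega>. (\<Sum>j<Suc n. (lam (?h n) (Y (?h n) j \<omega>) - Y (?h n) j \<omega>) * inc W 0 (?h n) j \<omega>)
      + (\<Sum>j<Suc n. Y (?h n) j \<omega> * inc W 0 (?h n) j \<omega>)) (\<lambda>\<omega>. 0 + I \<omega>)"
    by (rule lim_in_prob_add[OF _ _ _ Im lam_error_lim[OF t brownian_axioms] W1];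
        intro borel_measurable_sum borel_measurable_times borel_measurable_diff borel_measurable_const lm Ym iW)
  have W3: "lim_in_prob M (\<lambda>n \<omega>. \<Sum>j<Suc n. lam (?h n) (Y (?h n) j \<omega>) * inc W 0 (?h n) j \<omega>) I"
    using W2 unfolding sum.distrib[symmetric] distrib_right[symmetric] by simp
  have Z2: "lim_in_prob M (\<lambda>n \<omega>. (\<Sum>j<Suc n. (lam (?h n) (Y (?h n) j \<omega>) - Y (?h n) j \<omega>) * inc Z 0 (?h n) j \<omega>)
      + (\<Sum>j<Suc n. Y (?h n) j \<omega> * inc Z 0 (?h n) j \<omega>)) (\<lambda>\<omega>. 0 + (Z.gbm t \<omega> - 1))"
    by (rule lim_in_prob_add[OF _ _ _ gm lam_error_lim[OF t Z.brownian_axioms] gbm_ito_lim[OF t]];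
        intro borel_measurable_sum borel_measurable_times borel_measurable_diff borel_measurable_const lm Ym iZ)
  have Z3: "lim_in_prob M (\<lambda>n \<omega>. \<Sum>j<Suc n. lam (?h n) (Y (?h n) j \<omega>) * inc Z 0 (?h n) j \<omega>) (\<lambda>\<omega>. Z.gbm t \<omega> - 1)"
    using Z2 unfolding sum.distrib[symmetric] distrib_right[symmetric] by simp
  have S3: "lim_in_prob M (\<lambda>n \<omega>. \<Sum>j<Suc n. (lam (?h n) (Y (?h n) j \<omega>))\<^sup>2 * ?h n) A"
  proof (rule lim_in_prob_AE[OF _ Am])
    show "AE \<omega> in M. (\<lambda>n. \<Sum>j<Suc n. (lam (?h n) (Y (?h n) j \<omega>))\<^sup>2 * ?h n) \<longlonglongrightarrow> A \<omega>"
      using lam_square_lim[OF t] A by eventually_elim simp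
  qed (intro borel_measurable_sum borel_measurable_times borel_measurable_power borel_measurable_const lm)
  have G: "lim_in_prob M (\<lambda>n \<omega>. Z.gbm t \<omega> - 1) (\<lambda>\<omega>. Z.gbm t \<omega> - 1)"
    by (rule lim_in_prob_AE[OF gm gm]) simp
  have "lim_in_prob M (\<lambda>n \<omega>. \<alpha> * (\<Sum>j<Suc n. lam (?h n) (Y (?h n) j \<omega>) * inc W 0 (?h n) j \<omega>)
      + ((- ?c) * (\<Sum>j<Suc n. lam (?h n) (Y (?h n) j \<omega>) * inc Z 0 (?h n) j \<omega>)
      + ((- (\<alpha> / 2)) * (\<Sum>j<Suc n. (lam (?h n) (Y (?h n) j \<omega>))\<^sup>2 * ?h n) + ?c * (Z.gbm t \<omega> - 1))))
    (\<lambda>\<omega>. \<alpha> * I \<omega> + ((- ?c) * (Z.gbm t \<omega> - 1) + ((- (\<alpha> / 2)) * A \<omega> + ?c * (Z.gbm t \<omega> - 1))))"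
    by (intro lim_in_prob_add lim_in_prob_cmult W3 Z3 S3 G borel_measurable_add
        borel_measurable_sum borel_measurable_times borel_measurable_power borel_measurable_const lm Im Am gm iW iZ)
  moreover have "\<alpha> * I \<omega> + ((- ?c) * (Z.gbm t \<omega> - 1) + ((- (\<alpha> / 2)) * A \<omega> + ?c * (Z.gbm t \<omega> - 1))) = \<alpha> * I \<omega> - \<alpha> / 2 * A \<omega>" for \<omega>
    by (simp add: algebra_simps)
  moreover have "\<alpha> * (\<Sum>j<Suc n. lam (?h n) (Y (?h n) j \<omega>) * inc W 0 (?h n) j \<omega>)
      + ((- ?c) * (\<Sum>j<Suc n. lam (?h n) (Y (?h n) j \<omega>) * inc Z 0 (?h n) j \<omega>)
      + ((- (\<alpha> / 2)) * (\<Sum>j<Suc n. (lam (?h n) (Y (?h n) j \<omega>))\<^sup>2 * ?h n) + ?c * (Z.gbm t \<omega> - 1)))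
    = log_dens (?h n) (Suc n) \<omega> + ?c * (Z.gbm t \<omega> - 1)" for n \<omega>
  proof -
    have "log_dens (?h n) (Suc n) \<omega> = (\<Sum>j<Suc n. \<alpha> * (lam (?h n) (Y (?h n) j \<omega>) * inc W 0 (?h n) j \<omega>)
       + ((- ?c) * (lam (?h n) (Y (?h n) j \<omega>) * inc Z 0 (?h n) j \<omega>) + (- (\<alpha> / 2)) * ((lam (?h n) (Y (?h n) j \<omega>))\<^sup>2 * ?h n)))"
      unfolding log_dens_def log_step_def by (intro sum.cong refl) (simp add: algebra_simps)
    then show ?thesis unfolding sum.distrib sum_distrib_left by linarith
  qed
  ultimately show ?thesis by (simp only:)
qed

end

section \<open>Equality of the two expectations\<close>

context hull_white
begin

text \<open>\<open>M\<close> and \<open>N\<close> are unrelated; they communicate only through the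
  numbers \<open>e n m\<close>, each of which is a killed grid expectation on either space.\<close>

lemma moment_identity:
  assumes t: "0 < t" and I: "ito_integral_is M (\<lambda>u \<omega>. exp (Z u \<omega> - u / 2)) W t I"
    and N: "brownian N G B"
  defines "c \<equiv> \<beta> + \<rho> * \<alpha>"
  shows "(\<integral>\<^sup>+\<omega>. ennreal (exp (\<alpha> * (I \<omega> - (1/2) * integral {0..t} (\<lambda>u. (Z.gbm u \<omega>)\<^sup>2)))) \<partial>M)
    = ennreal (exp (- c)) * (\<integral>\<^sup>+\<omega>. ennreal (exp (c * (brownian.gbm B t \<omega>
        / (1 + \<beta> * integral {0..t} (\<lambda>s. brownian.gbm B s \<omega>))))) \<partial>N)"
proof -
  interpret N: brownian N G B by (rule N)
  let ?h = "mesh t"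
  have h: "0 < ?h n" "real (Suc n) * ?h n = t" for n using mesh[OF t] by auto
  have hd: "?h n = t / real (Suc n)" for n by (rule mesh_def[OF t])
  have YS: "Y (?h n) (Suc n) = Z.gbm t" for n unfolding h(2) ..
  have ldm [measurable]: "random_variable borel (log_dens (?h n) k)" for n k
    by (rule measurable_F[OF log_dens_adapted[OF h(1)]])
  have bm [measurable]: "random_variable borel (below (?h n) m k)" for n m k
    by (rule measurable_F[OF below_adapted[OF h(1), of k k]]) simp
  have gtm [measurable]: "random_variable borel (Z.gbm t)" using t by (intro Z.measurable_gbm) simp
  have Ym [measurable]: "random_variable borel (Y (?h n) k)" for n k using h(1)[of n] by (intro Z.measurable_gbm) simp
  have Im [measurable]: "random_variable borel I" using I by (simp add: ito_integral_is_def)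
  have gamm [measurable]: "N.random_variable borel (N.gam \<beta> (?h n) k)" for n k
    by (rule N.measurable_gam[OF h(1)])

  \<comment> \<open>Paths are continuous only almost surely, so measurability of the time integral
    in \<open>\<omega>\<close> is not immediate. A limit of grid sums is measurable and agrees with
    the integral almost surely; \<open>\<Gamma>\<close> below is obtained in the same way.\<close>
  define A where "A \<omega> = lim (\<lambda>n. \<Sum>j<Suc n. (lam (?h n) (Y (?h n) j \<omega>))\<^sup>2 * ?h n)" for \<omega>
  have Am [measurable]: "random_variable borel A"
    unfolding A_def by (intro borel_measurable_lim_metric borel_measurable_sum) measurable
  have A: "AE \<omega> in M. A \<omega> = integral {0..t} (\<lambda>u. (Z.gbm u \<omega>)\<^sup>2)"
    using lam_square_lim[OF t] unfolding A_def by eventually_elim (rule limI)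
  define \<Gamma> where "\<Gamma> \<omega> = lim (\<lambda>n. N.gam \<beta> (?h n) (Suc n) \<omega>)" for \<omega>
  have \<Gamma>m [measurable]: "N.random_variable borel \<Gamma>"
    unfolding \<Gamma>_def by (intro borel_measurable_lim_metric) measurable
  have \<Gamma>: "AE \<omega> in N. \<Gamma> \<omega> = N.gbm t \<omega> / (1 + \<beta> * integral {0..t} (\<lambda>s. N.gbm s \<omega>))"
    using N.gam_lim[OF t \<beta>] unfolding \<Gamma>_def hd by eventually_elim (rule limI)
  have \<Gamma>lim: "AE \<omega> in N. (\<lambda>n. N.gam \<beta> (?h n) (Suc n) \<omega>) \<longlonglongrightarrow> \<Gamma> \<omega>"
    using N.gam_lim[OF t \<beta>] \<Gamma> unfolding hd by eventually_elim simp

  define V where "V n \<omega> = log_dens (?h n) (Suc n) \<omega> + c * (Z.gbm t \<omega> - 1)" for n \<omega>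
  define L where "L \<omega> = \<alpha> * I \<omega> - \<alpha> / 2 * A \<omega>" for \<omega>
  have Vm [measurable]: "random_variable borel (V n)" for n unfolding V_def by measurable
  have Lm [measurable]: "random_variable borel L" unfolding L_def by measurable
  have "lim_in_prob M V L"
    using log_dens_lim[OF t I Am A] unfolding V_def L_def c_def .
  \<comment> \<open>The subsequence found on \<open>M\<close> must be used on \<open>N\<close> as
    well, because the two sides are compared on the same grid.\<close>
  from lim_in_prob_AE_subseq[OF Vm Lm this] obtain r :: "nat \<Rightarrow> nat" where
    r: "strict_mono r" "AE \<omega> in M. (\<lambda>n. V (r n) \<omega>) \<longlonglongrightarrow> L \<omega>" by blast
  have Vlim: "AE \<omega> in M. (\<lambda>n. exp (V (r n) \<omega>)) \<longlonglongrightarrow> exp (L \<omega>)"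
    using r(2) by eventually_elim (rule tendsto_exp)
  define E where "E n \<omega> = exp (c * (N.gam \<beta> (?h n) (Suc n) \<omega> - 1))" for n \<omega>
  have Em [measurable]: "N.random_variable borel (E n)" for n unfolding E_def by measurable
  have Elim: "AE \<omega> in N. (\<lambda>n. E (r n) \<omega>) \<longlonglongrightarrow> exp (c * (\<Gamma> \<omega> - 1))"
    using \<Gamma>lim
  proof eventually_elim
    case (elim \<omega>)
    from LIMSEQ_subseq_LIMSEQ[OF elim r(1)]
    have "(\<lambda>n. N.gam \<beta> (?h (r n)) (Suc (r n)) \<omega>) \<longlonglongrightarrow> \<Gamma> \<omega>" by (simp add: comp_def)
    then show ?case unfolding E_def by (intro tendsto_intros)
  qed

  \<comment> \<open>The terminal function tests the endpoint too, so that in \<open>e\<close> all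
    positions 0 to \<open>Suc n\<close> are required to be at most \<open>m\<close>.\<close>
  define g where "g m y = ennreal (exp (c * (y - 1))) * indicator {..m} y" for m y :: real
  have gmeas: "g m \<in> borel_measurable borel" for m unfolding g_def by measurable
  define e where "e n m = (trans_op \<beta> (?h n) m ^^ Suc n) (g m) 1" for n m
  define CN where "CN n m \<omega> = ((\<Prod>j<Suc (Suc n). indicator {..m} (N.gam \<beta> (?h n) j \<omega>)) :: ennreal)" for n m \<omega>
  have eM: "e n m = (\<integral>\<^sup>+\<omega>. ennreal (exp (V n \<omega>)) * below (?h n) m (Suc (Suc n)) \<omega> \<partial>M)" for n m
    unfolding e_def chain_gbm[OF h(1) gmeas, symmetric] YS
  proof (rule nn_integral_cong)
    fix \<omega>
    have "below (?h n) m (Suc (Suc n)) \<omega> = below (?h n) m (Suc n) \<omega> * indicator {..m} (Z.gbm t \<omega>)"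
      unfolding below_def prod.lessThan_Suc[of _ "Suc n"] YS ..
    then show "ennreal (exp (log_dens (?h n) (Suc n) \<omega>)) * below (?h n) m (Suc n) \<omega> * g m (Z.gbm t \<omega>)
       = ennreal (exp (V n \<omega>)) * below (?h n) m (Suc (Suc n)) \<omega>"
      unfolding V_def g_def by (simp only: exp_add ennreal_mult[OF exp_ge_zero exp_ge_zero] ac_simps)
  qed
  have eN: "e n m = (\<integral>\<^sup>+\<omega>. ennreal (E n \<omega>) * CN n m \<omega> \<partial>N)" for n m
    unfolding e_def N.chain_gam[OF h(1) \<beta> gmeas, symmetric]
  proof (rule nn_integral_cong)
    fix \<omega>
    show "(\<Prod>j<Suc n. indicator {..m} (N.gam \<beta> (?h n) j \<omega>)) * g m (N.gam \<beta> (?h n) (Suc n) \<omega>) = ennreal (E n \<omega>) * CN n m \<omega>"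
      unfolding CN_def prod.lessThan_Suc[of _ "Suc n"] E_def g_def by (simp only: ac_simps)
  qed
  have prod1: "(\<Prod>j<k. indicator {..m} (f j)) = (1 :: ennreal)" if "\<And>j. j < k \<Longrightarrow> f j \<le> m" for k m and f :: "nat \<Rightarrow> real"
    using that by (intro prod.neutral) auto
  have prodle: "(\<Prod>j<Suc k. indicator {..m} (f j)) \<le> (indicator {..m} (f k) :: ennreal)" for k m and f :: "nat \<Rightarrow> real"
  proof -
    have "(\<Prod>j<k. indicator {..m} (f j)) \<le> (1 :: ennreal)" by (intro prod_le_1) (auto simp: indicator_def)
    then show ?thesis using mult_right_mono[of _ 1 "indicator {..m} (f k) :: ennreal"] by simp
  qed
  \<comment> \<open>The absolute value is needed because \<beta> + \<rho> \<alpha> may be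
    negative.\<close>
  have bound: "exp (d * (y - 1)) \<le> exp (\<bar>d\<bar> * (m + 1))" if "0 \<le> y" "y \<le> m" for d y m :: real
  proof -
    have "d * (y - 1) \<le> \<bar>d\<bar> * \<bar>y - 1\<bar>" unfolding abs_mult[symmetric] by (rule abs_ge_self)
    also have "\<dots> \<le> \<bar>d\<bar> * (m + 1)" using that by (intro mult_left_mono) auto
    finally show ?thesis by simp
  qed

  \<comment> \<open>On \<open>N\<close> the killed integrand is bounded by \<open>K\<close>, so
    truncating it at \<open>K\<close> costs nothing and bounded convergence applies; on
    \<open>M\<close> Fatou's lemma suffices.\<close>
  have M_le_N: "(\<integral>\<^sup>+\<omega>. ennreal (exp (L \<omega>)) * Z.cutoff t m \<omega> \<partial>M) \<le> (\<integral>\<^sup>+\<omega>. ennreal (exp (c * (\<Gamma> \<omega> - 1))) \<partial>N)" for m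
  proof -
    define K where "K = exp (\<bar>c\<bar> * (m + 1))"
    have "(\<integral>\<^sup>+\<omega>. ennreal (exp (L \<omega>)) * Z.cutoff t m \<omega> \<partial>M)
       \<le> liminf (\<lambda>n. \<integral>\<^sup>+\<omega>. ennreal (exp (V (r n) \<omega>)) * Z.cutoff t m \<omega> \<partial>M)"
      using Z.measurable_cutoff[OF t] by (intro nn_integral_Fatou_cutoff Z.cutoff_01 Vlim) measurable
    also have "\<dots> \<le> liminf (\<lambda>n. \<integral>\<^sup>+\<omega>. ennreal (min (E (r n) \<omega>) K) \<partial>N)"
    proof (intro Liminf_mono always_eventually allI)
      fix n
      have "(\<integral>\<^sup>+\<omega>. ennreal (exp (V (r n) \<omega>)) * Z.cutoff t m \<omega> \<partial>M) \<le> e (r n) m"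
        unfolding eM
      proof (intro nn_integral_mono mult_left_mono)
        fix \<omega>
        show "Z.cutoff t m \<omega> \<le> below (?h (r n)) m (Suc (Suc (r n))) \<omega>"
        proof (cases "Z.cutoff t m \<omega> = 0")
          case False
          then have "below (?h (r n)) m (Suc (Suc (r n))) \<omega> = 1"
            unfolding below_def by (intro prod1) (use Z.cutoff_le[of t m \<omega>] in \<open>auto simp: hd\<close>)
          then show ?thesis using Z.cutoff_01[of t m \<omega>] by auto
        qed simp
      qed simp
      also have "\<dots> \<le> (\<integral>\<^sup>+\<omega>. ennreal (min (E (r n) \<omega>) K) \<partial>N)"
        unfolding eN
      proof (rule nn_integral_mono)
        fix \<omega>
        let ?y = "N.gam \<beta> (?h (r n)) (Suc (r n)) \<omega>"
        have "ennreal (E (r n) \<omega>) * CN (r n) m \<omega> \<le> ennreal (E (r n) \<omega>) * indicator {..m} ?y"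
          unfolding CN_def by (intro mult_left_mono prodle) simp
        also have "\<dots> \<le> ennreal (min (E (r n) \<omega>) K)"
          using bound[OF N.gam_nonneg[OF h(1) \<beta>], of "r n" "Suc (r n)" \<omega> m c]
          by (cases "?y \<le> m") (auto simp: E_def K_def min_def)
        finally show "ennreal (E (r n) \<omega>) * CN (r n) m \<omega> \<le> ennreal (min (E (r n) \<omega>) K)" .
      qed
      finally show "(\<integral>\<^sup>+\<omega>. ennreal (exp (V (r n) \<omega>)) * Z.cutoff t m \<omega> \<partial>M) \<le> (\<integral>\<^sup>+\<omega>. ennreal (min (E (r n) \<omega>) K) \<partial>N)" .
    qed
    also have "\<dots> = (\<integral>\<^sup>+\<omega>. ennreal (min (exp (c * (\<Gamma> \<omega> - 1))) K) \<partial>N)"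
      by (rule lim_imp_Liminf[OF _ N.nn_integral_min_tendsto[OF _ _ Elim]]) simp_all
    also have "\<dots> \<le> (\<integral>\<^sup>+\<omega>. ennreal (exp (c * (\<Gamma> \<omega> - 1))) \<partial>N)"
      by (intro nn_integral_mono ennreal_leI) simp
    finally show ?thesis .
  qed

  \<comment> \<open>Fatou's lemma now acts on \<open>N\<close>. On \<open>M\<close> the killed
    density is bounded only in L2, so truncation at \<open>K\<close> leaves an error, which is kept
    below \<open>\<epsilon>\<close> uniformly in \<open>n\<close>.\<close>
  have N_le_M: "(\<integral>\<^sup>+\<omega>. ennreal (exp (c * (\<Gamma> \<omega> - 1))) * N.cutoff t m \<omega> \<partial>N) \<le> (\<integral>\<^sup>+\<omega>. ennreal (exp (L \<omega>)) \<partial>M)" for m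
  proof (rule ennreal_le_epsilon)
    fix \<epsilon> :: real assume \<epsilon>: "0 < \<epsilon>"
    \<comment> \<open>\<open>Q\<close> bounds the square of the endpoint factor, exp (2 c (Y_t -
      1)), when Y_t \<le> m. Together with \<open>dens_L2_bound\<close> this bounds the killed
      second moment, and \<open>K\<close> is that bound divided by
      \<open>\<epsilon>\<close>.\<close>
    define Q where "Q = exp (\<bar>2 * c\<bar> * (m + 1))"
    define K where "K = Q * exp (\<alpha> * m\<^sup>2 * t) / \<epsilon>"
    have K: "0 < K" "Q / K * exp (\<alpha> * m\<^sup>2 * t) = \<epsilon>" using \<epsilon> by (simp_all add: K_def Q_def)
    have e_le: "e n m \<le> (\<integral>\<^sup>+\<omega>. ennreal (min (exp (V n \<omega>)) K) \<partial>M) + ennreal \<epsilon>" for n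
    proof -
      have pt: "ennreal (exp (V n \<omega>)) * below (?h n) m (Suc (Suc n)) \<omega>
        \<le> ennreal (min (exp (V n \<omega>)) K) + ennreal (Q / K) * (ennreal (exp (2 * log_dens (?h n) (Suc n) \<omega>)) * below (?h n) m (Suc n) \<omega>)" for \<omega>
      proof (cases "below (?h n) m (Suc (Suc n)) \<omega> = 0")
        case False
        have nz: "below (?h n) m (Suc (Suc n)) \<omega> = below (?h n) m (Suc n) \<omega> * indicator {..m} (Z.gbm t \<omega>)"
          unfolding below_def prod.lessThan_Suc[of _ "Suc n"] YS ..
        with False have y: "Z.gbm t \<omega> \<le> m" and b: "below (?h n) m (Suc n) \<omega> \<noteq> 0" by (auto simp: indicator_def split: if_splits)
        have b1: "below (?h n) m (Suc n) \<omega> = 1"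
          using b unfolding below_def by (intro prod.neutral) (auto simp: indicator_def less_Suc_eq split: if_splits)
        \<comment> \<open>The elementary bound x \<le> min x K + x^2 / K for positive x.\<close>
        have v: "exp (V n \<omega>) \<le> min (exp (V n \<omega>)) K + exp (V n \<omega>) * exp (V n \<omega>) / K"
        proof (cases "exp (V n \<omega>) \<le> K")
          case False
          then have "exp (V n \<omega>) * K \<le> exp (V n \<omega>) * exp (V n \<omega>)" by (intro mult_left_mono) auto
          then have "exp (V n \<omega>) \<le> exp (V n \<omega>) * exp (V n \<omega>) / K" using K(1) by (simp add: pos_le_divide_eq)
          then show ?thesis using K(1) False by simp
        qed (use K(1) in simp)
        have "exp (V n \<omega>) * exp (V n \<omega>) = exp (2 * log_dens (?h n) (Suc n) \<omega>) * exp (2 * c * (Z.gbm t \<omega> - 1))"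
          unfolding exp_add[symmetric] V_def by (simp add: algebra_simps)
        also have "\<dots> \<le> exp (2 * log_dens (?h n) (Suc n) \<omega>) * Q"
          unfolding Q_def by (intro mult_left_mono bound) (use y in \<open>auto intro: less_imp_le\<close>)
        finally have "exp (V n \<omega>) * exp (V n \<omega>) / K \<le> exp (2 * log_dens (?h n) (Suc n) \<omega>) * Q / K"
          using K(1) by (intro divide_right_mono) auto
        with v have "exp (V n \<omega>) \<le> min (exp (V n \<omega>)) K + Q / K * exp (2 * log_dens (?h n) (Suc n) \<omega>)"
          by (simp add: mult.commute)
        then have "ennreal (exp (V n \<omega>)) \<le> ennreal (min (exp (V n \<omega>)) K + Q / K * exp (2 * log_dens (?h n) (Suc n) \<omega>))"
          by (rule ennreal_leI)
        also have "\<dots> = ennreal (min (exp (V n \<omega>)) K) + ennreal (Q / K) * ennreal (exp (2 * log_dens (?h n) (Suc n) \<omega>))"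
        proof -
          have q: "0 \<le> Q / K" using K(1) by (simp add: Q_def)
          have "0 \<le> min (exp (V n \<omega>)) K" using K(1) by simp
          then show ?thesis
            unfolding ennreal_mult[OF q exp_ge_zero, symmetric]
            by (intro ennreal_plus mult_nonneg_nonneg q exp_ge_zero)
        qed
        finally show ?thesis unfolding nz b1 using y by simp
      qed simp
      have "e n m \<le> (\<integral>\<^sup>+\<omega>. ennreal (min (exp (V n \<omega>)) K)
          + ennreal (Q / K) * (ennreal (exp (2 * log_dens (?h n) (Suc n) \<omega>)) * below (?h n) m (Suc n) \<omega>) \<partial>M)"
        unfolding eM by (rule nn_integral_mono) (rule pt)
      also have "\<dots> = (\<integral>\<^sup>+\<omega>. ennreal (min (exp (V n \<omega>)) K) \<partial>M)
          + ennreal (Q / K) * (\<integral>\<^sup>+\<omega>. ennreal (exp (2 * log_dens (?h n) (Suc n) \<omega>)) * below (?h n) m (Suc n) \<omega> \<partial>M)"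
        by (subst nn_integral_add) (auto simp: nn_integral_cmult)
      also have "\<dots> \<le> (\<integral>\<^sup>+\<omega>. ennreal (min (exp (V n \<omega>)) K) \<partial>M) + ennreal (Q / K) * ennreal (exp (\<alpha> * m\<^sup>2 * ?h n * real (Suc n)))"
        by (intro add_left_mono mult_left_mono dens_L2_bound h(1)) simp
      also have "\<alpha> * m\<^sup>2 * ?h n * real (Suc n) = \<alpha> * m\<^sup>2 * t"
      proof -
        have "\<alpha> * m\<^sup>2 * ?h n * real (Suc n) = \<alpha> * m\<^sup>2 * (real (Suc n) * ?h n)" by (simp only: ac_simps)
        then show ?thesis unfolding h(2) .
      qed
      also have "ennreal (Q / K) * ennreal (exp (\<alpha> * m\<^sup>2 * t)) = ennreal \<epsilon>"
        unfolding K(2)[symmetric] using K(1) by (intro ennreal_mult[symmetric]) (auto simp: Q_def)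
      finally show ?thesis .
    qed
    have "(\<integral>\<^sup>+\<omega>. ennreal (exp (c * (\<Gamma> \<omega> - 1))) * N.cutoff t m \<omega> \<partial>N)
       \<le> liminf (\<lambda>n. \<integral>\<^sup>+\<omega>. ennreal (E (r n) \<omega>) * N.cutoff t m \<omega> \<partial>N)"
      using N.measurable_cutoff[OF t] by (intro N.nn_integral_Fatou_cutoff N.cutoff_01 Elim) measurable
    also have "\<dots> \<le> liminf (\<lambda>n. (\<integral>\<^sup>+\<omega>. ennreal (min (exp (V (r n) \<omega>)) K) \<partial>M) + ennreal \<epsilon>)"
    proof (intro Liminf_mono always_eventually allI)
      fix n
      have "(\<integral>\<^sup>+\<omega>. ennreal (E (r n) \<omega>) * N.cutoff t m \<omega> \<partial>N) \<le> e (r n) m"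
        unfolding eN
      proof (intro nn_integral_mono mult_left_mono)
        fix \<omega>
        show "N.cutoff t m \<omega> \<le> CN (r n) m \<omega>"
        proof (cases "N.cutoff t m \<omega> = 0")
          case False
          have "N.gam \<beta> (?h (r n)) j \<omega> \<le> m" if "j < Suc (Suc (r n))" for j
            using N.gam_le_gbm[OF h(1) \<beta>, of "r n" j \<omega>] N.cutoff_le[OF False, of j "r n"] that unfolding hd by simp
          then have "CN (r n) m \<omega> = 1" unfolding CN_def by (rule prod1)
          then show ?thesis using N.cutoff_01[of t m \<omega>] by auto
        qed simp
      qed simp
      also note e_le
      finally show "(\<integral>\<^sup>+\<omega>. ennreal (E (r n) \<omega>) * N.cutoff t m \<omega> \<partial>N) \<le> (\<integral>\<^sup>+\<omega>. ennreal (min (exp (V (r n) \<omega>)) K) \<partial>M) + ennreal \<epsilon>" .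
    qed
    also have "\<dots> = (\<integral>\<^sup>+\<omega>. ennreal (min (exp (L \<omega>)) K) \<partial>M) + ennreal \<epsilon>"
      by (rule lim_imp_Liminf, simp, intro tendsto_add tendsto_const nn_integral_min_tendsto Vlim) measurable
    also have "\<dots> \<le> (\<integral>\<^sup>+\<omega>. ennreal (exp (L \<omega>)) \<partial>M) + ennreal \<epsilon>"
      by (intro add_right_mono nn_integral_mono ennreal_leI) simp
    finally show "(\<integral>\<^sup>+\<omega>. ennreal (exp (c * (\<Gamma> \<omega> - 1))) * N.cutoff t m \<omega> \<partial>N) \<le> (\<integral>\<^sup>+\<omega>. ennreal (exp (L \<omega>)) \<partial>M) + ennreal \<epsilon>" .
  qed

  have eq: "(\<integral>\<^sup>+\<omega>. ennreal (exp (L \<omega>)) \<partial>M) = (\<integral>\<^sup>+\<omega>. ennreal (exp (c * (\<Gamma> \<omega> - 1))) \<partial>N)"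
  proof (rule antisym)
    show "(\<integral>\<^sup>+\<omega>. ennreal (exp (L \<omega>)) \<partial>M) \<le> (\<integral>\<^sup>+\<omega>. ennreal (exp (c * (\<Gamma> \<omega> - 1))) \<partial>N)"
      by (rule nn_integral_le_of_cutoffs[OF _ Z.measurable_cutoff[OF t] Z.cutoff_exhaust[OF t] M_le_N]) measurable
    show "(\<integral>\<^sup>+\<omega>. ennreal (exp (c * (\<Gamma> \<omega> - 1))) \<partial>N) \<le> (\<integral>\<^sup>+\<omega>. ennreal (exp (L \<omega>)) \<partial>M)"
      by (rule N.nn_integral_le_of_cutoffs[OF _ N.measurable_cutoff[OF t] N.cutoff_exhaust[OF t] N_le_M]) measurable
  qed
  have "(\<integral>\<^sup>+\<omega>. ennreal (exp (\<alpha> * (I \<omega> - (1/2) * integral {0..t} (\<lambda>u. (Z.gbm u \<omega>)\<^sup>2)))) \<partial>M)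
      = (\<integral>\<^sup>+\<omega>. ennreal (exp (L \<omega>)) \<partial>M)"
  proof (rule nn_integral_cong_AE)
    show "AE \<omega> in M. ennreal (exp (\<alpha> * (I \<omega> - (1/2) * integral {0..t} (\<lambda>u. (Z.gbm u \<omega>)\<^sup>2)))) = ennreal (exp (L \<omega>))"
      using A by eventually_elim (simp add: L_def right_diff_distrib)
  qed
  also note eq
  also have "(\<integral>\<^sup>+\<omega>. ennreal (exp (c * (\<Gamma> \<omega> - 1))) \<partial>N) = (\<integral>\<^sup>+\<omega>. ennreal (exp (- c)) * ennreal (exp (c * \<Gamma> \<omega>)) \<partial>N)"
    by (intro nn_integral_cong) (simp add: algebra_simps flip: ennreal_mult exp_add)
  also have "\<dots> = ennreal (exp (- c)) * (\<integral>\<^sup>+\<omega>. ennreal (exp (c * \<Gamma> \<omega>)) \<partial>N)"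
    by (rule nn_integral_cmult) measurable
  also have "(\<integral>\<^sup>+\<omega>. ennreal (exp (c * \<Gamma> \<omega>)) \<partial>N)
      = (\<integral>\<^sup>+\<omega>. ennreal (exp (c * (N.gbm t \<omega> / (1 + \<beta> * integral {0..t} (\<lambda>s. N.gbm s \<omega>))))) \<partial>N)"
    by (rule nn_integral_cong_AE) (use \<Gamma> in \<open>eventually_elim, simp\<close>)
  finally show ?thesis .
qed

end

theorem theorem3p1:
  fixes M :: "'a measure" and F :: "real \<Rightarrow> 'a measure"
    and W Z :: "real \<Rightarrow> 'a \<Rightarrow> real" and \<rho> \<alpha> \<beta> t :: real
    and N :: "'b measure" and B :: "real \<Rightarrow> 'b \<Rightarrow> real"
    and I :: "'a \<Rightarrow> real"
  assumes "prob_space M" and "usual_conditions M F"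
    and "bm_filt M F W" and "bm_filt M F Z"
    and "\<rho> \<in> {-1..1}"
    and "\<forall>s\<ge>0. covariation_is M W Z s (\<lambda>\<omega>. \<rho> * s)"
    and "\<alpha> > 0" and "\<alpha> * (1 - \<rho>\<^sup>2) < 1"
    and "\<beta> = sqrt (\<alpha> - \<alpha>\<^sup>2 * (1 - \<rho>\<^sup>2))"
    and "prob_space N" and "standard_bm N B"
    and "t \<ge> 0"
    and "ito_integral_is M (\<lambda>u \<omega>. exp (Z u \<omega> - u / 2)) W t I"
  shows "(\<integral>\<^sup>+ \<omega>. ennreal (exp (\<alpha> * (I \<omega>
              - (1/2) * integral {0..t} (\<lambda>u. (exp (Z u \<omega> - u / 2))\<^sup>2)))) \<partial>M)
       = ennreal (exp (- (\<beta> + \<rho> * \<alpha>))) *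
         (\<integral>\<^sup>+ \<omega>. ennreal (exp ((\<beta> + \<rho> * \<alpha>) *
              (exp (B t \<omega> - t / 2) /
               (1 + \<beta> * integral {0..t} (\<lambda>s. exp (B s \<omega> - s / 2)))))) \<partial>N)"
proof -
  interpret prob_space M by fact
  have F: "filtration M F" using assms(2) by (simp add: usual_conditions_def)
  obtain G where G: "filtration N G" "bm_filt N G B" using assms(11) by (auto simp: standard_bm_def)
  have N: "brownian N G B" using assms(10) G by (simp add: brownian_def brownian_axioms_def)
  \<comment> \<open>The condition \<alpha> (1 - \<rho>^2) < 1 enters here: it makes the radicand,
    and so \<beta>, strictly positive.\<close>
  have pos: "0 < \<alpha> - \<alpha>\<^sup>2 * (1 - \<rho>\<^sup>2)"
  proof -
    have "\<alpha> * (\<alpha> * (1 - \<rho>\<^sup>2)) < \<alpha> * 1" using assms(7,8) by (intro mult_strict_left_mono)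
    then show ?thesis by (simp add: power2_eq_square mult.assoc)
  qed
  interpret hull_white M F W Z \<rho> \<alpha> \<beta>
  proof unfold_locales
    show "\<beta>\<^sup>2 = \<alpha> - \<alpha>\<^sup>2 * (1 - \<rho>\<^sup>2)" using pos assms(9) by simp
    show "0 < \<beta>" using pos assms(9) by simp
  qed (use F assms in auto)
  interpret N: brownian N G B by (rule N)
  show ?thesis
  \<comment> \<open>The grids need t > 0. At time 0 all Riemann sums vanish, so \<open>I\<close> is
    0 almost surely as the limit along a subsequence, and both sides are 1.\<close>
  proof (cases "t = 0")
    case False
    then have "0 < t" using assms(12) by simp
    from moment_identity[OF this assms(13) N] show ?thesis
      unfolding Z.gbm_def N.gbm_def .
  next
    case True
    have "lim_in_prob M (riemann_sum (\<lambda>u \<omega>. exp (Z u \<omega> - u / 2)) W 0) I" "random_variable borel I"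
      using assms(13) unfolding True ito_integral_is_def by auto
    moreover have "riemann_sum (\<lambda>u \<omega>. exp (Z u \<omega> - u / 2)) W 0 = (\<lambda>n \<omega>. 0)"
      by (simp add: riemann_sum_def fun_eq_iff)
    ultimately obtain r :: "nat \<Rightarrow> nat" where "AE \<omega> in M. (\<lambda>n. 0) \<longlonglongrightarrow> I \<omega>"
      using lim_in_prob_AE_subseq[of "\<lambda>n \<omega>. 0" I] by auto
    then have I: "AE \<omega> in M. I \<omega> = 0" by eventually_elim (simp add: LIMSEQ_const_iff)
    have B: "AE \<omega> in N. B 0 \<omega> = 0" using G(2) by (simp add: bm_filt_def)
    have "(\<integral>\<^sup>+ \<omega>. ennreal (exp (\<alpha> * (I \<omega> - (1/2) * integral {0..t} (\<lambda>u. (exp (Z u \<omega> - u / 2))\<^sup>2)))) \<partial>M)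
      = (\<integral>\<^sup>+ \<omega>. 1 \<partial>M)"
      by (rule nn_integral_cong_AE) (use I in \<open>eventually_elim, simp add: True\<close>)
    moreover have "(\<integral>\<^sup>+ \<omega>. ennreal (exp ((\<beta> + \<rho> * \<alpha>) * (exp (B t \<omega> - t / 2) / (1 + \<beta> * integral {0..t} (\<lambda>s. exp (B s \<omega> - s / 2)))))) \<partial>N)
      = (\<integral>\<^sup>+ \<omega>. ennreal (exp (\<beta> + \<rho> * \<alpha>)) \<partial>N)"
      by (rule nn_integral_cong_AE) (use B in \<open>eventually_elim, simp add: True\<close>)
    ultimately show ?thesis
      by (simp add: emeasure_space_1 N.emeasure_space_1 flip: ennreal_mult exp_add)
  qed
qed

end
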